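(* Let $d\ge 1$ be an integer and let $\gamma_1,\gamma_2,\gamma_3,p>0$. There is a constant $C>0$, depending only on $d,\gamma_1,\gamma_2,\gamma_3,p$, such that any function $u:Q_2\to\mathbb{R}$ belonging to $\mathcal{DG}^+(\gamma_1,\gamma_2,\gamma_3,p)$ and such that $u\le 1$ in $Q_{3/2}$ satisfies $$|\{u\le 0\}\cap Q_1^-|\;\bigl|\{u\ge \tfrac12\}\cap Q_1\bigr|\;\le\; C\,\bigl|\{0<u<\tfrac12\}\cap Q_2\bigr|^{\frac{1}{4p+2}}.$$
   Context: Points of $\mathbb{R}\times\mathbb{R}^d$ are written $(t,x)$. $B_r(x_0)\subset\mathbb{R}^d$ is the Euclidean ball of radius $r$ centered at $x_0$, $B_r=B_r(0)$, $Q_r=(-r^2,0]\times B_r$, and $Q_1^-=(-2,-1]\times B_1$. $|E|$ is the Lebesgue measure of $E$. $w_+=\max(w,0)$. Parabolic De Giorgi class: let $\mathcal{U}=(T_1,T_2)\times\Omega$ be an open set of $\mathbb{R}\times\mathbb{R}^d$. For non-negative parameters $\gamma_1,\gamma_2,\gamma_3$ and $p>0$, $\mathcal{DG}^+(\gamma_1,\gamma_2,\gamma_3,p)$ is the set of functions $u\in L^\infty((T_1,T_2);L^2(\Omega))\cap L^2((T_1,T_2);H^1(\Omega))$ such that for all $k\in\mathbb{R}$, all $s,t$ with $T_1\le s<t\le T_2$, all $R>r>0$ and all $x_0\in\Omega$ with $B_R(x_0)\subset\Omega$, $$\int_{B_r(x_0)}(u-k)_+^2(t,x)\,dx+\gamma_1\int_s^t\int_{B_r(x_0)}|\nabla_x(u-k)_+|^2(\tau,x)\,dx\,d\tau$$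 $$\le \int_{B_R(x_0)}(u-k)_+^2(s,x)\,dx+\frac{\gamma_2}{(R-r)^2}\int_s^t\int_{B_R(x_0)}(u-k)_+^2(\tau,x)\,dx\,d\tau+\gamma_3\left(\int_s^t\int_{B_R(x_0)}(u-k)_+^p(\tau,x)\,dx\,d\tau\right)^{1/p}.$$ For a function on $Q_2$ this is understood with $T_1=-4$, $T_2=0$, $\Omega=B_2$. *)

theory Defs
  imports "HOL-Analysis.Analysis"
begin

section \<open>Weak gradients\<close>

primrec Ck :: "nat \<Rightarrow> ('a::euclidean_space \<Rightarrow> real) \<Rightarrow> bool" where
  "Ck 0 f \<longleftrightarrow> continuous_on UNIV f"
| "Ck (Suc n) f \<longleftrightarrow> (\<forall>x. f differentiable (at x)) \<and>
     (\<forall>v. Ck n (\<lambda>x. frechet_derivative f (at x) v))"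

definition test_function :: "'a::euclidean_space set \<Rightarrow> ('a \<Rightarrow> real) \<Rightarrow> bool" where
  "test_function \<Omega> \<phi> \<longleftrightarrow>
     (\<forall>n. Ck n \<phi>) \<and> (\<exists>K. compact K \<and> K \<subseteq> \<Omega> \<and> (\<forall>x. x \<notin> K \<longrightarrow> \<phi> x = 0))"

definition is_weak_grad ::
  "'a::euclidean_space set \<Rightarrow> ('a \<Rightarrow> real) \<Rightarrow> ('a \<Rightarrow> 'a) \<Rightarrow> bool" where
  "is_weak_grad \<Omega> f G \<longleftrightarrow>
     (\<forall>K. compact K \<and> K \<subseteq> \<Omega> \<longrightarrow> f absolutely_integrable_on K \<and> G absolutely_integrable_on K) \<and>
     (\<forall>\<phi> v. test_function \<Omega> \<phi> \<longrightarrow>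
        (LINT x:\<Omega>|lebesgue. f x * frechet_derivative \<phi> (at x) v)
          = - (LINT x:\<Omega>|lebesgue. (G x \<bullet> v) * \<phi> x))"

text \<open>On an open set the weak gradient, when it exists, is unique up to a null set, so integrals of
  the following function do not depend on the choice.\<close>

definition weak_grad :: "'a::euclidean_space set \<Rightarrow> ('a \<Rightarrow> real) \<Rightarrow> 'a \<Rightarrow> 'a" where
  "weak_grad \<Omega> f = (SOME G. is_weak_grad \<Omega> f G)"

section \<open>Bochner spaces\<close>

text \<open>A strongly measurable map from an interval into the separable space \<open>L\<^sup>2(\<Omega>)\<close>
  (or \<open>H\<^sup>1(\<Omega>)\<close>) is represented by a function of \<open>(t,x)\<close>
  that is jointly measurable (together with its spatial weak gradient).\<close>

definition Linf_L2 :: "real \<Rightarrow> real \<Rightarrow> 'a::euclidean_space set \<Rightarrow> (real \<times> 'a \<Rightarrow> real) \<Rightarrow> bool" where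
  "Linf_L2 T1 T2 \<Omega> u \<longleftrightarrow>
     u \<in> borel_measurable (lebesgue_on ({T1<..<T2} \<times> \<Omega>)) \<and>
     (\<exists>C::real. AE t in lebesgue_on {T1<..<T2}.
        (\<integral>\<^sup>+x\<in>\<Omega>. ennreal ((u (t, x))\<^sup>2) \<partial>lebesgue) \<le> ennreal C)"

definition L2_H1 :: "real \<Rightarrow> real \<Rightarrow> 'a::euclidean_space set \<Rightarrow> (real \<times> 'a \<Rightarrow> real) \<Rightarrow> bool" where
  "L2_H1 T1 T2 \<Omega> u \<longleftrightarrow>
     (\<exists>G :: real \<times> 'a \<Rightarrow> 'a.
        u \<in> borel_measurable (lebesgue_on ({T1<..<T2} \<times> \<Omega>)) \<and>
        G \<in> borel_measurable (lebesgue_on ({T1<..<T2} \<times> \<Omega>)) \<and>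
        (AE t in lebesgue_on {T1<..<T2}. is_weak_grad \<Omega> (\<lambda>x. u (t, x)) (\<lambda>x. G (t, x))) \<and>
        (\<integral>\<^sup>+t\<in>{T1<..<T2}.
           (\<integral>\<^sup>+x\<in>\<Omega>. ennreal ((u (t, x))\<^sup>2 + (norm (G (t, x)))\<^sup>2) \<partial>lebesgue) \<partial>lebesgue) < \<infinity>)"

section \<open>The parabolic De Giorgi class\<close>

text \<open>Only used with \<open>q > 0\<close>.\<close>

definition ennreal_powr :: "ennreal \<Rightarrow> real \<Rightarrow> ennreal" where
  "ennreal_powr a q = (if a = \<infinity> then \<infinity> else ennreal (enn2real a powr q))"

definition trunc :: "(real \<times> 'a \<Rightarrow> real) \<Rightarrow> real \<Rightarrow> real \<Rightarrow> 'a \<Rightarrow> real" where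
  "trunc u k t x = max (u (t, x) - k) 0"

text \<open>The inequality is imposed at every time of \<open>[T1,T2]\<close>, not just at almost every time; for its
  integrals to make sense every time slice has to be measurable. Both sides may be infinite, hence
  the use of \<^typ>\<open>ennreal\<close>. For a function given on \<open>(T1,T2] \<times> \<Omega>\<close> the inequality with
  \<open>s = T1\<close> is no restriction: extend it to time \<open>T1\<close> by a measurable function whose positive
  truncations are square integrable on no ball.\<close>

definition DG_plus ::
  "real \<Rightarrow> real \<Rightarrow> 'a::euclidean_space set \<Rightarrow> real \<Rightarrow> real \<Rightarrow> real \<Rightarrow> real \<Rightarrow> (real \<times> 'a \<Rightarrow> real) set" where
  "DG_plus T1 T2 \<Omega> \<gamma>1 \<gamma>2 \<gamma>3 p = {u.
     Linf_L2 T1 T2 \<Omega> u \<and> L2_H1 T1 T2 \<Omega> u \<and>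
     (\<forall>t\<in>{T1..T2}. (\<lambda>x. u (t, x)) \<in> borel_measurable (lebesgue_on \<Omega>)) \<and>
     (\<forall>k s t r R x0. T1 \<le> s \<and> s < t \<and> t \<le> T2 \<and> 0 < r \<and> r < R \<and> x0 \<in> \<Omega> \<and> ball x0 R \<subseteq> \<Omega> \<longrightarrow>
        (\<integral>\<^sup>+x\<in>ball x0 r. ennreal ((trunc u k t x)\<^sup>2) \<partial>lebesgue)
        + ennreal \<gamma>1 * (\<integral>\<^sup>+\<tau>\<in>{s..t}. (\<integral>\<^sup>+x\<in>ball x0 r.
             ennreal ((norm (weak_grad \<Omega> (trunc u k \<tau>) x))\<^sup>2) \<partial>lebesgue) \<partial>lebesgue)
        \<le> (\<integral>\<^sup>+x\<in>ball x0 R. ennreal ((trunc u k s x)\<^sup>2) \<partial>lebesgue)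
        + ennreal (\<gamma>2 / (R - r)\<^sup>2) * (\<integral>\<^sup>+\<tau>\<in>{s..t}. (\<integral>\<^sup>+x\<in>ball x0 R.
             ennreal ((trunc u k \<tau> x)\<^sup>2) \<partial>lebesgue) \<partial>lebesgue)
        + ennreal \<gamma>3 * ennreal_powr (\<integral>\<^sup>+\<tau>\<in>{s..t}. (\<integral>\<^sup>+x\<in>ball x0 R.
             ennreal (trunc u k \<tau> x powr p) \<partial>lebesgue) \<partial>lebesgue) (1 / p))}"

section \<open>Cylinders\<close>

definition Q :: "real \<Rightarrow> (real \<times> 'a::euclidean_space) set" where
  "Q r = {- r\<^sup>2<..0} \<times> ball 0 r"

definition Q1_minus :: "(real \<times> 'a::euclidean_space) set" where
  "Q1_minus = {-2<..-1} \<times> ball 0 1"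

end

theory Submission
  imports Defs
begin

text \<open>The proof gives the inequality with every exponent \<open>\<theta> \<le> 1/2\<close>. Let \<open>\<epsilon>\<close> be the measure of the
  intermediate set. At almost every time De Giorgi's isoperimetric inequality bounds
  \<open>|{u \<le> 0}| |{u \<ge> 1/2}|\<close> on a ball by the square root of the measure of the intermediate slice times
  the slice energy \<open>\<integral> |\<nabla>u\<^sub>+|\<^sup>2\<close>. The energy inequality with \<open>k = 0\<close> bounds the time integral of the latter,
  so the product of the two measures has time integral \<open>O(sqrt \<epsilon>)\<close>.
  Hence, outside a set of times of measure \<open>O(sqrt \<epsilon>)\<close>, either \<open>{u \<le> 0}\<close> or \<open>{u \<ge> 1/2}\<close> is negligible in
  the ball. By the energy inequality again, \<open>u\<^sub>+\<close> cannot pass from the second alternative to the first within a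
  fixed time \<open>\<tau>\<close>. If \<open>\<epsilon>\<close> is so small that the exceptional times have measure less than \<open>\<tau>/2\<close>, the passage
  never happens. So either \<open>{u \<le> 0}\<close> is negligible at almost all earlier times or \<open>{u \<ge> 1/2}\<close> at
  almost all later ones. If \<open>\<epsilon>\<close> is not small there is nothing to prove.\<close>

section \<open>Test functions\<close>

text \<open>The gradient in the energy inequality, \<open>weak_grad\<close>, is an arbitrary choice
  made separately for each truncation and each time. It need not be jointly measurable in (t,x), and
  its link with a gradient of \<open>u\<close> is only distributional. This obstacle shapes the
  preparation: a calculus of weak gradients resting on one identity. For fixed h and almost every x,
  the increment w(x+h) - w(x) is the mean of the directional derivative over the segment. Difference
  quotients then give the chain rule, and integration over all shifts h gives the isoperimetric
  inequality. Three radii 1 < 5/4 < 3/2 are used. Slices are studied in the ball of radius 5/4. The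
  gap up to 3/2, where u \<le> 1 is known, pays for the gradient bound. The gap down to 1 pays for
  the comparison of two times. The square root comes from Cauchy-Schwarz, in space and then in time.
  As \<epsilon> is bounded by the volume of the cylinder, smaller exponents follow from 1/2.\<close>

lemma Ck_imp_continuous: "Ck n f \<Longrightarrow> continuous_on UNIV f"
  using differentiable_imp_continuous_on[of f UNIV] by (cases n) (auto simp: differentiable_on_def)

lemma Ck_Suc_imp: "Ck (Suc n) f \<Longrightarrow> Ck n f"
proof (induction n arbitrary: f)
  case 0 then show ?case using Ck_imp_continuous[OF 0] by simp
next
  case (Suc n) then show ?case by (auto simp del: Ck.simps(1))
qed

lemma Ck_const: "Ck n (\<lambda>x. c)"
  by (induction n arbitrary: c) auto

lemma frechet_derivative_apply:
  "(f has_derivative f') (at x) \<Longrightarrow> frechet_derivative f (at x) v = f' v"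
  using frechet_derivative_at by metis

abbreviation dderiv :: "('a::euclidean_space \<Rightarrow> real) \<Rightarrow> 'a \<Rightarrow> 'a \<Rightarrow> real" where
  "dderiv \<phi> v \<equiv> \<lambda>x. frechet_derivative \<phi> (at x) v"

lemma Ck_SucI:
  assumes "\<And>x. (f has_derivative D x) (at x)" and "\<And>v. Ck n (\<lambda>x. D x v)"
  shows "Ck (Suc n) f"
  using assms by (auto simp: frechet_derivative_apply[OF assms(1)] differentiable_def)

lemma Ck_SucD:
  assumes "Ck (Suc n) f"
  shows "(f has_derivative frechet_derivative f (at x)) (at x)" "Ck n (\<lambda>x. frechet_derivative f (at x) v)"
  using assms frechet_derivative_works by auto

lemma Ck_add: "Ck n f \<Longrightarrow> Ck n g \<Longrightarrow> Ck n (\<lambda>x. f x + g x)"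
proof (induction n arbitrary: f g)
  case 0 then show ?case by (auto intro: continuous_on_add)
next
  case (Suc n)
  show ?case
    by (rule Ck_SucI[OF has_derivative_add[OF Ck_SucD(1)[OF Suc.prems(1)] Ck_SucD(1)[OF Suc.prems(2)]]])
      (intro Suc.IH Ck_SucD(2) Suc.prems)
qed

lemma Ck_mult: "Ck n f \<Longrightarrow> Ck n g \<Longrightarrow> Ck n (\<lambda>x. f x * g x)"
proof (induction n arbitrary: f g)
  case 0 then show ?case by (auto intro: continuous_on_mult)
next
  case (Suc n)
  show ?case
    by (rule Ck_SucI[OF has_derivative_mult[OF Ck_SucD(1)[OF Suc.prems(1)] Ck_SucD(1)[OF Suc.prems(2)]]])
      (intro Suc.IH Ck_add Ck_SucD(2) Suc.prems Ck_Suc_imp[OF Suc.prems(1)] Ck_Suc_imp[OF Suc.prems(2)])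
qed

lemma Ck_prod: "(\<And>i. i \<in> I \<Longrightarrow> Ck n (f i)) \<Longrightarrow> Ck n (\<lambda>x. \<Prod>i\<in>I. f i x)"
  by (induction I rule: infinite_finite_induct) (auto simp: Ck_const intro!: Ck_mult)

lemma Ck_translate: "Ck n f \<Longrightarrow> Ck n (\<lambda>x. f (x - h))"
proof (induction n arbitrary: f)
  case 0 
  then have "continuous_on UNIV f" by simp
  then have "continuous_on UNIV (\<lambda>x. f (x - h))"
    by (rule continuous_on_compose2) (auto intro!: continuous_intros)
  then show ?case by simp
next
  case (Suc n)
  show ?case
    by (rule Ck_SucI[OF has_derivative_compose[OF _ Ck_SucD(1)[OF Suc.prems]]])
      (auto intro!: derivative_eq_intros Suc.IH simp: Ck_SucD(2)[OF Suc.prems])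
qed

lemma Ck_affine: "Ck n (\<lambda>x. x \<bullet> a + b)"
proof (cases n)
  case (Suc m)
  show ?thesis unfolding Suc
    by (rule Ck_SucI[where D="\<lambda>_ h. h \<bullet> a"]) (auto intro!: derivative_eq_intros Ck_const)
qed (auto intro!: continuous_intros)

text \<open>The derivatives of \<open>t \<mapsto> exp (-c/t)\<close> are of the form \<open>P (1/t) exp (-c/t)\<close> with \<open>P\<close> a polynomial.\<close>

definition flat :: "real \<Rightarrow> real poly \<Rightarrow> real \<Rightarrow> real" where
  "flat c P t = (if t > 0 then poly P (1 / t) * exp (- c / t) else 0)"

text \<open>With y = 1/t one has d/dt = -y^2 d/dy, so P(y) exp(-c y) has t-derivative y^2 (c P - P')
  exp(-c y). The list polynomial is y^2.\<close>

definition flat_step :: "real \<Rightarrow> real poly \<Rightarrow> real poly" where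
  "flat_step c P = [:0, 0, 1:] * (smult c P - pderiv P)"

lemma poly_times_exp_tendsto_0:
  fixes P :: "real poly" assumes "c > 0"
  shows "((\<lambda>x. poly P x * exp (- c * x)) \<longlongrightarrow> 0) at_top"
proof -
  have mono: "((\<lambda>x. x ^ i * exp (- c * x)) \<longlongrightarrow> 0) at_top" for i :: nat
  proof -
    have "((\<lambda>x. (1/c)^i * ((c * x) ^ i / exp (c * x))) \<longlongrightarrow> (1/c)^i * 0) at_top" (is "(?f \<longlongrightarrow> _) _")
      by (intro tendsto_intros filterlim_compose[OF tendsto_power_div_exp_0]
          filterlim_tendsto_pos_mult_at_top[OF tendsto_const assms] filterlim_ident)
    moreover have "?f = (\<lambda>x. x ^ i * exp (- c * x))"
      using assms by (auto simp: exp_minus field_simps power_mult_distrib power_divide)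
    ultimately show ?thesis by simp
  qed
  have "((\<lambda>x. \<Sum>i\<le>degree P. coeff P i * (x ^ i * exp (- c * x))) \<longlongrightarrow> (\<Sum>i\<le>degree P. coeff P i * 0)) at_top"
    by (intro tendsto_intros mono)
  then show ?thesis by (simp add: poly_altdef sum_distrib_right mult.assoc)
qed

lemma flat_has_derivative:
  assumes "c > 0"
  shows "(flat c P has_real_derivative flat c (flat_step c P) t) (at t)"
proof (cases t "0::real" rule: linorder_cases)
  case less
  have "((\<lambda>_. 0) has_real_derivative 0) (at t)" by simp
  then have "(flat c P has_real_derivative 0) (at t)"
    by (rule has_field_derivative_transform_within_open[where S="{..<0}"]) (use less in \<open>auto simp: flat_def\<close>)
  then show ?thesis using less by (simp add: flat_def)
next
  case greater
  have "((\<lambda>t. poly P (1 / t) * exp (- c / t)) has_real_derivative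
      poly (flat_step c P) (1 / t) * exp (- c / t)) (at t)"
    using greater
    by (auto intro!: derivative_eq_intros simp: flat_step_def field_simps power2_eq_square)
  then have "(flat c P has_real_derivative poly (flat_step c P) (1 / t) * exp (- c / t)) (at t)"
    by (rule has_field_derivative_transform_within_open[where S="{0<..}"]) (use greater in \<open>auto simp: flat_def\<close>)
  then show ?thesis using greater by (simp add: flat_def)
next
  case equal
  \<comment> \<open>At the origin the difference quotient from the right is (1/h) P(1/h) exp(-c/h).
    The factor \<open>[:0,1:]\<close> is its 1/h, and the substitution y = 1/h moves the limit to
    infinity, where the exponential wins.\<close>
  have "((\<lambda>y. poly ([:0,1:] * P) y * exp (- c * y)) \<longlongrightarrow> 0) at_top"
    by (rule poly_times_exp_tendsto_0[OF assms])
  then have "((\<lambda>h. poly ([:0,1:] * P) (inverse h) * exp (- c * inverse h)) \<longlongrightarrow> 0) (at_right 0)"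
    by (rule filterlim_compose) (rule filterlim_inverse_at_top_right)
  then have r: "((\<lambda>h. (flat c P h - flat c P 0) / (h - 0)) \<longlongrightarrow> 0) (at_right 0)"
    by (rule Lim_transform_eventually) (auto simp: eventually_at_filter flat_def field_simps)
  have "((\<lambda>h. 0) \<longlongrightarrow> (0::real)) (at_left 0)" by simp
  then have l: "((\<lambda>h. (flat c P h - flat c P 0) / (h - 0)) \<longlongrightarrow> 0) (at_left 0)"
    by (rule Lim_transform_eventually) (auto simp: eventually_at_filter flat_def)
  have "((\<lambda>h. (flat c P h - flat c P 0) / (h - 0)) \<longlongrightarrow> 0) (at 0)"
    using l r filterlim_at_split by blast
  then show ?thesis unfolding equal by (simp add: has_field_derivative_iff flat_def)
qed

text \<open>A directional derivative of \<open>flat c P\<close> composed with \<open>q\<close> is a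
  function of the same form, with \<open>flat_step c P\<close> for \<open>P\<close>, times a
  directional derivative of \<open>q\<close>. The induction therefore runs over all \<open>P\<close>
  at once.\<close>

lemma Ck_flat:
  assumes "c > 0" and "\<And>n. Ck n q"
  shows "Ck n (\<lambda>x. flat c P (q x))"
proof (induction n arbitrary: P)
  case 0
  have "continuous_on UNIV (flat c P)"
    using flat_has_derivative[OF assms(1)] by (meson DERIV_isCont continuous_at_imp_continuous_on)
  then have "continuous_on UNIV (\<lambda>x. flat c P (q x))"
    by (rule continuous_on_compose2) (use assms(2)[of 0] in auto)
  then show ?case by simp
next
  case (Suc n)
  have d: "(q has_derivative frechet_derivative q (at x)) (at x)" for x
    using Ck_SucD(1)[OF assms(2)] by blast
  have "((\<lambda>x. flat c P (q x)) has_derivative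
      (\<lambda>v. frechet_derivative q (at x) v * flat c (flat_step c P) (q x))) (at x)" for x
    using has_derivative_compose[OF d flat_has_derivative[OF assms(1), THEN has_field_derivative_imp_has_derivative]]
    by (simp add: mult.commute)
  then show ?case
    by (rule Ck_SucI) (intro Ck_mult Suc Ck_SucD(2) assms(2))
qed

text \<open>All these functions live on the same box, whatever \<open>c\<close> is. As c tends to 0
  they increase to the indicator of the open box, so indicators are reached without convolution. The
  reflected form of the upper constraint makes both arguments affine functions of the shape treated
  by \<open>Ck_affine\<close>.\<close>

definition box_bump :: "'a::euclidean_space \<Rightarrow> 'a \<Rightarrow> real \<Rightarrow> 'a \<Rightarrow> real" where
  "box_bump a b c x = (\<Prod>i\<in>Basis. flat c 1 (x \<bullet> i + - (a \<bullet> i)) * flat c 1 (x \<bullet> - i + b \<bullet> i))"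

lemma flat_1_bounds: "c > 0 \<Longrightarrow> 0 \<le> flat c 1 t \<and> flat c 1 t \<le> 1"
  by (auto simp: flat_def)

lemma box_bump_bounds: "c > 0 \<Longrightarrow> 0 \<le> box_bump a b c x \<and> box_bump a b c x \<le> 1"
  unfolding box_bump_def using flat_1_bounds[of c]
  by (auto intro!: prod_nonneg prod_le_1 mult_le_one)

lemma box_bump_eq_0:
  assumes "x \<notin> box a b" shows "box_bump a b c x = 0"
proof -
  from assms obtain i where "i \<in> Basis" "\<not> (a \<bullet> i < x \<bullet> i \<and> x \<bullet> i < b \<bullet> i)"
    by (auto simp: mem_box)
  then show ?thesis
    unfolding box_bump_def by (intro prod_zero) (auto simp: flat_def intro!: bexI[of _ i])
qed

lemma test_function_box_bump:
  assumes "c > 0" "cbox a b \<subseteq> \<Omega>" shows "test_function \<Omega> (box_bump a b c)"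
proof -
  have "Ck n (box_bump a b c)" for n
    unfolding box_bump_def by (intro Ck_prod Ck_mult Ck_flat assms Ck_affine)
  moreover have "x \<notin> cbox a b \<Longrightarrow> box_bump a b c x = 0" for x
    using box_bump_eq_0 box_subset_cbox by blast
  ultimately have "compact (cbox a b) \<and> cbox a b \<subseteq> \<Omega> \<and> (\<forall>x. x \<notin> cbox a b \<longrightarrow> box_bump a b c x = 0)"
    "\<forall>n. Ck n (box_bump a b c)"
    using assms(2) by auto
  then show ?thesis unfolding test_function_def by (intro conjI exI[of _ "cbox a b"]) simp_all
qed

lemma box_bump_tendsto:
  "(\<lambda>n. box_bump a b (1 / Suc n) x) \<longlonglongrightarrow> indicat_real (box a b) x"
proof (cases "x \<in> box a b")
  case True
  have f: "(\<lambda>n. flat (1 / Suc n) 1 t) \<longlonglongrightarrow> 1" if "t > 0" for t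
  proof -
    have "(\<lambda>n. exp (- (1 / Suc n) / t)) \<longlonglongrightarrow> exp (- 0 / t)"
      by (intro tendsto_intros LIMSEQ_Suc[OF lim_1_over_n]) (use that in auto)
    then show ?thesis using that by (simp add: flat_def)
  qed
  have "(\<lambda>n. box_bump a b (1 / Suc n) x) \<longlonglongrightarrow> (\<Prod>i\<in>(Basis::'a set). 1 * 1)"
    unfolding box_bump_def using True
    by (intro tendsto_prod tendsto_mult f) (auto simp: mem_box)
  then show ?thesis using True by simp
qed (simp add: box_bump_eq_0)

lemma test_function_translate:
  assumes "test_function \<Omega> \<phi>" "\<And>x. x \<in> \<Omega> \<Longrightarrow> x + h \<in> \<Omega>'"
  shows "test_function \<Omega>' (\<lambda>x. \<phi> (x - h))"
proof -
  obtain K where K: "compact K" "K \<subseteq> \<Omega>" "\<And>x. x \<notin> K \<Longrightarrow> \<phi> x = 0"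
    using assms unfolding test_function_def by blast
  have "compact ((\<lambda>x. x + h) ` K)" by (intro compact_continuous_image K continuous_intros)
  moreover have "\<phi> (x - h) = 0" if "x \<notin> (\<lambda>x. x + h) ` K" for x
    using K(3)[of "x - h"] that by (metis diff_add_cancel image_eqI)
  moreover have "(\<lambda>x. x + h) ` K \<subseteq> \<Omega>'" using K assms(2) by auto
  ultimately show ?thesis
    using assms(1) Ck_translate unfolding test_function_def by blast
qed

lemma test_functionD:
  assumes "test_function \<Omega> \<phi>"
  shows "(\<phi> has_derivative frechet_derivative \<phi> (at x)) (at x)" "continuous_on UNIV \<phi>"
    "continuous_on UNIV (dderiv \<phi> v)"
proof -
  have C: "Ck 1 \<phi>" using assms unfolding test_function_def by blast
  then show "(\<phi> has_derivative frechet_derivative \<phi> (at x)) (at x)" "continuous_on UNIV \<phi>"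
    "continuous_on UNIV (dderiv \<phi> v)"
    using Ck_imp_continuous[OF C] by (auto simp: frechet_derivative_works[symmetric])
qed

lemma test_function_measurable:
  assumes "test_function \<Omega> \<phi>"
  shows "\<phi> \<in> borel_measurable borel" "dderiv \<phi> v \<in> borel_measurable borel"
  using test_functionD[OF assms] by (intro borel_measurable_continuous_onI; blast)+

lemma test_functionE:
  assumes "test_function \<Omega> \<phi>"
  obtains K where "compact K" "K \<subseteq> \<Omega>" "\<And>x. x \<notin> K \<Longrightarrow> \<phi> x = 0" "\<And>x v. x \<notin> K \<Longrightarrow> dderiv \<phi> v x = 0"
proof -
  obtain K where K: "compact K" "K \<subseteq> \<Omega>" "\<And>x. x \<notin> K \<Longrightarrow> \<phi> x = 0"
    using assms unfolding test_function_def by blast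
  have "dderiv \<phi> v x = 0" if "x \<notin> K" for x v
  proof -
    have "((\<lambda>_. 0) has_derivative (\<lambda>_. 0)) (at x)" by simp
    then have "(\<phi> has_derivative (\<lambda>_. 0)) (at x)"
      by (rule has_derivative_transform_within_open[where s="- K"])
        (use that K in \<open>auto simp: compact_imp_closed open_Compl\<close>)
    then show ?thesis by (simp add: frechet_derivative_apply)
  qed
  with K show thesis by (rule that)
qed

lemma continuous_compact_support_bounded:
  fixes f :: "'a::euclidean_space \<Rightarrow> real"
  assumes "continuous_on UNIV f" "compact K" "\<And>x. x \<notin> K \<Longrightarrow> f x = 0"
  obtains M where "M \<ge> 0" "\<And>x. \<bar>f x\<bar> \<le> M"
proof -
  have "bounded (f ` K)" using assms by (meson compact_continuous_image compact_imp_bounded continuous_on_subset subset_UNIV)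
  then obtain M where "M > 0" "\<And>x. x \<in> K \<Longrightarrow> \<bar>f x\<bar> \<le> M" unfolding bounded_pos by auto
  then show thesis using that[of M] assms(3) by (metis abs_zero less_eq_real_def)
qed

lemma test_function_bounded:
  assumes "test_function \<Omega> \<phi>" obtains C where "C \<ge> 0" "\<And>x. \<bar>\<phi> x\<bar> \<le> C"
  by (rule test_functionE[OF assms]) (metis continuous_compact_support_bounded test_functionD(2)[OF assms] that)

lemma test_function_dderiv_bounded:
  assumes "test_function \<Omega> \<phi>" obtains C where "C \<ge> 0" "\<And>x. \<bar>dderiv \<phi> v x\<bar> \<le> C"
proof -
  obtain K where "compact K" "\<And>x. x \<notin> K \<Longrightarrow> dderiv \<phi> v x = 0" using test_functionE[OF assms] by metis
  from continuous_compact_support_bounded[OF test_functionD(3)[OF assms] this] show thesis using that by blast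
qed

section \<open>Translations and the fundamental lemma\<close>

lemma nn_integral_lborel_translate:
  assumes "f \<in> borel_measurable borel"
  shows "(\<integral>\<^sup>+x. f (x + h :: 'a::euclidean_space) \<partial>lborel) = (\<integral>\<^sup>+x. f x \<partial>lborel)"
proof -
  have "(\<integral>\<^sup>+x. f x \<partial>lborel) = (\<integral>\<^sup>+x. f x \<partial>distr lborel borel ((+) h))"
    by (simp add: lborel_distr_plus)
  also have "\<dots> = (\<integral>\<^sup>+x. f (h + x) \<partial>lborel)"
    using assms by (subst nn_integral_distr) auto
  finally show ?thesis by (simp add: add.commute)
qed

lemma integral_lborel_translate:
  fixes f :: "'a::euclidean_space \<Rightarrow> 'b::{banach, second_countable_topology}"
  assumes "f \<in> borel_measurable borel"
  shows "(LBINT x. f (x + h)) = (LBINT x. f x)"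
proof -
  have "(LBINT x. f x) = (\<integral>x. f x \<partial>distr lborel borel ((+) h))"
    by (simp add: lborel_distr_plus)
  also have "\<dots> = (LBINT x. f (h + x))"
    using assms by (subst integral_distr) auto
  finally show ?thesis by (simp add: add.commute)
qed

lemma integrable_lborel_translate:
  fixes f :: "'a::euclidean_space \<Rightarrow> 'b::{banach, second_countable_topology}"
  assumes "integrable lborel f"
  shows "integrable lborel (\<lambda>x. f (x + h))"
proof -
  have "integrable (distr lborel borel ((+) h)) f"
    using assms by (simp add: lborel_distr_plus)
  then have "integrable lborel (\<lambda>x. f (h + x))"
    by (subst (asm) integrable_distr_eq) (use assms in auto)
  then show ?thesis by (simp add: add.commute)
qed

section \<open>The fundamental lemma of the calculus of variations\<close>

lemma set_integral_box_zero:
  fixes f :: "'a::euclidean_space \<Rightarrow> real"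
  assumes [measurable]: "f \<in> borel_measurable borel"
    and int: "set_integrable lborel (cbox a b) f"
    and zero: "\<And>\<phi>. test_function \<Omega> \<phi> \<Longrightarrow> (LBINT x. f x * \<phi> x) = 0"
    and sub: "cbox a b \<subseteq> \<Omega>"
  shows "(\<integral>x\<in>box a b. f x \<partial>lborel) = 0"
proof -
  have m: "box_bump a b (1 / real (Suc n)) \<in> borel_measurable borel" for n
    by (rule test_function_measurable(1)[OF test_function_box_bump[OF _ subset_UNIV]]) simp
  have "(\<lambda>n. LBINT x. f x * box_bump a b (1 / Suc n) x)
      \<longlonglongrightarrow> (LBINT x. f x * indicator (box a b) x)"
  proof (rule integral_dominated_convergence[where w="\<lambda>x. indicator (cbox a b) x *\<^sub>R \<bar>f x\<bar>"])
    show "integrable lborel (\<lambda>x. indicat_real (cbox a b) x *\<^sub>R \<bar>f x\<bar>)"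
      using set_integrable_abs[OF int] by (simp add: set_integrable_def)
    show "AE x in lborel. (\<lambda>n. f x * box_bump a b (1 / Suc n) x) \<longlonglongrightarrow> f x * indicator (box a b) x"
      by (intro AE_I2 tendsto_intros box_bump_tendsto)
    fix n
    have "norm (f x * box_bump a b (1 / Suc n) x) \<le> indicat_real (cbox a b) x *\<^sub>R \<bar>f x\<bar>" for x
      using box_bump_bounds[of "1 / Suc n" a b x] box_bump_eq_0[of x a b "1 / Suc n"] box_subset_cbox[of a b]
      by (cases "x \<in> cbox a b"; cases "x \<in> box a b") (auto simp: abs_mult intro!: mult_left_le)
    then show "AE x in lborel. norm (f x * box_bump a b (1 / Suc n) x) \<le> indicat_real (cbox a b) x *\<^sub>R \<bar>f x\<bar>"
      by auto
    show "(\<lambda>x. f x * box_bump a b (1 / real (Suc n)) x) \<in> borel_measurable lborel"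
      using m by measurable
  qed auto
  moreover have "(LBINT x. f x * box_bump a b (1 / Suc n) x) = 0" for n
    by (intro zero test_function_box_bump sub) auto
  ultimately have "(LBINT x. f x * indicator (box a b) x) = 0"
    by (simp add: LIMSEQ_const_iff)
  then show ?thesis by (simp add: set_lebesgue_integral_def mult.commute)
qed

text \<open>Integrals over boxes vanish by approximation with bumps. Boxes form an
  intersection-stable generator of the Borel sets, so integrals over all Borel sets vanish, and a
  density with this property is zero.\<close>

lemma test_function_AE_zero_box:
  fixes f :: "'a::euclidean_space \<Rightarrow> real"
  assumes meas[measurable]: "f \<in> borel_measurable borel"
    and int: "set_integrable lborel (cbox a b) f"
    and zero: "\<And>\<phi>. test_function \<Omega> \<phi> \<Longrightarrow> (LBINT x. f x * \<phi> x) = 0"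
    and sub: "cbox a b \<subseteq> \<Omega>"
  shows "AE x in lborel. x \<in> box a b \<longrightarrow> f x = 0"
proof -
  \<comment> \<open>Cutting \<open>f\<close> off makes it integrable on the whole space with total
    integral zero, as needed for complements in the Dynkin argument.\<close>
  define g where "g x = indicat_real (box a b) x * f x" for x
  have g: "integrable lborel g"
    using set_integrable_subset[OF int _ box_subset_cbox] unfolding g_def set_integrable_def by simp
  have box: "(\<integral>x\<in>box c d. g x \<partial>lborel) = 0" for c d
  proof -
    obtain c' d' where cd: "box c d \<inter> box a b = box c' d'"
      by (rule that[OF box_Int_box])
    have eq: "(\<integral>x\<in>box c d. g x \<partial>lborel) = (\<integral>x\<in>box c' d'. f x \<partial>lborel)"
      unfolding set_lebesgue_integral_def g_def cd[symmetric]
      by (intro Bochner_Integration.integral_cong) (auto simp: indicator_def)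
    show ?thesis
    proof (cases "box c' d' = {}")
      case True then show ?thesis unfolding eq by (simp add: set_lebesgue_integral_def)
    next
      case False
      then have "cbox c' d' = closure (box c' d')" by (simp add: closure_box)
      also have "\<dots> \<subseteq> cbox a b" unfolding cd[symmetric] using box_subset_cbox
        by (metis closed_cbox closure_minimal inf.coboundedI2)
      finally have "cbox c' d' \<subseteq> cbox a b" .
      then show ?thesis unfolding eq
        by (intro set_integral_box_zero[where \<Omega>=\<Omega>] meas zero set_integrable_subset[OF int]) (use sub in auto)
    qed
  qed
  have si: "set_integrable lborel A g" if "A \<in> sets borel" for A
    using g that unfolding set_integrable_def by (intro integrable_mult_indicator) auto
  have tot: "(LBINT x. g x) = 0"
  proof -
    have "(LBINT x. g x) = (\<integral>x\<in>box a b. g x \<partial>lborel)"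
      unfolding set_lebesgue_integral_def g_def
      by (intro Bochner_Integration.integral_cong) (auto simp: indicator_def)
    then show ?thesis using box by simp
  qed
  have "(\<integral>x\<in>A. g x \<partial>lborel) = 0" if A: "A \<in> sets borel" for A
  proof -
    let ?G = "range (\<lambda>(a, b). box a b :: 'a set)"
    have sig: "sigma_sets UNIV ?G = sets borel" by (subst borel_eq_box) simp
    have "Int_stable ?G"
      unfolding Int_stable_def by (auto simp: box_Int_box)
    moreover have "?G \<subseteq> Pow UNIV" by simp
    moreover have "A \<in> sigma_sets UNIV ?G" using A sig by simp
    ultimately show ?thesis
    proof (induction rule: sigma_sets_induct_disjoint)
      case (basic A) then show ?case using box by auto
    next
      case empty show ?case by (simp add: set_lebesgue_integral_def)
    next
      case (compl A)
      then have A: "A \<in> sets borel" using sig by simp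
      have "(\<integral>x\<in>A \<union> (UNIV - A). g x \<partial>lborel) = (\<integral>x\<in>A. g x \<partial>lborel) + (\<integral>x\<in>UNIV - A. g x \<partial>lborel)"
        using A by (intro set_integral_Un si) auto
      then show ?case using compl tot by (simp add: set_lebesgue_integral_def)
    next
      case (union F)
      then have F: "F i \<in> sets borel" for i using sig by auto
      have "(\<integral>x\<in>(\<Union>i. F i). g x \<partial>lborel) = (\<Sum>i. (\<integral>x\<in>F i. g x \<partial>lborel))"
        using union(1) F by (intro lebesgue_integral_countable_add si) (auto simp: disjoint_family_on_def)
      then show ?case using union by simp
    qed
  qed
  then have "AE x in lborel. g x = 0"
    by (intro density_unique_real[OF g]) (auto simp: set_lebesgue_integral_def)
  then show ?thesis by eventually_elim (auto simp: g_def)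
qed

text \<open>Integrability is only local, so the statement is glued from countably many closed boxes
  covering \<Omega>. Their boundaries are null sets.\<close>

lemma test_function_AE_zero:
  fixes f :: "'a::euclidean_space \<Rightarrow> real"
  assumes "open \<Omega>" and meas: "f \<in> borel_measurable borel"
    and int: "\<And>K. compact K \<Longrightarrow> K \<subseteq> \<Omega> \<Longrightarrow> set_integrable lborel K f"
    and zero: "\<And>\<phi>. test_function \<Omega> \<phi> \<Longrightarrow> (LBINT x. f x * \<phi> x) = 0"
  shows "AE x in lborel. x \<in> \<Omega> \<longrightarrow> f x = 0"
proof -
  obtain D :: "'a set set" where D: "countable D" "\<And>X. X \<in> D \<Longrightarrow> X \<subseteq> \<Omega>"
    "\<And>X. X \<in> D \<Longrightarrow> \<exists>a b. X = cbox a b" "\<Union>D = \<Omega>"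
    by (rule open_countable_Union_open_cbox[OF assms(1)]) (rule that, assumption, auto)
  have "AE x in lborel. \<forall>X\<in>D. x \<in> X \<longrightarrow> f x = 0"
  proof (rule AE_ball_countable[THEN iffD2, OF D(1)], rule ballI)
    fix X assume X: "X \<in> D"
    then obtain a b where ab: "X = cbox a b" "cbox a b \<subseteq> \<Omega>" using D by metis
    have 1: "AE x in lborel. x \<in> box a b \<longrightarrow> f x = 0"
      by (rule test_function_AE_zero_box[OF meas int zero ab(2)]) (use ab in auto)
    have "negligible (cbox a b - box a b)" by (rule negligible_frontier_interval)
    then have "AE x in lebesgue. x \<notin> cbox a b - box a b"
      unfolding negligible_iff_null_sets by (rule AE_not_in)
    then have "AE x in lborel. x \<notin> cbox a b - box a b"
      unfolding AE_completion_iff .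
    with 1 show "AE x in lborel. x \<in> X \<longrightarrow> f x = 0"
      unfolding ab by eventually_elim auto
  qed
  then show ?thesis using D(4) by (auto elim!: eventually_mono)
qed

section \<open>Continuity of translations in L1\<close>

lemma lborel_approx_compact_open:
  fixes A :: "'a::euclidean_space set"
  assumes A[measurable]: "A \<in> sets borel" and fin: "emeasure lborel A < \<infinity>" and e: "e > 0"
  obtains K U where "compact K" "open U" "K \<subseteq> A" "A \<subseteq> U"
    "emeasure lborel (A - K) < ennreal e" "emeasure lborel (U - A) < ennreal e"
proof -
  obtain U where U: "open U" "A \<subseteq> U" "emeasure lborel (U - A) < ennreal e"
    using outer_regular_lborel[OF A e] by metis
  have AL: "A \<in> sets lebesgue" using A by simp
  obtain T where T: "closed T" "T \<subseteq> A" "A - T \<in> lmeasurable" "emeasure lebesgue (A - T) < ennreal (e/2)"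
    using sets_lebesgue_inner_closed[OF AL, of "e/2"] e by auto
  \<comment> \<open>The closed set \<open>T\<close> inside \<open>A\<close> may be unbounded. Since
    \<open>A\<close> has finite measure, the part outside a large ball is small, and intersecting
    \<open>T\<close> with that ball makes it compact.\<close>
  define B where "B n = A - cball 0 (real n)" for n
  have [measurable]: "B n \<in> sets borel" for n unfolding B_def by simp
  have "(\<lambda>n. emeasure lborel (B n)) \<longlonglongrightarrow> emeasure lborel (\<Inter>n. B n)"
  proof (rule Lim_emeasure_decseq)
    show "range B \<subseteq> sets lborel" by auto
    show "decseq B" unfolding B_def by (auto simp: decseq_def)
    show "emeasure lborel (B i) \<noteq> \<infinity>" for i
      using emeasure_mono[of "B i" A lborel] fin by (auto simp: B_def top_unique)
  qed
  moreover have "(\<Inter>n. B n) = {}"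
    using real_arch_simple by (auto simp: B_def)
  ultimately have "(\<lambda>n. emeasure lborel (B n)) \<longlonglongrightarrow> 0" by simp
  then have "eventually (\<lambda>n. emeasure lborel (B n) < ennreal (e/2)) sequentially"
    by (rule order_tendstoD) (use e in auto)
  then obtain N where N: "emeasure lborel (B N) < ennreal (e/2)"
    by (meson eventually_sequentially order_refl)
  define K where "K = T \<inter> cball 0 (real N)"
  have Tb: "T \<in> sets borel" using T(1) by auto
  have "emeasure lborel (A - K) \<le> emeasure lborel ((A - T) \<union> B N)"
    by (rule emeasure_mono) (use Tb in \<open>auto simp: K_def B_def\<close>)
  also have "\<dots> \<le> emeasure lborel (A - T) + emeasure lborel (B N)"
    by (rule emeasure_subadditive) (use Tb in auto)
  also have "emeasure lborel (A - T) = emeasure lebesgue (A - T)"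
    using Tb by simp
  also have "emeasure lebesgue (A - T) + emeasure lborel (B N) < ennreal (e/2) + ennreal (e/2)"
    by (rule add_strict_mono) (use T N in auto)
  also have "\<dots> = ennreal e" using e by (simp flip: ennreal_plus)
  finally have "emeasure lborel (A - K) < ennreal e" .
  moreover have "compact K" unfolding K_def using T by (simp add: closed_Int_compact)
  ultimately show thesis using that[of K U] U T(2) by (auto simp: K_def)
qed

text \<open>With \<open>K \<subseteq> A \<subseteq> U\<close> as above, a small translation maps \<open>K\<close> into \<open>U\<close>, so
  \<open>A\<close> and its translate differ only inside translates of \<open>A - K\<close> and \<open>U - A\<close>.\<close>

lemma translation_L1_continuous:
  fixes f :: "'a::euclidean_space \<Rightarrow> real"
  assumes "integrable lborel f" "e > 0"
  shows "\<exists>d>0. \<forall>h. norm h < d \<longrightarrow> (LBINT x. \<bar>f (x + h) - f x\<bar>) < e"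
  using assms
proof (induction arbitrary: e rule: integrable_induct)
  case (base A c)
  then have [measurable]: "A \<in> sets borel" by simp
  show ?case
  proof (cases "c = 0")
    case True then show ?thesis using base by (auto intro!: exI[of _ 1])
  next
    case False
    \<comment> \<open>Four error sets of measure below \<open>r\<close> contribute, each weighted by
      \<bar>c\<bar>. The total is at most 4/5 of \<open>e\<close>.\<close>
    define r where "r = e / (5 * \<bar>c\<bar>)"
    have r: "r > 0" using False base by (simp add: r_def)
    obtain K U where KU: "compact K" "open U" "K \<subseteq> A" "A \<subseteq> U"
      "emeasure lborel (A - K) < ennreal r" "emeasure lborel (U - A) < ennreal r"
      using lborel_approx_compact_open[of A r] base r by auto
    have [measurable]: "K \<in> sets borel" "U \<in> sets borel" using KU by (auto intro: borel_compact)
    have fm: "emeasure lborel (A - K) < \<infinity>" "emeasure lborel (U - A) < \<infinity>" 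
      using KU(5,6) by (auto intro: order.strict_trans)
    have ml: "measure lborel (A - K) < r" "measure lborel (U - A) < r"
      using KU(5,6) r fm by (auto simp: emeasure_eq_ennreal_measure ennreal_less_iff)
    obtain d where d: "d > 0" "\<And>x y. x \<in> K \<Longrightarrow> y \<in> - U \<Longrightarrow> d \<le> dist x y"
      using separate_compact_closed[of K "- U"] KU(1-4) by (metis closed_Compl disjoint_eq_subset_Compl double_compl order_trans)
    have i: "integrable lborel (indicat_real (A - K))" "integrable lborel (indicat_real (U - A))"
      using fm by (auto simp: less_top)
    note ti = i[THEN integrable_lborel_translate]
    have "(LBINT x. \<bar>indicator A (x + h) *\<^sub>R c - indicator A x *\<^sub>R c\<bar>) < e" if h: "norm h < d" for h
    proof -
      have "\<bar>indicator A (x + h) *\<^sub>R c - indicator A x *\<^sub>R c\<bar> \<le>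
          \<bar>c\<bar> * (indicator (A - K) x + indicator (U - A) x + indicator (A - K) (x + h) + indicator (U - A) (x + h))" for x
      proof -
        have "x \<in> K \<Longrightarrow> x + h \<in> U" "x + h \<in> K \<Longrightarrow> x \<in> U"
          using d(2)[of x "x + h"] d(2)[of "x + h" x] h by (auto simp: dist_norm)
        then show ?thesis by (auto simp: indicator_def)
      qed
      then have "(LBINT x. \<bar>indicator A (x + h) *\<^sub>R c - indicator A x *\<^sub>R c\<bar>) \<le>
        (LBINT x. \<bar>c\<bar> * (indicat_real (A - K) x + indicator (U - A) x + indicator (A - K) (x + h) + indicator (U - A) (x + h)))"
        using i ti by (intro Bochner_Integration.integral_mono') (auto intro!: integrable_mult_right Bochner_Integration.integrable_add)
      also have "\<dots> = \<bar>c\<bar> * (measure lborel (A - K) + measure lborel (U - A) + measure lborel (A - K) + measure lborel (U - A))"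
        using i ti integral_lborel_translate[of "indicat_real (A - K)" h] integral_lborel_translate[of "indicat_real (U - A)" h]
        by simp
      also have "\<dots> \<le> \<bar>c\<bar> * (4 * r)" using ml by (intro mult_left_mono) auto
      also have "\<dots> < e" using False base by (simp add: r_def field_simps)
      finally show ?thesis .
    qed
    then show ?thesis using d(1) by auto
  qed
next
  case (add f g)
  have "e / 2 > 0" using add by simp
  from add.IH(1)[OF this] add.IH(2)[OF this] obtain d1 d2 where "d1 > 0 \<and> (\<forall>h. norm h < d1 \<longrightarrow> (LBINT x. \<bar>f (x + h) - f x\<bar>) < e/2)"
    and "d2 > 0 \<and> (\<forall>h. norm h < d2 \<longrightarrow> (LBINT x. \<bar>g (x + h) - g x\<bar>) < e/2)" by (elim exE)
  then have d: "d1 > 0" "d2 > 0"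
    "\<And>h. norm h < d1 \<Longrightarrow> (LBINT x. \<bar>f (x + h) - f x\<bar>) < e/2"
    "\<And>h. norm h < d2 \<Longrightarrow> (LBINT x. \<bar>g (x + h) - g x\<bar>) < e/2" by simp_all
  note ti = add.hyps(1,2)[THEN integrable_lborel_translate]
  have "(LBINT x. \<bar>f (x + h) + g (x + h) - (f x + g x)\<bar>) < e" if "norm h < min d1 d2" for h
  proof -
    have "(LBINT x. \<bar>f (x + h) + g (x + h) - (f x + g x)\<bar>) \<le>
      (LBINT x. \<bar>f (x + h) - f x\<bar> + \<bar>g (x + h) - g x\<bar>)"
      using add.hyps ti by (intro Bochner_Integration.integral_mono) auto
    also have "\<dots> = (LBINT x. \<bar>f (x + h) - f x\<bar>) + (LBINT x. \<bar>g (x + h) - g x\<bar>)"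
      using add.hyps ti by (intro Bochner_Integration.integral_add) auto
    also have "\<dots> < e" using d(3)[of h] d(4)[of h] that by simp
    finally show ?thesis .
  qed
  then show ?case using d by (intro exI[of _ "min d1 d2"]) auto
next
  case (lim f s)
  have [measurable]: "f \<in> borel_measurable lborel" "s i \<in> borel_measurable lborel" for i
    using lim.hyps by auto
  have "(\<lambda>i. LBINT x. \<bar>s i x - f x\<bar>) \<longlonglongrightarrow> (\<integral>x. 0 \<partial>(lborel :: 'a measure))"
  \<comment> \<open>The approximants satisfy \<bar>s i x\<bar> \<le> 2 \<bar>f x\<bar>, whence the
    factor 3.\<close>
  proof (rule integral_dominated_convergence[where w="\<lambda>x. 3 * norm (f x)"])
    show "AE x in lborel. (\<lambda>i. \<bar>s i x - f x\<bar>) \<longlonglongrightarrow> 0"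
      using lim.hyps(2) by (auto intro!: tendsto_rabs_zero simp: LIM_zero)
    show "AE x in lborel. norm \<bar>s i x - f x\<bar> \<le> 3 * norm (f x)" for i
    proof (rule AE_I2)
      fix x :: 'a show "norm \<bar>s i x - f x\<bar> \<le> 3 * norm (f x)"
        using lim.hyps(3)[of x i] by simp
    qed
  qed (use lim.hyps in auto)
  then have "eventually (\<lambda>i. (LBINT x. \<bar>s i x - f x\<bar>) < e/3) sequentially"
    by (intro order_tendstoD(2)[of _ 0]) (use lim.prems in auto)
  then obtain i where i: "(LBINT x. \<bar>s i x - f x\<bar>) < e/3"
    by (meson eventually_sequentially order_refl)
  obtain d where d: "d > 0" "\<And>h. norm h < d \<Longrightarrow> (LBINT x. \<bar>s i (x + h) - s i x\<bar>) < e/3"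
    using lim.IH[of "e/3" i] lim.prems by auto
  note hi = lim.hyps(1)[of i] lim.hyps(4)
  note ti = hi[THEN integrable_lborel_translate]
  have "(LBINT x. \<bar>f (x + h) - f x\<bar>) < e" if "norm h < d" for h
  proof -
    have 0: "integrable lborel (\<lambda>x. \<bar>s i x - f x\<bar>)" "integrable lborel (\<lambda>x. \<bar>s i (x + h) - f (x + h)\<bar>)"
      "integrable lborel (\<lambda>x. \<bar>s i (x + h) - s i x\<bar>)"
      using hi ti by auto
    have "(LBINT x. \<bar>f (x + h) - f x\<bar>) \<le>
      (LBINT x. \<bar>s i (x + h) - f (x + h)\<bar> + \<bar>s i x - f x\<bar> + \<bar>s i (x + h) - s i x\<bar>)"
      using hi ti 0 by (intro Bochner_Integration.integral_mono) auto
    also have "\<dots> = (LBINT x. \<bar>s i x - f x\<bar>) + (LBINT x. \<bar>s i x - f x\<bar>) + (LBINT x. \<bar>s i (x + h) - s i x\<bar>)"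
      using 0 integral_lborel_translate[of "\<lambda>x. \<bar>s i x - f x\<bar>" h] by simp
    also have "\<dots> < e" using d(2)[OF that] i by simp
    finally show ?thesis .
  qed
  then show ?case using d(1) by blast
qed

section \<open>Weak gradients\<close>

text \<open>The same notion for Borel functions and \<open>lborel\<close>, where translations and
  Fubini apply directly. The integrals run over the whole space: a test function and its derivatives
  vanish outside a compact subset of \<Omega>, so values of \<open>w\<close> and \<open>G\<close>
  off \<Omega> do not matter.\<close>

definition borel_weak_grad :: "'a::euclidean_space set \<Rightarrow> ('a \<Rightarrow> real) \<Rightarrow> ('a \<Rightarrow> 'a) \<Rightarrow> bool" where
  "borel_weak_grad \<Omega> w G \<longleftrightarrow> w \<in> borel_measurable borel \<and> G \<in> borel_measurable borel \<and>
     (\<forall>K. compact K \<longrightarrow> K \<subseteq> \<Omega> \<longrightarrow> set_integrable lborel K w \<and> set_integrable lborel K G) \<and>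
     (\<forall>\<phi> v. test_function \<Omega> \<phi> \<longrightarrow>
        (LBINT x. w x * dderiv \<phi> v x) = - (LBINT x. (G x \<bullet> v) * \<phi> x))"

lemma borel_weak_gradD:
  assumes "borel_weak_grad \<Omega> w G"
  shows "w \<in> borel_measurable borel" "G \<in> borel_measurable borel"
    "compact K \<Longrightarrow> K \<subseteq> \<Omega> \<Longrightarrow> set_integrable lborel K w"
    "compact K \<Longrightarrow> K \<subseteq> \<Omega> \<Longrightarrow> set_integrable lborel K G"
    "test_function \<Omega> \<phi> \<Longrightarrow>
      (LBINT x. w x * dderiv \<phi> v x) = - (LBINT x. (G x \<bullet> v) * \<phi> x)"
  using assms unfolding borel_weak_grad_def by blast+

lemma set_integrable_lebesgue_iff_lborel:
  fixes f :: "'a::euclidean_space \<Rightarrow> 'b::{banach, second_countable_topology}"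
  assumes "f \<in> borel_measurable borel" "K \<in> sets borel"
  shows "set_integrable lebesgue K f \<longleftrightarrow> set_integrable lborel K f"
proof -
  note [measurable] = assms
  have "(\<lambda>x. indicat_real K x *\<^sub>R f x) \<in> borel_measurable lborel" by measurable
  then show ?thesis unfolding set_integrable_def by (rule integrable_completion)
qed

lemma set_integral_lebesgue_eq_lborel:
  fixes f :: "'a::euclidean_space \<Rightarrow> real"
  assumes "f \<in> borel_measurable borel" "\<And>x. x \<notin> A \<Longrightarrow> f x = 0"
  shows "(LINT x:A|lebesgue. f x) = (LBINT x. f x)"
proof -
  have "(LINT x:A|lebesgue. f x) = (\<integral>x. f x \<partial>lebesgue)"
    unfolding set_lebesgue_integral_def
    by (intro Bochner_Integration.integral_cong) (use assms(2) in \<open>auto simp: indicator_def\<close>)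
  also have "\<dots> = (LBINT x. f x)"
    by (rule integral_completion) (use assms in auto)
  finally show ?thesis .
qed

lemma is_weak_grad_iff_borel:
  fixes w :: "'a::euclidean_space \<Rightarrow> real"
  assumes [measurable]: "w \<in> borel_measurable borel" "G \<in> borel_measurable borel"
  shows "is_weak_grad \<Omega> w G \<longleftrightarrow> borel_weak_grad \<Omega> w G"
proof -
  have "(LINT x:\<Omega>|lebesgue. w x * dderiv \<phi> v x) = (LBINT x. w x * dderiv \<phi> v x) \<and>
      (LINT x:\<Omega>|lebesgue. (G x \<bullet> v) * \<phi> x) = (LBINT x. (G x \<bullet> v) * \<phi> x)"
    if t: "test_function \<Omega> \<phi>" for \<phi> v
  proof -
    obtain K where K: "compact K" "K \<subseteq> \<Omega>" "\<And>x. x \<notin> K \<Longrightarrow> \<phi> x = 0" "\<And>x v. x \<notin> K \<Longrightarrow> dderiv \<phi> v x = 0"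
      by (rule test_functionE[OF t]) (rule that)
    note [measurable] = test_function_measurable[OF t]
    show ?thesis
      using K(2-4) by (intro conjI set_integral_lebesgue_eq_lborel) (measurable, auto simp: subset_iff)
  qed
  note B = this
  have "w absolutely_integrable_on K \<longleftrightarrow> set_integrable lborel K w" "G absolutely_integrable_on K \<longleftrightarrow> set_integrable lborel K G"
    if "compact K" for K
    using that by (simp_all add: set_integrable_lebesgue_iff_lborel borel_compact assms)
  then have "(\<forall>K. compact K \<and> K \<subseteq> \<Omega> \<longrightarrow> w absolutely_integrable_on K \<and> G absolutely_integrable_on K) \<longleftrightarrow>
      (\<forall>K. compact K \<longrightarrow> K \<subseteq> \<Omega> \<longrightarrow> set_integrable lborel K w \<and> set_integrable lborel K G)"
    by blast
  moreover have "(\<forall>\<phi> v. test_function \<Omega> \<phi> \<longrightarrow>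
        (LINT x:\<Omega>|lebesgue. w x * dderiv \<phi> v x) = - (LINT x:\<Omega>|lebesgue. (G x \<bullet> v) * \<phi> x)) \<longleftrightarrow>
      (\<forall>\<phi> v. test_function \<Omega> \<phi> \<longrightarrow>
        (LBINT x. w x * dderiv \<phi> v x) = - (LBINT x. (G x \<bullet> v) * \<phi> x))"
    using B by simp
  ultimately show ?thesis
    unfolding is_weak_grad_def borel_weak_grad_def using assms by simp
qed

lemma borel_measurable_lebesgue_cong_AE:
  fixes g g' :: "'a::euclidean_space \<Rightarrow> 'b::topological_space"
  assumes g: "g \<in> borel_measurable lebesgue" and ae: "AE x in lebesgue. g x = g' x"
  shows "g' \<in> borel_measurable lebesgue"
proof (rule measurableI)
  fix S :: "'b set" assume S: "S \<in> sets borel"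
  show "g' -` S \<inter> space lebesgue \<in> sets lebesgue"
  proof (rule completion.in_sets_AE)
    show "AE x in lebesgue. x \<in> g -` S \<inter> space lebesgue \<longleftrightarrow> x \<in> g' -` S \<inter> space lebesgue"
      using ae by eventually_elim auto
    show "g -` S \<inter> space lebesgue \<in> sets lebesgue" using g S by (rule measurable_sets)
  qed auto
qed auto

text \<open>A function that is not measurable has integral \<open>0\<close>.\<close>

lemma integral_lebesgue_cong_AE:
  fixes g g' :: "'a::euclidean_space \<Rightarrow> real"
  assumes ae: "AE x in lebesgue. g x = g' x"
  shows "integral\<^sup>L lebesgue g = integral\<^sup>L lebesgue g'"
proof (cases "g \<in> borel_measurable lebesgue")
  case True
  then show ?thesis by (rule integral_cong_AE[OF _ borel_measurable_lebesgue_cong_AE[OF True ae] ae])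
next
  case False
  have "AE x in lebesgue. g' x = g x" using ae by eventually_elim simp
  then have "g' \<notin> borel_measurable lebesgue" using False borel_measurable_lebesgue_cong_AE by blast
  then show ?thesis using False by (metis borel_measurable_integrable not_integrable_integral_eq)
qed

text \<open>Integrability and the test integrals depend only on the class modulo null sets.
  Measurability of the new functions is not assumed; it follows from completeness of Lebesgue
  measure.\<close>

lemma is_weak_grad_cong_AE:
  fixes f :: "'a::euclidean_space \<Rightarrow> real"
  assumes f: "AE x in lebesgue. x \<in> \<Omega> \<longrightarrow> f x = f' x" and G: "AE x in lebesgue. x \<in> \<Omega> \<longrightarrow> G x = G' x"
    and w: "is_weak_grad \<Omega> f G"
  shows "is_weak_grad \<Omega> f' G'"
proof -
  have ae: "AE x in lebesgue. indicat_real K x *\<^sub>R g x = indicat_real K x *\<^sub>R g' x"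
    if "AE x in lebesgue. x \<in> \<Omega> \<longrightarrow> g x = g' x" "K \<subseteq> \<Omega>" for K and g g' :: "'a \<Rightarrow> 'b::euclidean_space"
    using that(1) by eventually_elim (use that(2) in \<open>auto simp: indicator_def\<close>)
  have ai: "g' absolutely_integrable_on K"
    if "g absolutely_integrable_on K" "AE x in lebesgue. x \<in> \<Omega> \<longrightarrow> g x = g' x" "K \<subseteq> \<Omega>"
    for K and g g' :: "'a \<Rightarrow> 'b::euclidean_space"
  proof -
    have i: "integrable lebesgue (\<lambda>x. indicat_real K x *\<^sub>R g x)"
      using that(1) unfolding set_integrable_def .
    show ?thesis unfolding set_integrable_def
      using borel_measurable_lebesgue_cong_AE[OF borel_measurable_integrable[OF i]] ae[OF that(2,3)]
      by (intro integrable_cong_AE_imp[OF i])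
  qed
  have li: "(LINT x:\<Omega>|lebesgue. h' x) = (LINT x:\<Omega>|lebesgue. h x)"
    if "AE x in lebesgue. x \<in> \<Omega> \<longrightarrow> h x = h' x" for h h' :: "'a \<Rightarrow> real"
    unfolding set_lebesgue_integral_def by (rule integral_lebesgue_cong_AE[OF ae[OF that order_refl], symmetric])
  have eq: "(LINT x:\<Omega>|lebesgue. f' x * dderiv \<phi> v x) = (LINT x:\<Omega>|lebesgue. f x * dderiv \<phi> v x)"
    "(LINT x:\<Omega>|lebesgue. (G' x \<bullet> v) * \<phi> x) = (LINT x:\<Omega>|lebesgue. (G x \<bullet> v) * \<phi> x)" for \<phi> v
  proof -
    have "AE x in lebesgue. x \<in> \<Omega> \<longrightarrow> f x * dderiv \<phi> v x = f' x * dderiv \<phi> v x"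
      using f by eventually_elim simp
    then show "(LINT x:\<Omega>|lebesgue. f' x * dderiv \<phi> v x) = (LINT x:\<Omega>|lebesgue. f x * dderiv \<phi> v x)" by (rule li)
    have "AE x in lebesgue. x \<in> \<Omega> \<longrightarrow> (G x \<bullet> v) * \<phi> x = (G' x \<bullet> v) * \<phi> x"
      using G by eventually_elim simp
    then show "(LINT x:\<Omega>|lebesgue. (G' x \<bullet> v) * \<phi> x) = (LINT x:\<Omega>|lebesgue. (G x \<bullet> v) * \<phi> x)" by (rule li)
  qed
  show ?thesis
    using w ai[OF _ f] ai[OF _ G] eq unfolding is_weak_grad_def by simp
qed

section \<open>Increments as averages of the gradient over segments\<close>

lemma integrable_segment:
  fixes g :: "'a::euclidean_space \<Rightarrow> real"
  assumes g: "integrable lborel g"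
  shows "integrable (lborel \<Otimes>\<^sub>M lborel) (\<lambda>(x, s). indicat_real {0..1} s * g (x + s *\<^sub>R h))"
proof (rule integrableI_bounded)
  have [measurable]: "g \<in> borel_measurable borel" using g by auto
  show m: "(\<lambda>(x, s). indicat_real {0..1} s * g (x + s *\<^sub>R h)) \<in> borel_measurable (lborel \<Otimes>\<^sub>M lborel)"
    by measurable
  have "(\<integral>\<^sup>+ z. ennreal (norm (case z of (x, s) \<Rightarrow> indicat_real {0..1} s * g (x + s *\<^sub>R h))) \<partial>(lborel \<Otimes>\<^sub>M lborel)) =
    (\<integral>\<^sup>+ s. (\<integral>\<^sup>+ x. ennreal (norm (indicat_real {0..1} s * g (x + s *\<^sub>R h))) \<partial>lborel) \<partial>lborel)"
    by (subst lborel_pair.nn_integral_snd[symmetric]) (auto, measurable)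
  \<comment> \<open>With the integral over x innermost, each s shifts by a constant vector, which
    does not change the integral.\<close>
  also have "\<dots> = (\<integral>\<^sup>+ s. indicator {0..1::real} s * (\<integral>\<^sup>+ x. ennreal (norm (g x)) \<partial>lborel) \<partial>lborel)"
  proof (rule nn_integral_cong)
    fix s :: real
    have "(\<integral>\<^sup>+ x. ennreal (norm (indicat_real {0..1} s * g (x + s *\<^sub>R h))) \<partial>lborel) =
      (\<integral>\<^sup>+ x. indicator {0..1} s * ennreal (norm (g (x + s *\<^sub>R h))) \<partial>lborel)"
      by (intro nn_integral_cong) (auto simp: indicator_def)
    also have "\<dots> = indicator {0..1} s * (\<integral>\<^sup>+ x. ennreal (norm (g (x + s *\<^sub>R h))) \<partial>lborel)"
      by (rule nn_integral_cmult) measurable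
    also have "(\<integral>\<^sup>+ x. ennreal (norm (g (x + s *\<^sub>R h))) \<partial>lborel) = (\<integral>\<^sup>+ x. ennreal (norm (g x)) \<partial>lborel)"
      by (rule nn_integral_lborel_translate[where f="\<lambda>x. ennreal (norm (g x))"]) measurable
    finally show "(\<integral>\<^sup>+ x. ennreal (norm (indicat_real {0..1} s * g (x + s *\<^sub>R h))) \<partial>lborel) =
      indicator {0..1::real} s * (\<integral>\<^sup>+ x. ennreal (norm (g x)) \<partial>lborel)" .
  qed
  also have "\<dots> = (\<integral>\<^sup>+ x. ennreal (norm (g x)) \<partial>lborel)"
    by (subst nn_integral_multc) auto
  also have "\<dots> < \<infinity>" using g by (simp add: integrable_iff_bounded)
  finally show "(\<integral>\<^sup>+ z. ennreal (norm (case z of (x, s) \<Rightarrow> indicat_real {0..1} s * g (x + s *\<^sub>R h))) \<partial>(lborel \<Otimes>\<^sub>M lborel)) < \<infinity>" .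
qed

lemma integrable_mult_bounded:
  fixes f b :: "'a::euclidean_space \<Rightarrow> real"
  assumes "integrable lborel f" "b \<in> borel_measurable borel" "\<And>x. \<bar>b x\<bar> \<le> C"
  shows "integrable lborel (\<lambda>x. f x * b x)"
proof (rule Bochner_Integration.integrable_bound[of _ "\<lambda>x. C * f x"])
  show "AE x in lborel. norm (f x * b x) \<le> norm (C * f x)"
    using assms(3)[THEN order_trans, OF abs_ge_self]
    by (intro AE_I2) (auto simp: abs_mult mult.commute intro!: mult_right_mono)
qed (use assms in auto)

lemma borel_weak_grad_integrable:
  assumes "borel_weak_grad \<Omega> w G" "compact K" "K \<subseteq> \<Omega>"
  shows "integrable lborel (\<lambda>x. indicat_real K x * w x)" "integrable lborel (\<lambda>x. indicat_real K x * (G x \<bullet> h))"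
proof -
  show "integrable lborel (\<lambda>x. indicat_real K x * w x)"
    using borel_weak_gradD(3)[OF assms] unfolding set_integrable_def by simp
  have "integrable lborel (\<lambda>x. (indicat_real K x *\<^sub>R G x) \<bullet> h)"
    using borel_weak_gradD(4)[OF assms] unfolding set_integrable_def by (intro integrable_inner_left)
  then show "integrable lborel (\<lambda>x. indicat_real K x * (G x \<bullet> h))" by simp
qed

text \<open>The mean of \<open>g\<close> over the segment from x to x + h. Where \<open>g\<close> is
  not integrable along the segment the value is 0 by the convention for the integral, which never
  spoils an upper bound for its absolute value.\<close>

definition segment_avg :: "('a::euclidean_space \<Rightarrow> real) \<Rightarrow> 'a \<Rightarrow> 'a \<Rightarrow> real" where
  "segment_avg g h x = (LBINT s. indicat_real {0..1} s * g (x + s *\<^sub>R h))"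

lemma borel_measurable_segment_avg[measurable]:
  assumes [measurable]: "g \<in> borel_measurable borel"
  shows "segment_avg g h \<in> borel_measurable borel"
proof -
  have "(\<lambda>x. LBINT s. indicat_real {0..1} s * g (x + s *\<^sub>R h)) \<in> borel_measurable lborel"
    by measurable
  then show ?thesis by (simp add: segment_avg_def[abs_def])
qed

lemma integrable_segment_avg: "integrable lborel g \<Longrightarrow> integrable lborel (segment_avg g h)"
  unfolding segment_avg_def[abs_def] by (rule lborel_pair.integrable_fst[OF integrable_segment])

lemma segment_avg_cong: "(\<And>s. 0 \<le> s \<Longrightarrow> s \<le> 1 \<Longrightarrow> g (x + s *\<^sub>R h) = g' (x + s *\<^sub>R h)) \<Longrightarrow> segment_avg g h x = segment_avg g' h x"
  unfolding segment_avg_def by (intro Bochner_Integration.integral_cong) (auto simp: indicator_def)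

text \<open>The union of the segments from x to x + h with x in K. Cutting functions off outside
  this compact set makes them globally integrable and leaves them unchanged on all segments that
  matter.\<close>

definition sweep :: "'a::euclidean_space set \<Rightarrow> 'a \<Rightarrow> 'a set" where
  "sweep K h = (\<lambda>(x, s). x + s *\<^sub>R h) ` (K \<times> {0..1})"

lemma compact_sweep: "compact K \<Longrightarrow> compact (sweep K h)"
  unfolding sweep_def by (intro compact_continuous_image compact_Times)
    (auto intro!: continuous_intros simp: case_prod_unfold)

lemma sweepI: "x \<in> K \<Longrightarrow> 0 \<le> s \<Longrightarrow> s \<le> 1 \<Longrightarrow> x + s *\<^sub>R h \<in> sweep K h"
  unfolding sweep_def by force

lemma sweep_subset:
  assumes "convex \<Omega>" "\<And>x. x \<in> K \<Longrightarrow> x \<in> \<Omega> \<and> x + h \<in> \<Omega>"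
  shows "sweep K h \<subseteq> \<Omega>"
proof
  fix y assume "y \<in> sweep K h"
  then obtain x s where *: "x \<in> K" "0 \<le> s" "s \<le> 1" "y = x + s *\<^sub>R h" unfolding sweep_def by auto
  have "(1 - s) *\<^sub>R x + s *\<^sub>R (x + h) \<in> \<Omega>"
    using assms(2)[OF *(1)] * by (intro convexD[OF assms(1)]) auto
  then show "y \<in> \<Omega>" unfolding *(4) by (simp add: algebra_simps)
qed

lemma test_function_difference:
  assumes "test_function \<Omega> \<phi>"
  shows "\<phi> (x - h) - \<phi> x = - (LBINT s. indicat_real {0..1} s * frechet_derivative \<phi> (at (x - s *\<^sub>R h)) h)"
proof -
  note K = test_functionD(1)[OF assms] test_functionD(3)[OF assms, of h]
  have "(LBINT s. indicator {0..1} s *\<^sub>R (- frechet_derivative \<phi> (at (x - s *\<^sub>R h)) h)) = \<phi> (x - 1 *\<^sub>R h) - \<phi> (x - 0 *\<^sub>R h)"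
  proof (rule integral_FTC_Icc)
    show "((\<lambda>s. \<phi> (x - s *\<^sub>R h)) has_vector_derivative - frechet_derivative \<phi> (at (x - s *\<^sub>R h)) h) (at s within {0..1})" for s
    proof -
      have "((\<lambda>s. x - s *\<^sub>R h) has_derivative (\<lambda>t. - (t *\<^sub>R h))) (at s within {0..1})"
        by (auto intro!: derivative_eq_intros)
      from has_derivative_compose[OF this K(1)]
      have "((\<lambda>s. \<phi> (x - s *\<^sub>R h)) has_derivative (\<lambda>t. frechet_derivative \<phi> (at (x - s *\<^sub>R h)) (- (t *\<^sub>R h)))) (at s within {0..1})" .
      moreover have "linear (frechet_derivative \<phi> (at (x - s *\<^sub>R h)))"
        using K(1) has_derivative_linear by blast
      ultimately show ?thesis
        by (simp add: has_vector_derivative_def linear_neg linear_cmul)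
    qed
    show "continuous_on {0..1} (\<lambda>s. - frechet_derivative \<phi> (at (x - s *\<^sub>R h)) h)"
      by (intro continuous_intros continuous_on_compose2[OF K(2)]) auto
  qed simp
  then show ?thesis by simp
qed

lemma integrable_segment_product:
  fixes w :: "'a::euclidean_space \<Rightarrow> real"
  assumes w: "integrable lborel w" and b[measurable]: "b \<in> borel_measurable borel" and M: "\<And>x. \<bar>b x\<bar> \<le> M"
  shows "integrable (lborel \<Otimes>\<^sub>M lborel) (\<lambda>(x, s). indicat_real {0..1} s * (w (x + s *\<^sub>R h) * b (x + s *\<^sub>R k)))"
proof (rule Bochner_Integration.integrable_bound)
  have [measurable]: "w \<in> borel_measurable borel" using w by auto
  have "integrable lborel (\<lambda>x. M * w x)" using w by auto
  from integrable_segment[OF this]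
  show "integrable (lborel \<Otimes>\<^sub>M lborel) (\<lambda>(x, s). indicat_real {0..1} s * (M * w (x + s *\<^sub>R h)))" .
  show "(\<lambda>(x, s). indicat_real {0..1} s * (w (x + s *\<^sub>R h) * b (x + s *\<^sub>R k))) \<in> borel_measurable (lborel \<Otimes>\<^sub>M lborel)"
    by measurable
  have "\<bar>w y\<bar> * \<bar>b z\<bar> \<le> \<bar>M\<bar> * \<bar>w y\<bar>" for y z
    using M[of z] by (simp add: mult.commute mult_right_mono)
  then show "AE z in lborel \<Otimes>\<^sub>M lborel. norm (case z of (x, s) \<Rightarrow> indicat_real {0..1} s * (w (x + s *\<^sub>R h) * b (x + s *\<^sub>R k)))
      \<le> norm (case z of (x, s) \<Rightarrow> indicat_real {0..1} s * (M * w (x + s *\<^sub>R h)))"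
    by (intro AE_I2) (auto simp: abs_mult indicator_def)
qed

text \<open>Shift the increment onto \<phi>, write the increment of \<phi> as an integral of its
  derivative over a segment, apply the weak gradient to each translate of \<phi>, and shift back.
  Fubini is used twice, to exchange the integrals over x and over the segment.\<close>

lemma weak_grad_difference_test:
  fixes w :: "'a::euclidean_space \<Rightarrow> real"
  assumes W: "borel_weak_grad \<Omega> w G" and \<Omega>: "convex \<Omega>"
    and \<phi>: "test_function {x. x \<in> \<Omega> \<and> x + h \<in> \<Omega>} \<phi>"
  shows "(LBINT x. (w (x + h) - w x - segment_avg (\<lambda>y. G y \<bullet> h) h x) * \<phi> x) = 0"
proof -
  obtain K where K: "compact K" "K \<subseteq> {x. x \<in> \<Omega> \<and> x + h \<in> \<Omega>}" "\<And>x. x \<notin> K \<Longrightarrow> \<phi> x = 0"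
    "\<And>x v. x \<notin> K \<Longrightarrow> dderiv \<phi> v x = 0"
    by (rule test_functionE[OF \<phi>]) (rule that)
  define D where "D x = dderiv \<phi> h x" for x
  define K' where "K' = sweep K h"
  have K': "compact K'" "K' \<subseteq> \<Omega>" 
    using compact_sweep[OF K(1)] sweep_subset[OF \<Omega>, of K h] K(2) by (auto simp: K'_def)
  have inK': "x + s *\<^sub>R h \<in> K'" if "x \<in> K" "0 \<le> s" "s \<le> 1" for x s
    using sweepI[OF that] by (simp add: K'_def)
  note meas[measurable] = borel_weak_gradD(1,2)[OF W] borel_compact[OF K'(1)] borel_compact[OF K(1)]
  have [measurable]: "\<phi> \<in> borel_measurable borel" "D \<in> borel_measurable borel"
    unfolding D_def using test_function_measurable[OF \<phi>] by auto
  \<comment> \<open>The functions \<open>w\<close> and \<open>G\<close> are only locally integrable,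
    while translations and Fubini require integrability on the whole space. The cut-off is invisible
    to the translates of \<phi>, which are supported in \<open>K'\<close>.\<close>
  define u where "u x = indicat_real K' x * w x" for x
  define g where "g x = indicat_real K' x * (G x \<bullet> h)" for x
  have u: "integrable lborel u" and g: "integrable lborel g"
    unfolding u_def g_def by (rule borel_weak_grad_integrable[OF W K'])+
  obtain M where M: "\<And>x. \<bar>\<phi> x\<bar> \<le> M" by (rule test_function_bounded[OF \<phi>]) (rule that)
  obtain M' where M': "\<And>x. \<bar>D x\<bar> \<le> M'"
    unfolding D_def using test_function_dderiv_bounded[OF \<phi>, of h] by blast
  note bi = integrable_mult_bounded
  have [measurable]: "u \<in> borel_measurable borel" "g \<in> borel_measurable borel" using u g by auto

  have 1: "(LBINT x. (\<phi> (x - h) - \<phi> x) * u x) = - (LBINT s. indicat_real {0..1} s * (LBINT x. u x * D (x - s *\<^sub>R h)))"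
  proof -
    have "(LBINT x. (\<phi> (x - h) - \<phi> x) * u x) =
        - (LBINT x. (LBINT s. indicat_real {0..1} s * (u (x + s *\<^sub>R 0) * D (x + s *\<^sub>R (- h)))))"
      unfolding test_function_difference[OF \<phi>] D_def[symmetric]
      by (simp flip: integral_mult_left_zero integral_mult_right_zero Bochner_Integration.integral_minus add: mult_ac)
    also have "\<dots> = - (LBINT s. (LBINT x. indicat_real {0..1} s * (u (x + s *\<^sub>R 0) * D (x + s *\<^sub>R (- h)))))"
      by (subst lborel_pair.Fubini_integral[OF integrable_segment_product[OF u _ M']]) auto
    finally show ?thesis by simp
  qed
  have 2: "(LBINT x. u x * D (x - s *\<^sub>R h)) = - (LBINT x. g x * \<phi> (x - s *\<^sub>R h))" if s: "0 \<le> s" "s \<le> 1" for s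
  proof -
    \<comment> \<open>Here convexity of \<Omega> matters: the support of every intermediate
      translate, not only of the two end ones, stays in \<Omega>.\<close>
    have "test_function K' (\<lambda>x. \<phi> (x - s *\<^sub>R h))"
      by (rule test_function_translate[of K]) (use K inK' s \<phi> in \<open>auto simp: test_function_def\<close>)
    then have t: "test_function \<Omega> (\<lambda>x. \<phi> (x - s *\<^sub>R h))"
      using K'(2) unfolding test_function_def by blast
    have fd: "frechet_derivative (\<lambda>x. \<phi> (x - s *\<^sub>R h)) (at x) h = D (x - s *\<^sub>R h)" for x
      unfolding D_def by (rule frechet_derivative_apply[OF has_derivative_compose[OF _ test_functionD(1)[OF \<phi>]]]) (auto intro!: derivative_eq_intros)
    have out: "x \<in> K'" if "x - s *\<^sub>R h \<in> K" for x using inK'[OF that s] by simp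
    have "(LBINT x. u x * D (x - s *\<^sub>R h)) = (LBINT x. w x * D (x - s *\<^sub>R h))"
      using out K(4) by (intro Bochner_Integration.integral_cong) (auto simp: u_def D_def indicator_def)
    also have "\<dots> = - (LBINT x. (G x \<bullet> h) * \<phi> (x - s *\<^sub>R h))"
      using borel_weak_gradD(5)[OF W t, of h] unfolding fd .
    also have "(LBINT x. (G x \<bullet> h) * \<phi> (x - s *\<^sub>R h)) = (LBINT x. g x * \<phi> (x - s *\<^sub>R h))"
      using out K(3) by (intro Bochner_Integration.integral_cong) (auto simp: g_def indicator_def)
    finally show ?thesis .
  qed
  have 3: "(LBINT x. g x * \<phi> (x - s *\<^sub>R h)) = (LBINT x. g (x + s *\<^sub>R h) * \<phi> x)" for s
    using integral_lborel_translate[of "\<lambda>x. g x * \<phi> (x - s *\<^sub>R h)" "s *\<^sub>R h"] by simp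
  have "- (LBINT s. indicat_real {0..1} s * (LBINT x. u x * D (x - s *\<^sub>R h)))
      = (LBINT s. (LBINT x. indicat_real {0..1} s * (g (x + s *\<^sub>R h) * \<phi> (x + s *\<^sub>R 0))))"
    unfolding Bochner_Integration.integral_minus[symmetric]
    by (intro Bochner_Integration.integral_cong) (auto simp: indicator_def 2 3)
  also have "\<dots> = (LBINT x. (LBINT s. indicat_real {0..1} s * (g (x + s *\<^sub>R h) * \<phi> (x + s *\<^sub>R 0))))"
    by (subst lborel_pair.Fubini_integral[OF integrable_segment_product[OF g _ M]]) auto
  also have "\<dots> = (LBINT x. segment_avg g h x * \<phi> x)"
    unfolding segment_avg_def
    by (intro Bochner_Integration.integral_cong) (simp_all flip: integral_mult_left_zero add: mult_ac)
  finally have 4: "(LBINT x. (\<phi> (x - h) - \<phi> x) * u x) = (LBINT x. segment_avg g h x * \<phi> x)"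
    using 1 by simp
  have "(LBINT x. \<phi> (x - h) * u x) = (LBINT x. u (x + h) * \<phi> x)"
    using integral_lborel_translate[of "\<lambda>x. u x * \<phi> (x - h)" h] by (simp add: mult.commute)
  moreover have i1: "integrable lborel (\<lambda>x. \<phi> (x - h) * u x)" "integrable lborel (\<lambda>x. \<phi> x * u x)"
    "integrable lborel (\<lambda>x. u (x + h) * \<phi> x)" "integrable lborel (\<lambda>x. segment_avg g h x * \<phi> x)"
    using bi[OF u _ M] bi[OF u, of "\<lambda>x. \<phi> (x - h)" M, OF _ M] bi[OF integrable_lborel_translate[OF u] _ M]
      bi[OF integrable_segment_avg[OF g] _ M]
    by (auto simp: mult.commute[of "\<phi> _"])
  ultimately have 5: "(LBINT x. (\<phi> (x - h) - \<phi> x) * u x) = (LBINT x. u (x + h) * \<phi> x) - (LBINT x. u x * \<phi> x)"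
    by (simp add: left_diff_distrib mult.commute[of "u _"])
  have "(LBINT x. (w (x + h) - w x - segment_avg (\<lambda>y. G y \<bullet> h) h x) * \<phi> x)
     = (LBINT x. u (x + h) * \<phi> x - u x * \<phi> x - segment_avg g h x * \<phi> x)"
  proof (intro Bochner_Integration.integral_cong refl)
    fix x
    show "(w (x + h) - w x - segment_avg (\<lambda>y. G y \<bullet> h) h x) * \<phi> x = u (x + h) * \<phi> x - u x * \<phi> x - segment_avg g h x * \<phi> x"
    proof (cases "x \<in> K")
      case True
      have "segment_avg g h x = segment_avg (\<lambda>y. G y \<bullet> h) h x"
        by (rule segment_avg_cong) (use inK'[OF True] in \<open>simp add: g_def\<close>)
      moreover have "u (x + h) = w (x + h)" "u x = w x"
        using inK'[OF True, of 1] inK'[OF True, of 0] by (auto simp: u_def)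
      ultimately show ?thesis by (simp add: algebra_simps)
    qed (use K(3) in auto)
  qed
  also have "\<dots> = 0"
    using 4 5 i1 by (simp add: mult.commute[of _ "u _"])
  finally show ?thesis .
qed

text \<open>The fundamental theorem of calculus for weak gradients. The exceptional null set may
  depend on h, which is harmless because later uses fix h or take countably many shifts.\<close>

lemma weak_grad_difference:
  fixes w :: "'a::euclidean_space \<Rightarrow> real"
  assumes W: "borel_weak_grad \<Omega> w G" and \<Omega>: "open \<Omega>" "convex \<Omega>"
  shows "AE x in lborel. x \<in> \<Omega> \<and> x + h \<in> \<Omega> \<longrightarrow> w (x + h) - w x = segment_avg (\<lambda>y. G y \<bullet> h) h x"
proof -
  let ?\<Omega> = "{x. x \<in> \<Omega> \<and> x + h \<in> \<Omega>}"
  let ?f = "\<lambda>x. w (x + h) - w x - segment_avg (\<lambda>y. G y \<bullet> h) h x"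
  note meas[measurable] = borel_weak_gradD(1,2)[OF W]
  have "?\<Omega> = \<Omega> \<inter> (\<lambda>x. x + h) -` \<Omega>" by auto
  moreover have "open ((\<lambda>x. x + h) -` \<Omega>)"
    by (intro open_vimage \<Omega> continuous_intros)
  ultimately have op: "open ?\<Omega>" using \<Omega>(1) by auto
  have "AE x in lborel. x \<in> ?\<Omega> \<longrightarrow> ?f x = 0"
  proof (rule test_function_AE_zero[OF op])
    show "?f \<in> borel_measurable borel" by measurable
    show "(LBINT x. ?f x * \<phi> x) = 0" if "test_function ?\<Omega> \<phi>" for \<phi>
      by (rule weak_grad_difference_test[OF W \<Omega>(2) that])
    fix K assume K: "compact K" "K \<subseteq> ?\<Omega>"
    define K' where "K' = sweep K h"
    have K': "compact K'" "K' \<subseteq> \<Omega>" 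
      using compact_sweep[OF K(1)] sweep_subset[OF \<Omega>(2), of K h] K(2) by (auto simp: K'_def)
    have inK': "x + s *\<^sub>R h \<in> K'" if "x \<in> K" "0 \<le> s" "s \<le> 1" for x s
      using sweepI[OF that] by (simp add: K'_def)
    note [measurable] = borel_compact[OF K'(1)] borel_compact[OF K(1)]
    define u where "u x = indicat_real K' x * w x" for x
    define g where "g x = indicat_real K' x * (G x \<bullet> h)" for x
    have u: "integrable lborel u" and g: "integrable lborel g"
      unfolding u_def g_def by (rule borel_weak_grad_integrable[OF W K'])+
    have "integrable lborel (\<lambda>x. indicat_real K x *\<^sub>R (u (x + h) - u x - segment_avg g h x))"
      using u g integrable_lborel_translate[OF u, of h] integrable_segment_avg[OF g, of h]
      by (intro integrable_mult_indicator) auto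
    moreover have "indicat_real K x *\<^sub>R (u (x + h) - u x - segment_avg g h x) = indicat_real K x *\<^sub>R ?f x" for x
    proof (cases "x \<in> K")
      case True
      have "segment_avg g h x = segment_avg (\<lambda>y. G y \<bullet> h) h x"
        by (rule segment_avg_cong) (use inK'[OF True] in \<open>simp add: g_def\<close>)
      moreover have "u (x + h) = w (x + h)" "u x = w x"
        using inK'[OF True, of 1] inK'[OF True, of 0] by (auto simp: u_def)
      ultimately show ?thesis by simp
    qed auto
    ultimately show "set_integrable lborel K ?f" unfolding set_integrable_def by (simp only:)
  qed
  then show ?thesis by eventually_elim auto
qed

section \<open>Chain rule\<close>

text \<open>By Fubini, the L1 distance between the average and \<open>g\<close> is at most the mean
  over s of the L1 distances between \<open>g\<close> and its translate by s h. Each of these shifts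
  is no longer than h, so continuity of translations applies uniformly in s.\<close>

lemma segment_avg_tendsto_L1:
  fixes g :: "'a::euclidean_space \<Rightarrow> real"
  assumes g: "integrable lborel g" and h: "h \<longlonglongrightarrow> 0"
  shows "(\<lambda>n. LBINT x. \<bar>segment_avg g (h n) x - g x\<bar>) \<longlonglongrightarrow> 0"
proof (rule LIMSEQ_I)
  fix r :: real assume "r > 0"
  then have r2: "r / 2 > 0" by simp
  obtain d where d: "d > 0" "\<And>k. norm k < d \<Longrightarrow> (LBINT x. \<bar>g (x + k) - g x\<bar>) < r / 2"
    using translation_L1_continuous[OF g r2] by blast
  obtain N where N: "\<And>n. n \<ge> N \<Longrightarrow> norm (h n) < d"
    using LIMSEQ_D[OF h d(1)] by auto
  have [measurable]: "g \<in> borel_measurable borel" using g by auto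
  have "(LBINT x. \<bar>segment_avg g k x - g x\<bar>) < r" if k: "norm k < d" for k
  proof -
    \<comment> \<open>The zero shift in the second term turns \<open>g x\<close> into a segment
      integrand as well, so one integrability lemma covers both terms.\<close>
    let ?f = "\<lambda>x s. indicat_real {0..1} s * g (x + s *\<^sub>R k) - indicat_real {0..1} s * g (x + s *\<^sub>R 0)"
    have i: "integrable (lborel \<Otimes>\<^sub>M lborel) (\<lambda>(x, s). ?f x s)"
      using Bochner_Integration.integrable_diff[OF integrable_segment[OF g, of k] integrable_segment[OF g, of 0]]
      by (simp add: case_prod_unfold)
    then have i': "integrable (lborel \<Otimes>\<^sub>M lborel) (\<lambda>(x, s). \<bar>?f x s\<bar>)"
      using integrable_abs[OF i] by (simp add: case_prod_unfold)
    have ae: "AE x in lborel. \<bar>segment_avg g k x - g x\<bar> \<le> (LBINT s. \<bar>?f x s\<bar>)"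
      using lborel_pair.AE_integrable_fst[OF integrable_segment[OF g, of k]]
    proof eventually_elim
      case (elim x)
      have 0: "integrable lborel (\<lambda>s. indicat_real {0..1} s * g (x + s *\<^sub>R 0))" by simp
      have "segment_avg g k x - g x = (LBINT s. ?f x s)"
        using Bochner_Integration.integral_diff[OF elim 0] by (simp add: segment_avg_def)
      then show ?case by (simp add: integral_abs_bound)
    qed
    have "(LBINT x. \<bar>segment_avg g k x - g x\<bar>) \<le> (LBINT x. (LBINT s. \<bar>?f x s\<bar>))"
      by (rule integral_mono_AE[OF _ lborel_pair.integrable_fst[OF i'] ae])
        (intro integrable_abs Bochner_Integration.integrable_diff integrable_segment_avg g)
    also have "\<dots> = (LBINT s. (LBINT x. \<bar>?f x s\<bar>))"
      by (rule lborel_pair.Fubini_integral[OF i', symmetric])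
    also have "\<dots> \<le> (\<integral>s. indicat_real {0..1} s * (r/2) \<partial>(lborel :: real measure))"
    proof (rule Bochner_Integration.integral_mono)
      show "integrable lborel (\<lambda>s. LBINT x. \<bar>?f x s\<bar>)" by (rule lborel_pair.integrable_snd[OF i'])
      fix s :: real
      show "(LBINT x. \<bar>?f x s\<bar>) \<le> indicat_real {0..1} s * (r/2)"
      proof (cases "s \<in> {0..1}")
        case True
        then have "norm (s *\<^sub>R k) \<le> 1 * norm k" unfolding norm_scaleR by (intro mult_right_mono) auto
        then have "norm (s *\<^sub>R k) < d" using k by simp
        from d(2)[OF this] show ?thesis using True by simp
      qed simp
    qed simp
    also have "\<dots> < r" using \<open>r > 0\<close> by simp
    finally show ?thesis .
  qed
  then show "\<exists>no. \<forall>n\<ge>no. norm ((LBINT x. \<bar>segment_avg g (h n) x - g x\<bar>) - 0) < r"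
    using N by (intro exI[of _ N]) auto
qed

text \<open>With \<xi> from the mean value theorem, c (\<Phi> b - \<Phi> a) - \<Phi>' a g equals
  \<Phi>' \<xi> (c (b - a) - g) + (\<Phi>' \<xi> - \<Phi>' a) g. Only the second summand keeps \<xi>
  in the bound. The first is moved to the left, so that the left side is free of \<xi>, for which no
  measurable choice is at hand.\<close>

lemma difference_quotient_chain:
  fixes \<Phi> \<Phi>' :: "real \<Rightarrow> real"
  assumes \<Phi>: "\<And>s. (\<Phi> has_real_derivative \<Phi>' s) (at s)" and M: "\<And>s. \<bar>\<Phi>' s\<bar> \<le> M"
  obtains \<xi> where "\<bar>\<xi> - a\<bar> \<le> \<bar>b - a\<bar>"
    "\<bar>c * (\<Phi> b - \<Phi> a) - \<Phi>' a * g\<bar> - M * \<bar>c * (b - a) - g\<bar> \<le> \<bar>\<Phi>' \<xi> - \<Phi>' a\<bar> * \<bar>g\<bar>"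
proof -
  have "\<exists>\<xi>. \<bar>\<xi> - a\<bar> \<le> \<bar>b - a\<bar> \<and> \<Phi> b - \<Phi> a = (b - a) * \<Phi>' \<xi>"
  proof (cases a b rule: linorder_cases)
    case less
    then show ?thesis using MVT2[of a b \<Phi> \<Phi>'] \<Phi> by (metis abs_of_pos diff_gt_0_iff_gt diff_strict_right_mono less_eq_real_def)
  next
    case greater
    then obtain z where "z > b" "z < a" "\<Phi> a - \<Phi> b = (a - b) * \<Phi>' z" using MVT2[of b a \<Phi> \<Phi>'] \<Phi> by blast
    then show ?thesis by (intro exI[of _ z]) (auto simp: algebra_simps)
  qed simp
  then obtain \<xi> where \<xi>: "\<bar>\<xi> - a\<bar> \<le> \<bar>b - a\<bar>" "\<Phi> b - \<Phi> a = (b - a) * \<Phi>' \<xi>" by blast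
  have "c * (\<Phi> b - \<Phi> a) - \<Phi>' a * g = \<Phi>' \<xi> * (c * (b - a) - g) + (\<Phi>' \<xi> - \<Phi>' a) * g"
    unfolding \<xi>(2) by (simp add: algebra_simps)
  then have "\<bar>c * (\<Phi> b - \<Phi> a) - \<Phi>' a * g\<bar> \<le> \<bar>\<Phi>' \<xi>\<bar> * \<bar>c * (b - a) - g\<bar> + \<bar>\<Phi>' \<xi> - \<Phi>' a\<bar> * \<bar>g\<bar>"
    by (metis abs_mult abs_triangle_ineq)
  also have "\<dots> \<le> M * \<bar>c * (b - a) - g\<bar> + \<bar>\<Phi>' \<xi> - \<Phi>' a\<bar> * \<bar>g\<bar>"
    using M by (intro add_mono mult_right_mono) auto
  finally show thesis using that[OF \<xi>(1)] by simp
qed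

text \<open>Convergence in L1 gives convergence almost everywhere along a subsequence
  \<open>r\<close>. There the quotients stay bounded while \<open>c\<close> grows, so
  \<open>b\<close> tends to \<open>a\<close>, and continuity of \<Phi>' makes the remainder vanish
  pointwise. Domination by a multiple of \<bar>g\<bar> brings the limit back to L1.\<close>

lemma chain_rule_L1:
  fixes b :: "nat \<Rightarrow> 'a \<Rightarrow> real" and a g :: "'a \<Rightarrow> real" and \<Phi> \<Phi>' :: "real \<Rightarrow> real"
  assumes \<Phi>: "\<And>s. (\<Phi> has_real_derivative \<Phi>' s) (at s)" and M: "\<And>s. \<bar>\<Phi>' s\<bar> \<le> M"
    and cont: "continuous_on UNIV \<Phi>'"
    and meas[measurable]: "\<And>n. b n \<in> borel_measurable M0" "a \<in> borel_measurable M0" "integrable M0 g"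
    and int: "\<And>n. integrable M0 (\<lambda>x. c n * (b n x - a x) - g x)"
    and L1: "(\<lambda>n. \<integral>x. \<bar>c n * (b n x - a x) - g x\<bar> \<partial>M0) \<longlonglongrightarrow> 0"
    and c: "filterlim c at_top sequentially"
  shows "\<exists>r. strict_mono r \<and> (\<forall>n. integrable M0 (\<lambda>x. c n * (\<Phi> (b n x) - \<Phi> (a x)) - \<Phi>' (a x) * g x)) \<and>
    (\<lambda>n. \<integral>x. \<bar>c (r n) * (\<Phi> (b (r n) x) - \<Phi> (a x)) - \<Phi>' (a x) * g x\<bar> \<partial>M0) \<longlonglongrightarrow> 0"
proof -
  have [measurable]: "\<Phi> \<in> borel_measurable borel" "\<Phi>' \<in> borel_measurable borel" "g \<in> borel_measurable M0"
    using DERIV_isCont[OF \<Phi>] cont meas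
    by (auto intro!: borel_measurable_continuous_onI simp: continuous_at_imp_continuous_on)
  have M0: "M \<ge> 0" using M[of 0] by simp
  define d where "d n x = c n * (b n x - a x) - g x" for n x
  define q where "q n x = c n * (\<Phi> (b n x) - \<Phi> (a x)) - \<Phi>' (a x) * g x" for n x
  \<comment> \<open>The excess over the Lipschitz part is measurable without any choice of \<xi>;
    the intermediate points only serve to bound it at each x.\<close>
  define p where "p n x = max 0 (\<bar>q n x\<bar> - M * \<bar>d n x\<bar>)" for n x
  have [measurable]: "d n \<in> borel_measurable M0" "q n \<in> borel_measurable M0" "p n \<in> borel_measurable M0" for n
    unfolding d_def q_def p_def by measurable
  have \<xi>: "\<exists>\<xi>. \<bar>\<xi> - a x\<bar> \<le> \<bar>b n x - a x\<bar> \<and> p n x \<le> \<bar>\<Phi>' \<xi> - \<Phi>' (a x)\<bar> * \<bar>g x\<bar>" for n x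
    using difference_quotient_chain[OF \<Phi> M, of "a x" "b n x" "c n" "g x"] unfolding p_def q_def d_def
    by (metis max.bounded_iff abs_ge_zero mult_nonneg_nonneg)
  have p0: "p n x \<ge> 0" for n x unfolding p_def by simp
  have pb: "p n x \<le> 2 * M * \<bar>g x\<bar>" for n x
  proof -
    obtain \<xi> where "p n x \<le> \<bar>\<Phi>' \<xi> - \<Phi>' (a x)\<bar> * \<bar>g x\<bar>" using \<xi> by blast
    also have "\<bar>\<Phi>' \<xi> - \<Phi>' (a x)\<bar> \<le> 2 * M" using M[of \<xi>] M[of "a x"] by linarith
    then have "\<bar>\<Phi>' \<xi> - \<Phi>' (a x)\<bar> * \<bar>g x\<bar> \<le> 2 * M * \<bar>g x\<bar>" by (intro mult_right_mono) auto
    finally show ?thesis .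
  qed
  have d_int: "integrable M0 (d n)" for n using int unfolding d_def .
  have qb: "\<bar>q n x\<bar> \<le> M * \<bar>d n x\<bar> + p n x" for n x unfolding p_def by simp
  have q_int: "integrable M0 (q n)" for n
  proof (rule Bochner_Integration.integrable_bound)
    show "integrable M0 (\<lambda>x. M * \<bar>d n x\<bar> + 2 * M * \<bar>g x\<bar>)" using d_int meas by auto
    show "AE x in M0. norm (q n x) \<le> norm (M * \<bar>d n x\<bar> + 2 * M * \<bar>g x\<bar>)"
      using qb[of n] pb[of n] M0 by (intro AE_I2) (smt (verit) real_norm_def)
  qed measurable
  have p_int: "integrable M0 (p n)" for n
    by (rule Bochner_Integration.integrable_bound[of _ "\<lambda>x. 2 * M * \<bar>g x\<bar>"]) (use meas(3) pb p0 in \<open>auto intro!: order_trans[OF pb abs_ge_self] simp: abs_of_nonneg\<close>)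
  obtain r where r: "strict_mono r" "AE x in M0. (\<lambda>n. d (r n) x) \<longlonglongrightarrow> 0"
    using tendsto_L1_AE_subseq[of M0 d] d_int L1 by (auto simp: d_def)
  have "(\<lambda>n. \<integral>x. p (r n) x \<partial>M0) \<longlonglongrightarrow> (\<integral>x. 0 \<partial>M0)"
  proof (rule integral_dominated_convergence[where w="\<lambda>x. 2 * M * \<bar>g x\<bar>"])
    show "AE x in M0. (\<lambda>n. p (r n) x) \<longlonglongrightarrow> 0"
      using r(2)
    proof eventually_elim
      case (elim x)
      have ci: "(\<lambda>n. inverse (c (r n))) \<longlonglongrightarrow> 0"
        by (rule tendsto_inverse_0_at_top[OF filterlim_compose[OF c filterlim_subseq[OF r(1)]]])
      have "(\<lambda>n. (d (r n) x + g x) * inverse (c (r n))) \<longlonglongrightarrow> (0 + g x) * 0"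
        by (intro tendsto_intros elim ci)
      moreover have "eventually (\<lambda>n. (d (r n) x + g x) * inverse (c (r n)) = b (r n) x - a x) sequentially"
        using eventually_compose_filterlim[OF eventually_gt_at_top[of 0] filterlim_compose[OF c filterlim_subseq[OF r(1)]]]
        by eventually_elim (auto simp: d_def)
      ultimately have ba: "(\<lambda>n. b (r n) x - a x) \<longlonglongrightarrow> 0"
        by (auto intro: Lim_transform_eventually)
      obtain z where z: "\<And>n. \<bar>z n - a x\<bar> \<le> \<bar>b (r n) x - a x\<bar>" "\<And>n. p (r n) x \<le> \<bar>\<Phi>' (z n) - \<Phi>' (a x)\<bar> * \<bar>g x\<bar>"
      proof -
        have "\<forall>n. \<exists>\<zeta>. \<bar>\<zeta> - a x\<bar> \<le> \<bar>b (r n) x - a x\<bar> \<and> p (r n) x \<le> \<bar>\<Phi>' \<zeta> - \<Phi>' (a x)\<bar> * \<bar>g x\<bar>"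
          using \<xi> by blast
        from choice[OF this] show thesis using that by blast
      qed
      have "(\<lambda>n. z n - a x) \<longlonglongrightarrow> 0"
        using z(1) by (intro Lim_null_comparison[OF _ tendsto_rabs_zero[OF ba]]) auto
      then have "z \<longlonglongrightarrow> a x" by (simp add: LIM_zero_iff)
      then have "(\<lambda>n. \<Phi>' (z n)) \<longlonglongrightarrow> \<Phi>' (a x)"
        using cont by (intro isCont_tendsto_compose[of "a x" \<Phi>']) (auto simp: continuous_on_eq_continuous_at)
      then have "(\<lambda>n. \<bar>\<Phi>' (z n) - \<Phi>' (a x)\<bar> * \<bar>g x\<bar>) \<longlonglongrightarrow> \<bar>\<Phi>' (a x) - \<Phi>' (a x)\<bar> * \<bar>g x\<bar>"
        by (intro tendsto_intros)
      then show ?case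
        by (intro Lim_null_comparison[of "\<lambda>n. p (r n) x" "\<lambda>n. \<bar>\<Phi>' (z n) - \<Phi>' (a x)\<bar> * \<bar>g x\<bar>"] always_eventually allI)
          (simp_all add: p0 abs_of_nonneg z(2))
    qed
    show "AE x in M0. norm (p (r n) x) \<le> 2 * M * \<bar>g x\<bar>" for n
      using pb p0 by (intro AE_I2) auto
    show "integrable M0 (\<lambda>x. 2 * M * \<bar>g x\<bar>)" using meas by auto
  qed auto
  moreover have "(\<lambda>n. \<integral>x. \<bar>d (r n) x\<bar> \<partial>M0) \<longlonglongrightarrow> 0"
    using LIMSEQ_subseq_LIMSEQ[OF L1 r(1)] unfolding d_def comp_def .
  ultimately have L: "(\<lambda>n. M * (\<integral>x. \<bar>d (r n) x\<bar> \<partial>M0) + (\<integral>x. p (r n) x \<partial>M0)) \<longlonglongrightarrow> 0"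
    using tendsto_add[OF tendsto_mult[OF tendsto_const]] by fastforce
  have B: "(\<integral>x. \<bar>q n x\<bar> \<partial>M0) \<le> M * (\<integral>x. \<bar>d n x\<bar> \<partial>M0) + (\<integral>x. p n x \<partial>M0)" for n
  proof -
    have "(\<integral>x. \<bar>q n x\<bar> \<partial>M0) \<le> (\<integral>x. M * \<bar>d n x\<bar> + p n x \<partial>M0)"
      using q_int d_int p_int qb by (intro Bochner_Integration.integral_mono) auto
    then show ?thesis using d_int p_int by simp
  qed
  have "(\<lambda>n. \<integral>x. \<bar>q (r n) x\<bar> \<partial>M0) \<longlonglongrightarrow> 0"
  proof (rule Lim_null_comparison[OF always_eventually L], rule allI)
    show "norm (\<integral>x. \<bar>q (r n) x\<bar> \<partial>M0) \<le> M * (\<integral>x. \<bar>d (r n) x\<bar> \<partial>M0) + (\<integral>x. p (r n) x \<partial>M0)" for n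
      using B[of "r n"] by simp
  qed
  then show ?thesis using r(1) q_int unfolding q_def by (intro exI[of _ r] conjI allI)
qed

text \<open>The second claim supplies the dominating constant for passing to the limit under the
  integral: each quotient is a mean of values of the derivative over a segment, hence bounded by its
  supremum.\<close>

lemma test_function_difference_quotient:
  assumes "test_function \<Omega> \<phi>" and c: "filterlim c at_top sequentially" and c0: "\<And>n. c n > (0::real)"
  shows "(\<lambda>n. c n * (\<phi> x - \<phi> (x - (1 / c n) *\<^sub>R v))) \<longlonglongrightarrow> dderiv \<phi> v x"
    and "\<exists>M. \<forall>n x. \<bar>c n * (\<phi> x - \<phi> (x - (1 / c n) *\<^sub>R v))\<bar> \<le> M"
proof -
  note D = test_functionD(1)[OF assms(1)]
  have lin: "linear (frechet_derivative \<phi> (at x))" for x using D has_derivative_linear by blast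
  have ci: "(\<lambda>n. inverse (c n)) \<longlonglongrightarrow> 0" by (rule tendsto_inverse_0_at_top[OF c])
  have "((\<lambda>t. \<phi> (x + t *\<^sub>R v)) has_derivative (\<lambda>t. frechet_derivative \<phi> (at (x + 0 *\<^sub>R v)) (t *\<^sub>R v))) (at 0)"
    by (rule has_derivative_compose[OF _ D]) (auto intro!: derivative_eq_intros)
  then have "((\<lambda>t. \<phi> (x + t *\<^sub>R v)) has_real_derivative dderiv \<phi> v x) (at 0)"
    by (simp add: has_field_derivative_def linear_cmul[OF lin] mult_commute_abs)
  then have "((\<lambda>t. (\<phi> (x + t *\<^sub>R v) - \<phi> x) / t) \<longlongrightarrow> dderiv \<phi> v x) (at 0)"
    by (simp add: has_field_derivative_iff)
  moreover have "filterlim (\<lambda>n. - inverse (c n)) (at 0) sequentially"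
    using tendsto_minus[OF ci] c0 by (auto simp: filterlim_at intro!: always_eventually less_imp_neq[symmetric])
  ultimately have "(\<lambda>n. (\<phi> (x + (- inverse (c n)) *\<^sub>R v) - \<phi> x) / (- inverse (c n))) \<longlonglongrightarrow> dderiv \<phi> v x"
    by (rule filterlim_compose)
  then show "(\<lambda>n. c n * (\<phi> x - \<phi> (x - (1 / c n) *\<^sub>R v))) \<longlonglongrightarrow> dderiv \<phi> v x"
    by (simp add: inverse_eq_divide algebra_simps)
  obtain M where M: "M \<ge> 0" "\<And>x. \<bar>dderiv \<phi> v x\<bar> \<le> M"
    by (rule test_function_dderiv_bounded[OF assms(1), of v]) (rule that)
  have "\<bar>c n * (\<phi> x - \<phi> (x - (1 / c n) *\<^sub>R v))\<bar> \<le> M" for n x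
  proof -
    have "\<phi> x - \<phi> (x - (1 / c n) *\<^sub>R v) = (1 / c n) * (LBINT s. indicat_real {0..1} s * frechet_derivative \<phi> (at (x - s *\<^sub>R (1 / c n) *\<^sub>R v)) v)"
      using test_function_difference[OF assms(1), of x "(1 / c n) *\<^sub>R v"]
      by (simp add: linear_cmul[OF lin] flip: integral_mult_right_zero)
    then have "c n * (\<phi> x - \<phi> (x - (1 / c n) *\<^sub>R v)) = (LBINT s. indicat_real {0..1} s * frechet_derivative \<phi> (at (x - s *\<^sub>R (1 / c n) *\<^sub>R v)) v)"
      using c0[of n] by simp
    also have "\<bar>\<dots>\<bar> \<le> (\<integral>s. indicat_real {0..1} s * M \<partial>(lborel :: real measure))"
    proof (rule order_trans[OF integral_abs_bound], rule Bochner_Integration.integral_mono')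
      show "integrable (lborel :: real measure) (\<lambda>s. indicat_real {0..1} s * M)" by simp
    qed (use M in \<open>auto simp: abs_mult indicator_def\<close>)
    also have "\<dots> = M" by simp
    finally show ?thesis .
  qed
  then show "\<exists>M. \<forall>n x. \<bar>c n * (\<phi> x - \<phi> (x - (1 / c n) *\<^sub>R v))\<bar> \<le> M" by blast
qed

text \<open>Difference quotients of \<open>w\<close> converge in L1 on the support of \<phi> to the
  directional derivative, because they are segment averages. This carries over to \<Phi> of
  \<open>w\<close>. Summation by parts for the quotients then becomes, in the limit, the defining
  identity of the weak gradient.\<close>

lemma borel_weak_grad_chain:
  fixes w :: "'a::euclidean_space \<Rightarrow> real" and \<Phi> \<Phi>' :: "real \<Rightarrow> real"
  assumes W: "borel_weak_grad \<Omega> w G" and \<Omega>: "open \<Omega>" "convex \<Omega>"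
    and \<Phi>: "\<And>s. (\<Phi> has_real_derivative \<Phi>' s) (at s)" and M: "\<And>s. \<bar>\<Phi>' s\<bar> \<le> M"
    and cont: "continuous_on UNIV \<Phi>'"
  shows "borel_weak_grad \<Omega> (\<lambda>x. \<Phi> (w x)) (\<lambda>x. \<Phi>' (w x) *\<^sub>R G x)"
proof -
  note meas[measurable] = borel_weak_gradD(1,2)[OF W]
  have [measurable]: "\<Phi> \<in> borel_measurable borel" "\<Phi>' \<in> borel_measurable borel"
    using DERIV_isCont[OF \<Phi>] cont
    by (auto intro!: borel_measurable_continuous_onI simp: continuous_at_imp_continuous_on)
  \<comment> \<open>The mean value estimate with base point 0, c = 1 and g = 0, where the remainder
    vanishes. The resulting linear growth of \<Phi> gives local integrability.\<close>
  have \<Phi>b: "\<bar>\<Phi> s\<bar> \<le> \<bar>\<Phi> 0\<bar> + M * \<bar>s\<bar>" for s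
    by (rule difference_quotient_chain[OF \<Phi> M, of 0 s 1 0]) simp
  have int\<Phi>: "set_integrable lborel K (\<lambda>x. \<Phi> (w x))" if K: "compact K" "K \<subseteq> \<Omega>" for K
    unfolding set_integrable_def
  proof (rule Bochner_Integration.integrable_bound)
    have [measurable]: "K \<in> sets borel" using K by (simp add: borel_compact)
    have "integrable lborel (indicat_real K)"
      using emeasure_bounded_finite[OF compact_imp_bounded[OF K(1)]] by (simp add: less_top)
    then show "integrable lborel (\<lambda>x. \<bar>\<Phi> 0\<bar> * indicator K x + M * \<bar>indicator K x *\<^sub>R w x\<bar>)"
      using borel_weak_gradD(3)[OF W K] unfolding set_integrable_def by (intro Bochner_Integration.integrable_add integrable_mult_right integrable_abs)
    show "AE x in lborel. norm (indicator K x *\<^sub>R \<Phi> (w x)) \<le> norm (\<bar>\<Phi> 0\<bar> * indicator K x + M * \<bar>indicator K x *\<^sub>R w x\<bar>)"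
      using \<Phi>b by (intro AE_I2) (auto simp: indicator_def intro: order_trans[OF _ abs_ge_self])
    show "(\<lambda>x. indicat_real K x *\<^sub>R \<Phi> (w x)) \<in> borel_measurable lborel"
      using borel_compact[OF K(1)] by measurable
  qed
  have intG: "set_integrable lborel K (\<lambda>x. \<Phi>' (w x) *\<^sub>R G x)" if K: "compact K" "K \<subseteq> \<Omega>" for K
    unfolding set_integrable_def
  proof (rule Bochner_Integration.integrable_bound)
    have [measurable]: "K \<in> sets borel" using K by (simp add: borel_compact)
    show "integrable lborel (\<lambda>x. M *\<^sub>R (indicator K x *\<^sub>R G x))"
      using borel_weak_gradD(4)[OF W K] unfolding set_integrable_def by (intro integrable_scaleR_right)
    show "(\<lambda>x. indicat_real K x *\<^sub>R \<Phi>' (w x) *\<^sub>R G x) \<in> borel_measurable lborel" by measurable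
    show "AE x in lborel. norm (indicator K x *\<^sub>R \<Phi>' (w x) *\<^sub>R G x) \<le> norm (M *\<^sub>R (indicator K x *\<^sub>R G x))"
      using order_trans[OF M abs_ge_self] by (intro AE_I2) (auto simp: indicator_def intro: mult_right_mono)
  qed
  have main: "(LBINT x. \<Phi> (w x) * dderiv \<phi> v x) = - (LBINT x. ((\<Phi>' (w x) *\<^sub>R G x) \<bullet> v) * \<phi> x)"
    if t: "test_function \<Omega> \<phi>" for \<phi> v
  proof -
    obtain K where K: "compact K" "K \<subseteq> \<Omega>" "\<And>x. x \<notin> K \<Longrightarrow> \<phi> x = 0" "\<And>x v. x \<notin> K \<Longrightarrow> dderiv \<phi> v x = 0"
      by (rule test_functionE[OF t]) (rule that)
    note [measurable] = test_function_measurable[OF t]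
    obtain e where e: "e > 0" "(\<Union>x\<in>K. cball x e) \<subseteq> \<Omega>"
      using compact_subset_open_imp_cball_epsilon_subset[OF K(1) \<Omega>(1) K(2)] by metis
    \<comment> \<open>The closed \<open>e\<close>-neighbourhood of the support \<open>K\<close>. It
      contains all segments from points of \<open>K\<close> along the shifts used below.\<close>
    define K' where "K' = {x + y | x y. x \<in> K \<and> y \<in> cball 0 e}"
    have K': "compact K'" "K' \<subseteq> \<Omega>"
    proof -
      show "compact K'" unfolding K'_def by (intro compact_sums K(1) compact_cball)
      show "K' \<subseteq> \<Omega>" using e(2) unfolding K'_def by (fastforce simp: dist_norm)
    qed
    have inK': "x + y \<in> K'" if "x \<in> K" "norm y \<le> e" for x y
      using that unfolding K'_def by auto
    note [measurable] = borel_compact[OF K'(1)] borel_compact[OF K(1)]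
    \<comment> \<open>Starting the sequence at \<open>N\<close> makes every shift v / c n at most
      \<open>e\<close> long, so no estimate needs to be restricted to large n.\<close>
    obtain N :: nat where N: "norm v / e \<le> real N" using real_arch_simple by blast
    define c where "c n = real (Suc (n + N))" for n
    have c0: "c n > 0" for n by (simp add: c_def)
    have c: "filterlim c at_top sequentially" unfolding c_def
      by (rule filterlim_compose[OF filterlim_real_sequentially]) (rule filterlim_subseq, simp add: strict_mono_def)
    define h where "h n = (1 / c n) *\<^sub>R v" for n
    have h: "norm (h n) \<le> e" for n
    proof -
      have "norm v \<le> real N * e" using N e(1) by (simp add: field_simps)
      also have "\<dots> \<le> c n * e" using e(1) by (intro mult_right_mono) (auto simp: c_def)
      finally show ?thesis using c0[of n] by (simp add: h_def field_simps)
    qed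
    have h0: "h \<longlonglongrightarrow> 0"
    proof -
      have "(\<lambda>n. inverse (c n) *\<^sub>R v) \<longlonglongrightarrow> 0 *\<^sub>R v"
        by (intro tendsto_intros tendsto_inverse_0_at_top c)
      then show ?thesis by (simp add: h_def[abs_def] inverse_eq_divide)
    qed
    define u where "u x = indicat_real K' x * w x" for x
    define g where "g x = indicat_real K' x * (G x \<bullet> v)" for x
    define U where "U x = indicat_real K' x * \<Phi> (w x)" for x
    have U: "integrable lborel U"
      using int\<Phi>[OF K'] unfolding set_integrable_def U_def by simp
    have u: "integrable lborel u" and g: "integrable lborel g"
      unfolding u_def g_def by (rule borel_weak_grad_integrable[OF W K'])+
    have [measurable]: "u \<in> borel_measurable borel" "g \<in> borel_measurable borel" "U \<in> borel_measurable borel" using u g U by auto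
    \<comment> \<open>Near the boundary of \<open>K'\<close> the cut-off spoils the segment
      identity. It holds on \<open>K\<close>, and \<open>K\<close> is all that \<phi> sees.\<close>
    let ?M = "restrict_space lborel K"
    have Ks: "K \<inter> space lborel \<in> sets lborel" by simp
    have ires: "integrable ?M f" if "integrable lborel f" for f :: "'a \<Rightarrow> real"
      unfolding integrable_restrict_space[OF Ks] using integrable_mult_indicator[OF _ that, of K] by simp
    have ae: "AE x in ?M. c n * (u (x + h n) - u x) - g x = segment_avg g (h n) x - g x" for n
      unfolding AE_restrict_space_iff[OF Ks]
      using weak_grad_difference[OF W \<Omega>, of "h n"]
    proof eventually_elim
      case (elim x)
      show ?case
      proof
        assume x: "x \<in> K"
        then have x': "x \<in> K'" "x + h n \<in> K'" using inK'[of x 0] inK'[of x "h n"] h e(1) by auto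
        then have "w (x + h n) - w x = segment_avg (\<lambda>y. G y \<bullet> h n) (h n) x" using elim K'(2) by blast
        also have "\<dots> = segment_avg (\<lambda>y. (1 / c n) * g y) (h n) x"
        proof (rule segment_avg_cong)
          fix s :: real assume s: "0 \<le> s" "s \<le> 1"
          have "norm (s *\<^sub>R h n) \<le> 1 * e" unfolding norm_scaleR using s h by (intro mult_mono) auto
          then have "x + s *\<^sub>R h n \<in> K'" using inK'[OF x] by simp
          then show "G (x + s *\<^sub>R h n) \<bullet> h n = (1 / c n) * g (x + s *\<^sub>R h n)"
            by (simp add: g_def h_def)
        qed
        also have "\<dots> = (1 / c n) * segment_avg g (h n) x"
          unfolding segment_avg_def by (simp flip: integral_mult_right_zero add: mult_ac)
        finally show "c n * (u (x + h n) - u x) - g x = segment_avg g (h n) x - g x"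
          using x' c0[of n] by (simp add: u_def)
      qed
    qed
    have "\<exists>r. strict_mono r \<and> (\<forall>n. integrable ?M (\<lambda>x. c n * (\<Phi> (u (x + h n)) - \<Phi> (u x)) - \<Phi>' (u x) * g x)) \<and>
      (\<lambda>n. \<integral>x. \<bar>c (r n) * (\<Phi> (u (x + h (r n))) - \<Phi> (u x)) - \<Phi>' (u x) * g x\<bar> \<partial>?M) \<longlonglongrightarrow> 0"
    proof (rule chain_rule_L1[OF \<Phi> M cont])
      show "(\<lambda>x. u (x + h n)) \<in> borel_measurable ?M" for n by (intro measurable_restrict_space1) measurable
      show "u \<in> borel_measurable ?M" by (intro measurable_restrict_space1) measurable
      show "integrable ?M g" by (rule ires[OF g])
      show "integrable ?M (\<lambda>x. c n * (u (x + h n) - u x) - g x)" for n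
        using u g integrable_lborel_translate[OF u] by (intro ires) auto
      have "(\<integral>x. \<bar>c n * (u (x + h n) - u x) - g x\<bar> \<partial>?M) \<le> (LBINT x. \<bar>segment_avg g (h n) x - g x\<bar>)" for n
      proof -
        have i: "integrable lborel (\<lambda>x. \<bar>segment_avg g (h n) x - g x\<bar>)"
          using integrable_segment_avg[OF g] g by auto
        have "(\<integral>x. \<bar>c n * (u (x + h n) - u x) - g x\<bar> \<partial>?M) = (\<integral>x. \<bar>segment_avg g (h n) x - g x\<bar> \<partial>?M)"
        proof (rule integral_cong_AE)
          show "AE x in ?M. \<bar>c n * (u (x + h n) - u x) - g x\<bar> = \<bar>segment_avg g (h n) x - g x\<bar>"
            using ae[of n] by eventually_elim simp
        qed (intro measurable_restrict_space1, measurable)+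
        also have "\<dots> = (LBINT x. indicator K x *\<^sub>R \<bar>segment_avg g (h n) x - g x\<bar>)"
          by (rule integral_restrict_space[OF Ks])
        also have "\<dots> \<le> (LBINT x. \<bar>segment_avg g (h n) x - g x\<bar>)"
          using i by (intro Bochner_Integration.integral_mono' ) (auto simp: indicator_def)
        finally show ?thesis .
      qed
      then show "(\<lambda>n. \<integral>x. \<bar>c n * (u (x + h n) - u x) - g x\<bar> \<partial>?M) \<longlonglongrightarrow> 0"
        by (intro Lim_null_comparison[OF _ segment_avg_tendsto_L1[OF g h0]]) auto
    qed (rule c)
    then obtain r where r: "strict_mono r"
      and qi: "\<And>n. integrable ?M (\<lambda>x. c n * (\<Phi> (u (x + h n)) - \<Phi> (u x)) - \<Phi>' (u x) * g x)"
      and ql: "(\<lambda>n. \<integral>x. \<bar>c (r n) * (\<Phi> (u (x + h (r n))) - \<Phi> (u x)) - \<Phi>' (u x) * g x\<bar> \<partial>?M) \<longlonglongrightarrow> 0"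
      by blast
    define q where "q n x = indicat_real K x * (c n * (U (x + h n) - U x) - \<Phi>' (w x) * g x)" for n x
    have q_eq: "q n x = indicat_real K x *\<^sub>R (c n * (\<Phi> (u (x + h n)) - \<Phi> (u x)) - \<Phi>' (u x) * g x)" for n x
    proof (cases "x \<in> K")
      case True
      then have "x \<in> K'" "x + h n \<in> K'" using inK'[of x 0] inK'[of x "h n"] h e(1) by auto
      then show ?thesis by (simp add: q_def U_def u_def)
    qed (simp add: q_def)
    have q_int: "integrable lborel (q n)" for n
      using qi[of n] unfolding integrable_restrict_space[OF Ks] q_eq[abs_def] .
    have q_abs: "\<bar>q n x\<bar> = indicat_real K x *\<^sub>R \<bar>c n * (\<Phi> (u (x + h n)) - \<Phi> (u x)) - \<Phi>' (u x) * g x\<bar>" for n x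
      unfolding q_eq by (simp add: indicator_def)
    have q_lim: "(\<lambda>n. LBINT x. \<bar>q (r n) x\<bar>) \<longlonglongrightarrow> 0"
      using ql unfolding integral_restrict_space[OF Ks] q_abs .
    obtain C where C: "C \<ge> 0" "\<And>x. \<bar>\<phi> x\<bar> \<le> C" by (rule test_function_bounded[OF t]) (rule that)
    note bi = integrable_mult_bounded
    have G: "integrable lborel (\<lambda>x. \<Phi>' (w x) * g x * \<phi> x)"
      using bi[OF bi[OF g, of "\<lambda>x. \<Phi>' (w x)" M] _ C(2)] M by (simp add: mult.commute)
    have dq: "(\<lambda>n. LBINT x. U x * (c n * (\<phi> x - \<phi> (x - h n)))) \<longlonglongrightarrow> (LBINT x. U x * dderiv \<phi> v x)"
    proof -
      obtain C' where C': "\<And>n x. \<bar>c n * (\<phi> x - \<phi> (x - h n))\<bar> \<le> C'"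
        using test_function_difference_quotient(2)[OF t c c0, of v] unfolding h_def by blast
      show ?thesis
      proof (rule integral_dominated_convergence[where w="\<lambda>x. C' * \<bar>U x\<bar>"])
        show "AE x in lborel. norm (U x * (c n * (\<phi> x - \<phi> (x - h n)))) \<le> C' * \<bar>U x\<bar>" for n
          using C' by (intro AE_I2) (auto simp: abs_mult[of "U _"] mult.commute[of "\<bar>U _\<bar>"] intro!: mult_right_mono)
        show "AE x in lborel. (\<lambda>n. U x * (c n * (\<phi> x - \<phi> (x - h n)))) \<longlonglongrightarrow> U x * dderiv \<phi> v x"
          unfolding h_def by (intro AE_I2 tendsto_intros test_function_difference_quotient(1)[OF t c c0])
        show "integrable lborel (\<lambda>x. C' * \<bar>U x\<bar>)" using U by auto
      qed measurable
    qed
    \<comment> \<open>Summation by parts: the backward quotient of \<phi> becomes minus the forward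
      quotient of \<open>U\<close>, which on \<open>K\<close> is the expected derivative plus the
      error \<open>q\<close>.\<close>
    have "(LBINT x. U x * (c n * (\<phi> x - \<phi> (x - h n)))) = - (LBINT x. q n x * \<phi> x) - (LBINT x. \<Phi>' (w x) * g x * \<phi> x)" for n
    proof -
      have i: "integrable lborel (\<lambda>x. U x * \<phi> x)" "integrable lborel (\<lambda>x. U x * \<phi> (x - h n))" "integrable lborel (\<lambda>x. U (x + h n) * \<phi> x)"
        by (intro bi[of _ _ C] U integrable_lborel_translate C(2); measurable)+
      have tr: "(LBINT x. U x * \<phi> (x - h n)) = (LBINT x. U (x + h n) * \<phi> x)"
        using integral_lborel_translate[of "\<lambda>x. U x * \<phi> (x - h n)" "h n"] by simp
      have "(LBINT x. U x * (c n * (\<phi> x - \<phi> (x - h n)))) = (LBINT x. c n * (U x * \<phi> x - U x * \<phi> (x - h n)))"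
        by (simp add: algebra_simps)
      also have "\<dots> = c n * ((LBINT x. U x * \<phi> x) - (LBINT x. U (x + h n) * \<phi> x))"
        using i by (simp add: tr)
      also have "\<dots> = (LBINT x. c n * (U x * \<phi> x - U (x + h n) * \<phi> x))"
        using i by simp
      also have "\<dots> = (LBINT x. - (q n x * \<phi> x) - \<Phi>' (w x) * g x * \<phi> x)"
      proof (rule Bochner_Integration.integral_cong[OF refl])
        fix x show "c n * (U x * \<phi> x - U (x + h n) * \<phi> x) = - (q n x * \<phi> x) - \<Phi>' (w x) * g x * \<phi> x"
          using K(3)[of x] by (cases "x \<in> K") (auto simp: q_def algebra_simps)
      qed
      also have "\<dots> = - (LBINT x. q n x * \<phi> x) - (LBINT x. \<Phi>' (w x) * g x * \<phi> x)"
        using G bi[OF q_int _ C(2)] by simp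
      finally show ?thesis .
    qed
    moreover have "(\<lambda>n. LBINT x. q (r n) x * \<phi> x) \<longlonglongrightarrow> 0"
    proof (rule Lim_null_comparison)
      show "(\<lambda>n. C * (LBINT x. \<bar>q (r n) x\<bar>)) \<longlonglongrightarrow> 0"
        using tendsto_mult_left[OF q_lim, of C] by simp
      have "\<bar>\<integral>x. q n x * \<phi> x \<partial>lborel\<bar> \<le> (LBINT x. C * \<bar>q n x\<bar>)" for n
        by (rule order_trans[OF integral_abs_bound Bochner_Integration.integral_mono'])
          (use q_int C in \<open>auto simp: abs_mult mult.commute[of "\<bar>q _ _\<bar>"] intro!: mult_right_mono\<close>)
      then show "\<forall>\<^sub>F n in sequentially. norm (LBINT x. q (r n) x * \<phi> x) \<le> C * (LBINT x. \<bar>q (r n) x\<bar>)"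
        by simp
    qed
    ultimately have "(\<lambda>n. LBINT x. U x * (c (r n) * (\<phi> x - \<phi> (x - h (r n))))) \<longlonglongrightarrow> - 0 - (LBINT x. \<Phi>' (w x) * g x * \<phi> x)"
      by (simp only:) (intro tendsto_intros)
    with LIMSEQ_subseq_LIMSEQ[OF dq r] have "(LBINT x. U x * dderiv \<phi> v x) = - (LBINT x. \<Phi>' (w x) * g x * \<phi> x)"
      unfolding comp_def by (auto dest: LIMSEQ_unique)
    moreover have "x \<in> K'" if "x \<in> K" for x using inK'[OF that, of 0] e(1) by simp
    then have "U x * dderiv \<phi> v x = \<Phi> (w x) * dderiv \<phi> v x"
      "\<Phi>' (w x) * g x * \<phi> x = ((\<Phi>' (w x) *\<^sub>R G x) \<bullet> v) * \<phi> x" for x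
      using K(3,4)[of x] by (cases "x \<in> K"; simp add: U_def g_def)+
    ultimately show ?thesis by simp
  qed
  show ?thesis
    unfolding borel_weak_grad_def using int\<Phi> intG main by auto
qed

section \<open>The positive part\<close>

text \<open>Smoothing the positive part by \<open>(s + sqrt (s\<^sup>2 + d\<^sup>2)) / 2\<close> produces the factor \<open>1/2\<close> on \<open>{w = 0}\<close>.
  Its value there is immaterial, as \<open>G\<close> vanishes almost everywhere on that set.\<close>

lemma borel_weak_grad_pos_part:
  fixes w :: "'a::euclidean_space \<Rightarrow> real"
  assumes W: "borel_weak_grad \<Omega> w G" and \<Omega>: "open \<Omega>" "convex \<Omega>"
  shows "borel_weak_grad \<Omega> (\<lambda>x. max (w x) 0) (\<lambda>x. ((1 + sgn (w x)) / 2) *\<^sub>R G x)"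
proof -
  note meas[measurable] = borel_weak_gradD(1,2)[OF W]
  define d where "d n = 1 / real (Suc n)" for n
  have d0: "d n > 0" "d n \<le> 1" for n by (auto simp: d_def)
  have d: "d \<longlonglongrightarrow> 0" unfolding d_def by (rule LIMSEQ_Suc[OF lim_1_over_n])
  define \<Phi> where "\<Phi> n s = (s + sqrt (s\<^sup>2 + (d n)\<^sup>2)) / 2" for n and s :: real
  define \<Phi>' where "\<Phi>' n s = (1 + s / sqrt (s\<^sup>2 + (d n)\<^sup>2)) / 2" for n and s :: real
  have pos: "s\<^sup>2 + (d n)\<^sup>2 > 0" for s n using d0[of n] by (simp add: add_nonneg_pos)
  have der: "(\<Phi> n has_real_derivative \<Phi>' n s) (at s)" for n s
    unfolding \<Phi>_def \<Phi>'_def using pos[of s n] by (auto intro!: derivative_eq_intros simp: field_simps)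
  have quot: "\<bar>s / sqrt (s\<^sup>2 + (d n)\<^sup>2)\<bar> \<le> 1" for n s
  proof -
    have "\<bar>s\<bar> \<le> sqrt (s\<^sup>2 + (d n)\<^sup>2)" by (rule real_le_rsqrt) simp
    then show ?thesis using pos[of s n] by (simp add: divide_le_eq)
  qed
  have \<Phi>'b: "\<bar>\<Phi>' n s\<bar> \<le> 1" for n s 
  proof -
    have "\<bar>(1 + q) / 2\<bar> \<le> 1" if "\<bar>q\<bar> \<le> 1" for q :: real using that by (auto simp: abs_le_iff)
    then show ?thesis unfolding \<Phi>'_def using quot by blast
  qed
  have cont: "continuous_on UNIV (\<Phi>' n)" for n
    unfolding \<Phi>'_def using pos[of _ n] by (auto intro!: continuous_intros simp: less_imp_neq[symmetric])
  have chain: "borel_weak_grad \<Omega> (\<lambda>x. \<Phi> n (w x)) (\<lambda>x. \<Phi>' n (w x) *\<^sub>R G x)" for n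
    by (rule borel_weak_grad_chain[OF W \<Omega> der \<Phi>'b cont])
  have lim: "(\<lambda>n. \<Phi> n s) \<longlonglongrightarrow> max s 0" for s
  proof -
    have "(\<lambda>n. \<Phi> n s) \<longlonglongrightarrow> (s + sqrt (s\<^sup>2 + 0\<^sup>2)) / 2"
      unfolding \<Phi>_def by (intro tendsto_intros d) auto
    moreover have "(s + sqrt (s\<^sup>2 + 0\<^sup>2)) / 2 = max s 0" by simp
    ultimately show ?thesis by (simp only:)
  qed
  have lim': "(\<lambda>n. \<Phi>' n s) \<longlonglongrightarrow> (1 + sgn s) / 2" for s
  proof (cases "s = 0")
    case False
    have "(\<lambda>n. \<Phi>' n s) \<longlonglongrightarrow> (1 + s / sqrt (s\<^sup>2 + 0\<^sup>2)) / 2"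
      unfolding \<Phi>'_def by (intro tendsto_intros d) (use False in auto)
    then show ?thesis by (simp add: real_sgn_eq)
  qed (simp add: \<Phi>'_def)
  have \<Phi>b: "\<bar>\<Phi> n s\<bar> \<le> 1 + \<bar>s\<bar>" for n s
  proof -
    have "sqrt (s\<^sup>2 + (d n)\<^sup>2) \<le> \<bar>s\<bar> + \<bar>d n\<bar>" using sqrt_add_le_add_sqrt[of "s\<^sup>2" "(d n)\<^sup>2"] by simp
    moreover have "sqrt (s\<^sup>2 + (d n)\<^sup>2) \<ge> 0" using pos[of s n] by simp
    ultimately have "\<bar>s + sqrt (s\<^sup>2 + (d n)\<^sup>2)\<bar> \<le> 2 * (1 + \<bar>s\<bar>)"
      using d0[of n] abs_triangle_ineq[of s "sqrt (s\<^sup>2 + (d n)\<^sup>2)"] abs_ge_zero[of s]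
      unfolding abs_of_pos[OF d0(1)] abs_of_nonneg[OF \<open>sqrt (s\<^sup>2 + (d n)\<^sup>2) \<ge> 0\<close>] by argo
    then show ?thesis unfolding \<Phi>_def by simp
  qed
  have sg: "\<bar>(1 + sgn s) / 2\<bar> \<le> 1" for s :: real by (auto simp: sgn_real_def)
  show ?thesis
    unfolding borel_weak_grad_def
  proof (intro conjI allI impI)
    show "(\<lambda>x. max (w x) 0) \<in> borel_measurable borel" "(\<lambda>x. ((1 + sgn (w x)) / 2) *\<^sub>R G x) \<in> borel_measurable borel"
      by measurable
    fix K assume K: "compact K" "K \<subseteq> \<Omega>"
    note [measurable] = borel_compact[OF K(1)]
    show "set_integrable lborel K (\<lambda>x. max (w x) 0)"
      using borel_weak_gradD(3)[OF W K] unfolding set_integrable_def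
      by (rule Bochner_Integration.integrable_bound) (auto simp: indicator_def)
    show "set_integrable lborel K (\<lambda>x. ((1 + sgn (w x)) / 2) *\<^sub>R G x)"
      using borel_weak_gradD(4)[OF W K] unfolding set_integrable_def
    proof (rule Bochner_Integration.integrable_bound)
      show "AE x in lborel. norm (indicat_real K x *\<^sub>R ((1 + sgn (w x)) / 2) *\<^sub>R G x) \<le> norm (indicat_real K x *\<^sub>R G x)"
      proof (rule AE_I2)
        fix x
        have "\<bar>(1 + sgn (w x)) / 2\<bar> * norm (G x) \<le> 1 * norm (G x)" using sg by (intro mult_right_mono) auto
        then show "norm (indicat_real K x *\<^sub>R ((1 + sgn (w x)) / 2) *\<^sub>R G x) \<le> norm (indicat_real K x *\<^sub>R G x)"
          by (simp add: indicator_def)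
      qed
    qed measurable
  next
    fix \<phi> v assume t: "test_function \<Omega> \<phi>"
    obtain K where K: "compact K" "K \<subseteq> \<Omega>" "\<And>x. x \<notin> K \<Longrightarrow> \<phi> x = 0" "\<And>x v. x \<notin> K \<Longrightarrow> dderiv \<phi> v x = 0"
      by (rule test_functionE[OF t]) (rule that)
    note [measurable] = test_function_measurable[OF t]
    obtain C where C: "C \<ge> 0" "\<And>x. \<bar>\<phi> x\<bar> \<le> C" by (rule test_function_bounded[OF t]) (rule that)
    obtain C' where C': "C' \<ge> 0" "\<And>x. \<bar>dderiv \<phi> v x\<bar> \<le> C'"
      by (rule test_function_dderiv_bounded[OF t, of v]) (rule that)
    have [measurable]: "K \<in> sets borel" "\<Phi>' n \<in> borel_measurable borel" for n
      using K cont by (auto intro!: borel_measurable_continuous_onI borel_compact simp del: continuous_on_eq_continuous_at)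
    have [measurable]: "\<Phi> n \<in> borel_measurable borel" for n
      unfolding \<Phi>_def by measurable
    have "integrable lborel (indicat_real K)"
      using emeasure_bounded_finite[OF compact_imp_bounded[OF K(1)]] by (simp add: less_top)
    then have i1: "integrable lborel (\<lambda>x. C' * (indicat_real K x + \<bar>indicat_real K x *\<^sub>R w x\<bar>))"
      using borel_weak_gradD(3)[OF W K(1,2)] unfolding set_integrable_def
      by (intro integrable_mult_right Bochner_Integration.integrable_add integrable_abs)
    have i2: "integrable lborel (\<lambda>x. C * \<bar>(indicat_real K x *\<^sub>R G x) \<bullet> v\<bar>)"
      using borel_weak_gradD(4)[OF W K(1,2)] unfolding set_integrable_def
      by (intro integrable_mult_right integrable_abs integrable_inner_left)
    have L1: "(\<lambda>n. LBINT x. \<Phi> n (w x) * dderiv \<phi> v x) \<longlonglongrightarrow> (LBINT x. max (w x) 0 * dderiv \<phi> v x)"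
    proof (rule integral_dominated_convergence[OF _ _ i1])
      show "AE x in lborel. norm (\<Phi> n (w x) * dderiv \<phi> v x) \<le> C' * (indicat_real K x + \<bar>indicat_real K x *\<^sub>R w x\<bar>)" for n
      proof (rule AE_I2)
        fix x show "norm (\<Phi> n (w x) * dderiv \<phi> v x) \<le> C' * (indicat_real K x + \<bar>indicat_real K x *\<^sub>R w x\<bar>)"
        proof (cases "x \<in> K")
          case True
          have "\<bar>\<Phi> n (w x)\<bar> * \<bar>dderiv \<phi> v x\<bar> \<le> (1 + \<bar>w x\<bar>) * C'"
            using \<Phi>b C' by (intro mult_mono) auto
          then show ?thesis using True by (simp add: abs_mult mult.commute)
        qed (simp add: K(4))
      qed
      show "AE x in lborel. (\<lambda>n. \<Phi> n (w x) * dderiv \<phi> v x) \<longlonglongrightarrow> max (w x) 0 * dderiv \<phi> v x"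
        by (intro AE_I2 tendsto_intros lim)
    qed measurable
    have L2: "(\<lambda>n. LBINT x. ((\<Phi>' n (w x) *\<^sub>R G x) \<bullet> v) * \<phi> x) \<longlonglongrightarrow> (LBINT x. ((((1 + sgn (w x)) / 2) *\<^sub>R G x) \<bullet> v) * \<phi> x)"
    proof (rule integral_dominated_convergence[OF _ _ i2])
      show "AE x in lborel. norm (((\<Phi>' n (w x) *\<^sub>R G x) \<bullet> v) * \<phi> x) \<le> C * \<bar>(indicat_real K x *\<^sub>R G x) \<bullet> v\<bar>" for n
      proof (rule AE_I2)
        fix x show "norm (((\<Phi>' n (w x) *\<^sub>R G x) \<bullet> v) * \<phi> x) \<le> C * \<bar>(indicat_real K x *\<^sub>R G x) \<bullet> v\<bar>"
        proof (cases "x \<in> K")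
          case True
          have "\<bar>\<Phi>' n (w x)\<bar> * \<bar>\<phi> x\<bar> \<le> 1 * C"
            using \<Phi>'b C by (intro mult_mono) auto
          then have "\<bar>\<Phi>' n (w x)\<bar> * \<bar>\<phi> x\<bar> * \<bar>G x \<bullet> v\<bar> \<le> C * \<bar>G x \<bullet> v\<bar>" by (intro mult_right_mono) auto
          then show ?thesis using True by (simp add: abs_mult mult_ac)
        qed (simp add: K(3))
      qed
      show "AE x in lborel. (\<lambda>n. ((\<Phi>' n (w x) *\<^sub>R G x) \<bullet> v) * \<phi> x) \<longlonglongrightarrow> ((((1 + sgn (w x)) / 2) *\<^sub>R G x) \<bullet> v) * \<phi> x"
        by (intro AE_I2 tendsto_intros lim')
    qed measurable
    show "(LBINT x. max (w x) 0 * dderiv \<phi> v x) = - (LBINT x. ((((1 + sgn (w x)) / 2) *\<^sub>R G x) \<bullet> v) * \<phi> x)"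
      by (rule LIMSEQ_unique[OF L1[unfolded borel_weak_gradD(5)[OF chain t]] tendsto_minus[OF L2]])
  qed
qed

section \<open>Borel representatives and uniqueness\<close>

lemma lebesgue_ex_borel_measurable:
  fixes f :: "'a::euclidean_space \<Rightarrow> 'b::euclidean_space"
  assumes f: "f \<in> borel_measurable lebesgue"
  obtains f' where "f' \<in> borel_measurable borel" "AE x in lborel. f x = f' x"
proof -
  have "\<exists>g'. g' \<in> borel_measurable lborel \<and> (AE x in lborel. f x \<bullet> i = g' x)" for i
    using completion_ex_borel_measurable_real[of "\<lambda>x. f x \<bullet> i" lborel] f by auto
  then obtain g where g: "\<And>i. g i \<in> borel_measurable lborel" "\<And>i. AE x in lborel. f x \<bullet> i = g i x"
    by metis
  define f' where "f' x = (\<Sum>i\<in>Basis. g i x *\<^sub>R i)" for x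
  show thesis
  proof
    show "f' \<in> borel_measurable borel" using g(1) unfolding f'_def by simp
    have "AE x in lborel. \<forall>i\<in>Basis. f x \<bullet> i = g i x" using g(2) by (intro AE_finite_allI) auto
    then show "AE x in lborel. f x = f' x"
      unfolding f'_def by eventually_elim (metis (no_types, lifting) euclidean_representation sum.cong)
  qed
qed

lemma lebesgue_on_ex_borel_measurable:
  fixes f :: "'a::euclidean_space \<Rightarrow> 'b::euclidean_space"
  assumes "f \<in> borel_measurable (lebesgue_on S)" "S \<in> sets lebesgue"
  obtains f' where "f' \<in> borel_measurable borel" "AE x in lborel. x \<in> S \<longrightarrow> f x = f' x"
proof -
  have "(\<lambda>x. indicator S x *\<^sub>R f x) \<in> borel_measurable lebesgue"
    using assms by (subst (asm) borel_measurable_restrict_space_iff) auto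
  then obtain f' where "f' \<in> borel_measurable borel" "AE x in lborel. indicator S x *\<^sub>R f x = f' x"
    by (rule lebesgue_ex_borel_measurable)
  then show thesis by (intro that[of f']) (auto elim!: eventually_mono)
qed

text \<open>The definition gives measurability only on compact subsets of \<Omega>. A compact
  exhaustion yields it on \<Omega>, after which Borel versions exist.\<close>

lemma is_weak_grad_borel_representative:
  fixes f :: "'a::euclidean_space \<Rightarrow> real"
  assumes w: "is_weak_grad \<Omega> f G" and \<Omega>: "open \<Omega>"
  obtains f' G' where "AE x in lborel. x \<in> \<Omega> \<longrightarrow> f x = f' x" "AE x in lborel. x \<in> \<Omega> \<longrightarrow> G x = G' x"
    "borel_weak_grad \<Omega> f' G'"
proof -
  obtain C :: "nat \<Rightarrow> 'a set" where C: "\<And>n. compact (C n)" "\<And>n. C n \<subseteq> \<Omega>" "\<And>n. C n \<subseteq> interior (C (Suc n))" "\<Union>(range C) = \<Omega>"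
    by (rule open_Union_compact_subsets[OF \<Omega>]) (rule that)
  have mono: "C m \<subseteq> C n" if "m \<le> n" for m n
    by (rule lift_Suc_mono_le[OF _ that]) (use C(3) interior_subset in \<open>meson order_trans\<close>)
  have meas: "(\<lambda>x. indicator \<Omega> x *\<^sub>R g x) \<in> borel_measurable lebesgue"
    if "\<And>K. compact K \<Longrightarrow> K \<subseteq> \<Omega> \<Longrightarrow> g absolutely_integrable_on K" for g :: "'a \<Rightarrow> 'b::euclidean_space"
  proof (rule borel_measurable_LIMSEQ_metric)
    show "(\<lambda>x. indicator (C n) x *\<^sub>R g x) \<in> borel_measurable lebesgue" for n
      using that[OF C(1,2)] unfolding set_integrable_def by auto
    fix x
    show "(\<lambda>n. indicator (C n) x *\<^sub>R g x) \<longlonglongrightarrow> indicator \<Omega> x *\<^sub>R g x"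
    proof (cases "x \<in> \<Omega>")
      case True
      then obtain N where "x \<in> C N" using C(4) by auto
      then have "x \<in> C n" if "n \<ge> N" for n using mono[OF that] by auto
      then have "eventually (\<lambda>n. indicator (C n) x *\<^sub>R g x = indicator \<Omega> x *\<^sub>R g x) sequentially"
        using True by (intro eventually_sequentiallyI[of N]) auto
      then show ?thesis by (rule tendsto_eventually)
    next
      case False
      then have "x \<notin> C n" for n using C(2) by auto
      then show ?thesis using False by simp
    qed
  qed
  have ai: "f absolutely_integrable_on K" "G absolutely_integrable_on K" if "compact K" "K \<subseteq> \<Omega>" for K
    using w that unfolding is_weak_grad_def by blast+
  have m: "(\<lambda>x. indicator \<Omega> x *\<^sub>R f x) \<in> borel_measurable lebesgue" "(\<lambda>x. indicator \<Omega> x *\<^sub>R G x) \<in> borel_measurable lebesgue"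
    by ((rule meas, rule ai; assumption))+
  obtain f' where f': "f' \<in> borel_measurable borel" "AE x in lborel. indicator \<Omega> x *\<^sub>R f x = f' x"
    by (rule lebesgue_ex_borel_measurable[OF m(1)])
  obtain G' where G': "G' \<in> borel_measurable borel" "AE x in lborel. indicator \<Omega> x *\<^sub>R G x = G' x"
    by (rule lebesgue_ex_borel_measurable[OF m(2)])
  have e: "AE x in lborel. x \<in> \<Omega> \<longrightarrow> f x = f' x"
    using f'(2) by eventually_elim (auto simp: indicator_def)
  have e': "AE x in lborel. x \<in> \<Omega> \<longrightarrow> G x = G' x"
    using G'(2) by eventually_elim (auto simp: indicator_def)
  have "is_weak_grad \<Omega> f' G'"
    by (rule is_weak_grad_cong_AE[OF AE_completion[OF e] AE_completion[OF e'] w])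
  then have "borel_weak_grad \<Omega> f' G'" unfolding is_weak_grad_iff_borel[OF f'(1) G'(1)] .
  with e e' show thesis by (rule that)
qed

lemma borel_weak_grad_unique:
  fixes w :: "'a::euclidean_space \<Rightarrow> real"
  assumes G: "borel_weak_grad \<Omega> w G" and H: "borel_weak_grad \<Omega> w' H" and \<Omega>: "open \<Omega>"
    and eq: "AE x in lborel. x \<in> \<Omega> \<longrightarrow> w x = w' x"
  shows "AE x in lborel. x \<in> \<Omega> \<longrightarrow> G x = H x"
proof -
  note [measurable] = borel_weak_gradD(1,2)[OF G] borel_weak_gradD(1,2)[OF H]
  have "AE x in lborel. x \<in> \<Omega> \<longrightarrow> (G x - H x) \<bullet> i = 0" for i
  proof (rule test_function_AE_zero[OF \<Omega>])
    show "(\<lambda>x. (G x - H x) \<bullet> i) \<in> borel_measurable borel" by measurable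
    have Gi: "integrable lborel (\<lambda>x. (indicat_real K x *\<^sub>R F x) \<bullet> i)" if "set_integrable lborel K F" for K F
      using that unfolding set_integrable_def by (intro integrable_inner_left)
    show "set_integrable lborel K (\<lambda>x. (G x - H x) \<bullet> i)" if "compact K" "K \<subseteq> \<Omega>" for K
      using Bochner_Integration.integrable_diff[OF Gi[OF borel_weak_gradD(4)[OF G that]] Gi[OF borel_weak_gradD(4)[OF H that]]] unfolding set_integrable_def
      by (simp add: inner_diff_left right_diff_distrib)
    fix \<phi> assume t: "test_function \<Omega> \<phi>"
    obtain K where K: "compact K" "K \<subseteq> \<Omega>" "\<And>x. x \<notin> K \<Longrightarrow> \<phi> x = 0" "\<And>x v. x \<notin> K \<Longrightarrow> dderiv \<phi> v x = 0"
      by (rule test_functionE[OF t]) (rule that)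
    note [measurable] = test_function_measurable[OF t]
    obtain C where C: "C \<ge> 0" "\<And>x. \<bar>\<phi> x\<bar> \<le> C" by (rule test_function_bounded[OF t]) (rule that)
    have bi: "integrable lborel (\<lambda>x. (F x \<bullet> i) * \<phi> x)"
      if "integrable lborel (\<lambda>x. (indicat_real K x *\<^sub>R F x) \<bullet> i)" "F \<in> borel_measurable borel" for F
    proof (rule Bochner_Integration.integrable_bound[OF integrable_mult_right[OF that(1), of C]])
      show "(\<lambda>x. (F x \<bullet> i) * \<phi> x) \<in> borel_measurable lborel" using that(2) by measurable
      show "AE x in lborel. norm ((F x \<bullet> i) * \<phi> x) \<le> norm (C * ((indicat_real K x *\<^sub>R F x) \<bullet> i))"
      proof (rule AE_I2)
        fix x show "norm ((F x \<bullet> i) * \<phi> x) \<le> norm (C * ((indicat_real K x *\<^sub>R F x) \<bullet> i))"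
          using C K(3)[of x] by (cases "x \<in> K") (auto simp: abs_mult mult.commute intro!: mult_right_mono)
      qed
    qed
    have "(LBINT x. ((G x - H x) \<bullet> i) * \<phi> x) = (LBINT x. (G x \<bullet> i) * \<phi> x) - (LBINT x. (H x \<bullet> i) * \<phi> x)"
      using bi[OF Gi[OF borel_weak_gradD(4)[OF G K(1,2)]]] bi[OF Gi[OF borel_weak_gradD(4)[OF H K(1,2)]]] by (simp add: inner_diff_left left_diff_distrib)
    also have "\<dots> = - (LBINT x. w x * dderiv \<phi> i x) + (LBINT x. w' x * dderiv \<phi> i x)"
      using borel_weak_gradD(5)[OF G t, of i] borel_weak_gradD(5)[OF H t, of i] by simp
    also have "(LBINT x. w x * dderiv \<phi> i x) = (LBINT x. w' x * dderiv \<phi> i x)"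
    proof (rule integral_cong_AE)
      show "AE x in lborel. w x * dderiv \<phi> i x = w' x * dderiv \<phi> i x"
        using eq
      proof eventually_elim
        case (elim x) then show ?case using K(2) K(4)[of x i] by (cases "x \<in> K") auto
      qed
    qed measurable
    finally show "(LBINT x. ((G x - H x) \<bullet> i) * \<phi> x) = 0" by simp
  qed
  then have "AE x in lborel. \<forall>i\<in>Basis. x \<in> \<Omega> \<longrightarrow> (G x - H x) \<bullet> i = 0"
    by (intro AE_finite_allI) auto
  then show ?thesis
  proof eventually_elim
    case (elim x)
    show ?case
    proof
      assume "x \<in> \<Omega>"
      then have "G x \<bullet> i = H x \<bullet> i" if "i \<in> Basis" for i
        using elim[rule_format, OF that] by (simp add: inner_diff_left)
      then show "G x = H x" by (rule euclidean_eqI)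
    qed
  qed
qed

text \<open>This turns the choice behind \<open>weak_grad\<close> into a formula. Existence of a
  weak gradient of the positive part shows that the chosen function is one, and uniqueness
  identifies it almost everywhere.\<close>

lemma weak_grad_pos_part_AE:
  fixes w :: "'a::euclidean_space \<Rightarrow> real"
  assumes W: "borel_weak_grad \<Omega> w G" and \<Omega>: "open \<Omega>" "convex \<Omega>"
    and f: "AE x in lborel. x \<in> \<Omega> \<longrightarrow> f x = max (w x) 0"
  shows "AE x in lborel. x \<in> \<Omega> \<longrightarrow> weak_grad \<Omega> f x = ((1 + sgn (w x)) / 2) *\<^sub>R G x"
proof -
  note P = borel_weak_grad_pos_part[OF W \<Omega>]
  have "is_weak_grad \<Omega> f (\<lambda>x. ((1 + sgn (w x)) / 2) *\<^sub>R G x)"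
    by (rule is_weak_grad_cong_AE[OF AE_completion _ P[folded is_weak_grad_iff_borel[OF borel_weak_gradD(1,2)[OF P]]]])
      (use f in \<open>auto elim!: eventually_mono\<close>)
  then have "is_weak_grad \<Omega> f (weak_grad \<Omega> f)" unfolding weak_grad_def by (rule someI[of "is_weak_grad \<Omega> f"])
  then obtain f' H where *: "AE x in lborel. x \<in> \<Omega> \<longrightarrow> f x = f' x" "AE x in lborel. x \<in> \<Omega> \<longrightarrow> weak_grad \<Omega> f x = H x"
    "borel_weak_grad \<Omega> f' H" by (rule is_weak_grad_borel_representative[OF _ \<Omega>(1)])
  have "AE x in lborel. x \<in> \<Omega> \<longrightarrow> max (w x) 0 = f' x" using f *(1) by eventually_elim auto
  from borel_weak_grad_unique[OF P *(3) \<Omega>(1) this] *(2) show ?thesis by eventually_elim auto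
qed

section \<open>De Giorgi's isoperimetric inequality\<close>

text \<open>No exceptional points: where the integrand is not integrable, the left side is 0 by
  convention.\<close>

lemma abs_segment_avg_le:
  assumes [measurable]: "g \<in> borel_measurable borel"
  shows "ennreal \<bar>segment_avg g h x\<bar> \<le> (\<integral>\<^sup>+s. indicator {0..1} s * ennreal \<bar>g (x + s *\<^sub>R h)\<bar> \<partial>lborel)"
proof (cases "integrable lborel (\<lambda>s. indicat_real {0..1} s * g (x + s *\<^sub>R h))")
  case True
  have "ennreal \<bar>segment_avg g h x\<bar> \<le> (\<integral>\<^sup>+s. ennreal (norm (indicat_real {0..1} s * g (x + s *\<^sub>R h))) \<partial>lborel)"
    using integral_norm_bound_ennreal[OF True] by (simp add: segment_avg_def)
  also have "\<dots> = (\<integral>\<^sup>+s. indicator {0..1} s * ennreal \<bar>g (x + s *\<^sub>R h)\<bar> \<partial>lborel)"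
    by (intro nn_integral_cong) (auto simp: indicator_def)
  finally show ?thesis .
next
  case False
  then have "segment_avg g h x = 0" unfolding segment_avg_def by (rule not_integrable_integral_eq)
  then show ?thesis by simp
qed

text \<open>Convexity of \<open>B\<close> keeps the whole segment in \<open>B\<close> when both ends
  lie there. The indicator of \<open>B\<close> can thus be placed at each intermediate point, and
  translation of the integral restores the integral of \<open>V\<close> over
  \<open>B\<close>.\<close>

lemma weak_grad_translation_L1:
  fixes v :: "'a::euclidean_space \<Rightarrow> real"
  assumes W: "borel_weak_grad \<Omega> v V" and \<Omega>: "open \<Omega>" "convex \<Omega>"
    and B[measurable]: "B \<in> sets borel" and "convex B" "B \<subseteq> \<Omega>"
  shows "(\<integral>\<^sup>+x. indicator B x * indicator B (x + h) * ennreal \<bar>v (x + h) - v x\<bar> \<partial>lborel)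
    \<le> ennreal (norm h) * (\<integral>\<^sup>+x\<in>B. ennreal (norm (V x)) \<partial>lborel)"
proof -
  note meas[measurable] = borel_weak_gradD(1,2)[OF W]
  have cs: "\<bar>V y \<bullet> h\<bar> \<le> norm h * norm (V y)" for y
    using Cauchy_Schwarz_ineq2[of "V y" h] by (simp add: mult.commute)
  have "(\<integral>\<^sup>+x. indicator B x * indicator B (x + h) * ennreal \<bar>v (x + h) - v x\<bar> \<partial>lborel)
     \<le> (\<integral>\<^sup>+x. (\<integral>\<^sup>+s. indicator {0..1::real} s * (indicator B (x + s *\<^sub>R h) * ennreal (norm h * norm (V (x + s *\<^sub>R h)))) \<partial>lborel) \<partial>lborel)"
  proof (rule nn_integral_mono_AE)
    show "AE x in lborel. indicator B x * indicator B (x + h) * ennreal \<bar>v (x + h) - v x\<bar>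
      \<le> (\<integral>\<^sup>+s. indicator {0..1::real} s * (indicator B (x + s *\<^sub>R h) * ennreal (norm h * norm (V (x + s *\<^sub>R h)))) \<partial>lborel)"
      using weak_grad_difference[OF W \<Omega>, of h]
    proof eventually_elim
      case (elim x)
      show ?case
      proof (cases "x \<in> B \<and> x + h \<in> B")
        case True
        have inB: "x + s *\<^sub>R h \<in> B" if "s \<in> {0..1}" for s
          using sweep_subset[OF \<open>convex B\<close>, of "{x}" h] sweepI[of x "{x}" s h] True that by auto
        have "v (x + h) - v x = segment_avg (\<lambda>y. V y \<bullet> h) h x" using elim True \<open>B \<subseteq> \<Omega>\<close> by blast
        then have "ennreal \<bar>v (x + h) - v x\<bar> \<le> (\<integral>\<^sup>+s. indicator {0..1} s * ennreal \<bar>V (x + s *\<^sub>R h) \<bullet> h\<bar> \<partial>lborel)"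
          using abs_segment_avg_le[of "\<lambda>y. V y \<bullet> h" h x] by simp
        also have "\<dots> \<le> (\<integral>\<^sup>+s. indicator {0..1::real} s * (indicator B (x + s *\<^sub>R h) * ennreal (norm h * norm (V (x + s *\<^sub>R h)))) \<partial>lborel)"
          using cs inB by (intro nn_integral_mono) (auto simp: indicator_def intro!: ennreal_leI)
        finally show ?thesis using True by simp
      qed (auto simp: indicator_def)
    qed
  qed
  also have "\<dots> = (\<integral>\<^sup>+s. (\<integral>\<^sup>+x. indicator {0..1::real} s * (indicator B (x + s *\<^sub>R h) * ennreal (norm h * norm (V (x + s *\<^sub>R h)))) \<partial>lborel) \<partial>lborel)"
    by (rule lborel_pair.Fubini'[symmetric]) measurable
  also have "\<dots> = (\<integral>\<^sup>+s. indicator {0..1::real} s * (\<integral>\<^sup>+x. indicator B x * ennreal (norm h * norm (V x)) \<partial>lborel) \<partial>lborel)"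
  proof (rule nn_integral_cong)
    fix s :: real
    have "(\<integral>\<^sup>+x. indicator {0..1::real} s * (indicator B (x + s *\<^sub>R h) * ennreal (norm h * norm (V (x + s *\<^sub>R h)))) \<partial>lborel)
      = indicator {0..1::real} s * (\<integral>\<^sup>+x. indicator B (x + s *\<^sub>R h) * ennreal (norm h * norm (V (x + s *\<^sub>R h))) \<partial>lborel)"
      by (rule nn_integral_cmult) measurable
    also have "(\<integral>\<^sup>+x. indicator B (x + s *\<^sub>R h) * ennreal (norm h * norm (V (x + s *\<^sub>R h))) \<partial>lborel) = (\<integral>\<^sup>+x. indicator B x * ennreal (norm h * norm (V x)) \<partial>lborel)"
      by (rule nn_integral_lborel_translate[where f="\<lambda>x. indicator B x * ennreal (norm h * norm (V x))"]) measurable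
    finally show "(\<integral>\<^sup>+x. indicator {0..1::real} s * (indicator B (x + s *\<^sub>R h) * ennreal (norm h * norm (V (x + s *\<^sub>R h)))) \<partial>lborel)
      = indicator {0..1::real} s * (\<integral>\<^sup>+x. indicator B x * ennreal (norm h * norm (V x)) \<partial>lborel)" .
  qed
  also have "\<dots> = (\<integral>\<^sup>+x. indicator B x * ennreal (norm h * norm (V x)) \<partial>lborel)"
    by (subst nn_integral_multc) auto
  also have "\<dots> = (\<integral>\<^sup>+x. ennreal (norm h) * (ennreal (norm (V x)) * indicator B x) \<partial>lborel)"
    by (intro nn_integral_cong) (simp add: ennreal_mult mult_ac)
  also have "\<dots> = ennreal (norm h) * (\<integral>\<^sup>+x\<in>B. ennreal (norm (V x)) \<partial>lborel)"
    by (rule nn_integral_cmult) measurable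
  finally show ?thesis .
qed

text \<open>A continuously differentiable function of \<open>w\<close> equal to \<open>1/16\<close> on \<open>{w \<le> 0}\<close> and to \<open>0\<close> on
  \<open>{w \<ge> 1/2}\<close>.\<close>

definition cutoff :: "real \<Rightarrow> real" where
  "cutoff s = (max 0 (1/4 - (max 0 s)\<^sup>2))\<^sup>2"

definition cutoff' :: "real \<Rightarrow> real" where
  "cutoff' s = - 4 * max 0 (1/4 - (max 0 s)\<^sup>2) * max 0 s"

lemma max0_power2_has_derivative:
  "((\<lambda>s. (max 0 s)\<^sup>2) has_real_derivative 2 * max 0 s) (at (s::real))"
proof (cases s "0::real" rule: linorder_cases)
  case less
  have "((\<lambda>_. 0) has_real_derivative 0) (at s)" by simp
  then have "((\<lambda>s. (max 0 s)\<^sup>2) has_real_derivative 0) (at s)"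
    by (rule has_field_derivative_transform_within_open[where S="{..<0}"]) (use less in auto)
  then show ?thesis using less by simp
next
  case greater
  have "((\<lambda>s. s\<^sup>2) has_real_derivative 2 * s) (at s)" by (auto intro!: derivative_eq_intros)
  then have "((\<lambda>s. (max 0 s)\<^sup>2) has_real_derivative 2 * s) (at s)"
    by (rule has_field_derivative_transform_within_open[where S="{0<..}"]) (use greater in auto)
  then show ?thesis using greater by simp
next
  case equal
  have "((\<lambda>h::real. \<bar>h\<bar>) \<longlongrightarrow> 0) (at 0)" by (auto intro!: tendsto_eq_intros)
  then have "((\<lambda>h::real. (max 0 h)\<^sup>2 / h) \<longlongrightarrow> 0) (at 0)"
    by (rule Lim_null_comparison[rotated]) (auto simp: eventually_at_filter max_def power2_eq_square)
  then show ?thesis unfolding equal by (simp add: has_field_derivative_iff)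
qed

lemma cutoff_has_derivative: "(cutoff has_real_derivative cutoff' s) (at s)"
proof -
  have "((\<lambda>s. 1/4 - (max 0 s)\<^sup>2) has_real_derivative (0 - 2 * max 0 s)) (at s)"
    by (intro DERIV_diff DERIV_const max0_power2_has_derivative)
  from DERIV_chain2[OF max0_power2_has_derivative this]
  show ?thesis unfolding cutoff_def[abs_def] cutoff'_def by (simp add: mult_ac)
qed

lemma cutoff_eq_0:
  fixes s :: real
  assumes "s \<ge> 1/2" shows "max 0 (1/4 - (max 0 s)\<^sup>2) = 0"
proof -
  have "(1/2)\<^sup>2 \<le> (max 0 s)\<^sup>2" by (rule power_mono) (use assms in auto)
  then show ?thesis by (simp add: power2_eq_square)
qed

text \<open>The support property is what confines the gradient integral in the isoperimetric
  inequality to the intermediate set.\<close>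

lemma cutoff'_bound: "\<bar>cutoff' s\<bar> \<le> indicator {0<..<1/2} s"
proof (cases "0 < s \<and> s < 1/2")
  case True
  have a: "4 * max 0 (1/4 - s\<^sup>2) \<le> 1" by (simp add: max_def)
  have "4 * max 0 (1/4 - s\<^sup>2) * s \<le> 1 * 1"
    by (rule mult_mono[OF a]) (use True in auto)
  then show ?thesis using True by (simp add: cutoff'_def abs_mult)
next
  case False
  then have "s \<ge> 1/2 \<or> max 0 s = 0" by auto
  then have "cutoff' s = 0" unfolding cutoff'_def using cutoff_eq_0[of s] by (metis mult_zero_left mult_zero_right)
  then show ?thesis by simp
qed

lemma cutoff'_continuous: "continuous_on UNIV cutoff'"
  unfolding cutoff'_def[abs_def] by (intro continuous_intros)

text \<open>The product of the two measures is the integral over h of the measure of those x with x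
  in the sublevel set and x + h in the superlevel set. For such pairs \<open>v\<close> drops by
  1/16, which accounts for the factor 16. The translation estimate bounds the contribution of each
  h, and only shifts shorter than 2 R occur.\<close>

lemma isoperimetric_inequality:
  fixes w :: "'a::euclidean_space \<Rightarrow> real"
  assumes W: "borel_weak_grad \<Omega> w G" and \<Omega>: "open \<Omega>" "convex \<Omega>" and R: "ball 0 R \<subseteq> \<Omega>" "R > 0"
  shows "emeasure lborel ({x. w x \<le> 0} \<inter> ball 0 R) * emeasure lborel ({x. w x \<ge> 1/2} \<inter> ball 0 R)
    \<le> 16 * (ennreal (2 * R) * emeasure lborel (ball (0::'a) (2 * R)))
      * (\<integral>\<^sup>+x\<in>ball 0 R. ennreal (indicator {0<..<1/2} (w x) * norm (G x)) \<partial>lborel)"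
proof -
  note meas[measurable] = borel_weak_gradD(1,2)[OF W]
  let ?B = "ball (0::'a) R"
  have [measurable]: "?B \<in> sets borel" by simp
  define A where "A = {x. w x \<le> 0} \<inter> ?B"
  define A' where "A' = {x. w x \<ge> 1/2} \<inter> ?B"
  have [measurable]: "A \<in> sets borel" "A' \<in> sets borel" unfolding A_def A'_def by measurable
  define v where "v x = cutoff (w x)" for x
  define V where "V x = cutoff' (w x) *\<^sub>R G x" for x
  define I where "I = (\<integral>\<^sup>+x\<in>?B. ennreal (indicator {0<..<1/2} (w x) * norm (G x)) \<partial>lborel)"
  have cb1: "\<bar>cutoff' s\<bar> \<le> 1" for s by (rule order_trans[OF cutoff'_bound]) (simp add: indicator_def)
  have V: "borel_weak_grad \<Omega> v V"
    unfolding v_def[abs_def] V_def[abs_def]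
    by (rule borel_weak_grad_chain[OF W \<Omega> cutoff_has_derivative cb1 cutoff'_continuous])
  note meas'[measurable] = borel_weak_gradD(1,2)[OF V]
  have IV: "(\<integral>\<^sup>+x\<in>?B. ennreal (norm (V x)) \<partial>lborel) \<le> I"
    unfolding I_def V_def using cutoff'_bound
    by (intro nn_integral_mono mult_right_mono ennreal_leI) (auto intro: mult_right_mono)
  have tr: "(\<integral>\<^sup>+x. indicator ?B x * indicator ?B (x + h) * ennreal \<bar>v (x + h) - v x\<bar> \<partial>lborel)
    \<le> ennreal (2 * R) * indicator (ball 0 (2 * R)) h * I" for h
  proof (cases "norm h < 2 * R")
    case True
    have "(\<integral>\<^sup>+x. indicator ?B x * indicator ?B (x + h) * ennreal \<bar>v (x + h) - v x\<bar> \<partial>lborel)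
      \<le> ennreal (norm h) * (\<integral>\<^sup>+x\<in>?B. ennreal (norm (V x)) \<partial>lborel)"
      by (rule weak_grad_translation_L1[OF V \<Omega>]) (use R in auto)
    also have "\<dots> \<le> ennreal (2 * R) * I" using True by (intro mult_mono IV ennreal_leI) auto
    finally show ?thesis using True by simp
  next
    case False
    have "\<not> (x \<in> ?B \<and> x + h \<in> ?B)" for x
      using False norm_triangle_ineq4[of "x + h" x] by auto
    then have "(\<integral>\<^sup>+x. indicator ?B x * indicator ?B (x + h) * ennreal \<bar>v (x + h) - v x\<bar> \<partial>lborel) = (\<integral>\<^sup>+x. 0 \<partial>(lborel::'a measure))"
      by (intro nn_integral_cong) (auto simp: indicator_def)
    then show ?thesis by simp
  qed
  have "emeasure lborel A * emeasure lborel A' = (\<integral>\<^sup>+x. indicator A x * emeasure lborel A' \<partial>lborel)"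
    by (subst nn_integral_multc) auto
  also have "\<dots> = (\<integral>\<^sup>+x. (\<integral>\<^sup>+h. indicator A x * indicator A' (x + h) \<partial>lborel) \<partial>lborel)"
  proof (rule nn_integral_cong)
    fix x
    have "(\<integral>\<^sup>+h. indicator A x * indicator A' (x + h) \<partial>lborel) = indicator A x * (\<integral>\<^sup>+h. indicator A' (h + x) \<partial>lborel)"
      by (subst nn_integral_cmult) (auto simp: add.commute)
    also have "(\<integral>\<^sup>+h. indicator A' (h + x) \<partial>lborel) = (\<integral>\<^sup>+h. indicator A' h \<partial>lborel)"
      by (rule nn_integral_lborel_translate) measurable
    finally show "indicator A x * emeasure lborel A' = (\<integral>\<^sup>+h. indicator A x * indicator A' (x + h) \<partial>lborel)" by simp
  qed
  also have "\<dots> = (\<integral>\<^sup>+h. (\<integral>\<^sup>+x. indicator A x * indicator A' (x + h) \<partial>lborel) \<partial>lborel)"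
    by (rule lborel_pair.Fubini'[symmetric]) measurable
  also have "\<dots> \<le> (\<integral>\<^sup>+h. 16 * (ennreal (2 * R) * indicator (ball 0 (2 * R)) h * I) \<partial>(lborel :: 'a measure))"
  proof (rule nn_integral_mono)
    fix h
    have "(\<integral>\<^sup>+x. indicator A x * indicator A' (x + h) \<partial>lborel) \<le>
      (\<integral>\<^sup>+x. 16 * (indicator ?B x * indicator ?B (x + h) * ennreal \<bar>v (x + h) - v x\<bar>) \<partial>lborel)"
    proof (rule nn_integral_mono)
      fix x
      show "indicator A x * indicator A' (x + h) \<le> 16 * (indicator ?B x * indicator ?B (x + h) * ennreal \<bar>v (x + h) - v x\<bar>)"
      proof (cases "x \<in> A \<and> x + h \<in> A'")
        case True
        then have "w (x + h) \<ge> 1/2" by (simp add: A'_def)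
        from cutoff_eq_0[OF this] have "v (x + h) = 0" by (simp only: v_def cutoff_def) simp
        moreover have "v x = 1/16" using True by (auto simp: v_def A_def cutoff_def max_def power2_eq_square)
        ultimately have "16 * ennreal \<bar>v (x + h) - v x\<bar> = 1"
          by (simp add: ennreal_numeral[symmetric] ennreal_mult[symmetric] del: ennreal_numeral)
        then show ?thesis using True by (simp add: A_def A'_def)
      qed (auto simp: indicator_def)
    qed
    also have "\<dots> = 16 * (\<integral>\<^sup>+x. indicator ?B x * indicator ?B (x + h) * ennreal \<bar>v (x + h) - v x\<bar> \<partial>lborel)"
      by (rule nn_integral_cmult) measurable
    also have "\<dots> \<le> 16 * (ennreal (2 * R) * indicator (ball 0 (2 * R)) h * I)"
      by (intro mult_left_mono tr) auto
    finally show "(\<integral>\<^sup>+x. indicator A x * indicator A' (x + h) \<partial>lborel) \<le> 16 * (ennreal (2 * R) * indicator (ball 0 (2 * R)) h * I)" .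
  qed
  also have "\<dots> = (\<integral>\<^sup>+h. 16 * ennreal (2 * R) * I * indicator (ball 0 (2 * R)) h \<partial>(lborel :: 'a measure))"
    by (simp add: mult_ac)
  also have "\<dots> = 16 * (ennreal (2 * R) * emeasure lborel (ball (0::'a) (2 * R))) * I"
    by (subst nn_integral_cmult) (auto simp: mult_ac intro!: borel_measurable_indicator)
  finally show ?thesis unfolding A_def A'_def I_def .
qed

text \<open>Cauchy-Schwarz splits the gradient integral into the measure of the intermediate set and
  the energy of the positive part, whose gradient agrees with \<open>G\<close> on that set. The
  squared form avoids square roots of extended reals.\<close>

lemma isoperimetric_inequality_L2:
  fixes w :: "'a::euclidean_space \<Rightarrow> real"
  assumes W: "borel_weak_grad \<Omega> w G" and \<Omega>: "open \<Omega>" "convex \<Omega>" and R: "ball 0 R \<subseteq> \<Omega>" "R > 0"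
  shows "(emeasure lborel ({x. w x \<le> 0} \<inter> ball 0 R) * emeasure lborel ({x. w x \<ge> 1/2} \<inter> ball 0 R))\<^sup>2
    \<le> (16 * (ennreal (2 * R) * emeasure lborel (ball (0::'a) (2 * R))))\<^sup>2
      * (emeasure lborel ({x. 0 < w x \<and> w x < 1/2} \<inter> ball 0 R)
      * (\<integral>\<^sup>+x\<in>ball 0 R. ennreal ((norm (((1 + sgn (w x)) / 2) *\<^sub>R G x))\<^sup>2) \<partial>lborel))"
proof -
  note meas[measurable] = borel_weak_gradD(1,2)[OF W]
  define M where "M = {x. 0 < w x \<and> w x < 1/2} \<inter> ball 0 R"
  have [measurable]: "ball (0::'a) R \<in> sets borel" by simp
  have [measurable]: "M \<in> sets borel" unfolding M_def by measurable
  define H where "H x = ((1 + sgn (w x)) / 2) *\<^sub>R G x" for x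
  have [measurable]: "H \<in> borel_measurable borel" unfolding H_def[abs_def] by measurable
  have "(\<integral>\<^sup>+x\<in>ball 0 R. ennreal (indicator {0<..<1/2} (w x) * norm (G x)) \<partial>lborel)
     = (\<integral>\<^sup>+x. indicator M x * (ennreal (norm (H x)) * indicator (ball 0 R) x) \<partial>lborel)"
    by (intro nn_integral_cong) (auto simp: M_def H_def indicator_def)
  also have "\<dots>\<^sup>2 \<le> (\<integral>\<^sup>+x. (indicator M x)\<^sup>2 \<partial>lborel) * (\<integral>\<^sup>+x. (ennreal (norm (H x)) * indicator (ball 0 R) x)\<^sup>2 \<partial>lborel)"
    by (rule Cauchy_Schwarz_nn_integral) measurable
  also have "(\<integral>\<^sup>+x. (indicator M x)\<^sup>2 \<partial>lborel) = (\<integral>\<^sup>+x. indicator M x \<partial>lborel)"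
    by (intro nn_integral_cong) (auto simp: indicator_def)
  also have "(\<integral>\<^sup>+x. (ennreal (norm (H x)) * indicator (ball 0 R) x)\<^sup>2 \<partial>lborel) = (\<integral>\<^sup>+x\<in>ball 0 R. ennreal ((norm (H x))\<^sup>2) \<partial>lborel)"
    by (intro nn_integral_cong) (auto simp: indicator_def ennreal_power)
  finally have CS: "(\<integral>\<^sup>+x\<in>ball 0 R. ennreal (indicator {0<..<1/2} (w x) * norm (G x)) \<partial>lborel)\<^sup>2
    \<le> emeasure lborel M * (\<integral>\<^sup>+x\<in>ball 0 R. ennreal ((norm (H x))\<^sup>2) \<partial>lborel)" by simp
  show ?thesis
    using power_mono[OF isoperimetric_inequality[OF W \<Omega> R], of 2]
      mult_left_mono[OF CS, of "(16 * (ennreal (2 * R) * emeasure lborel (ball (0::'a) (2 * R))))\<^sup>2"]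
    unfolding M_def H_def by (simp add: power_mult_distrib)
qed

section \<open>Alternation in time\<close>

text \<open>Here \<open>f t\<close> and \<open>g t\<close> stand for the measures of the sublevel and superlevel sets at time \<open>t\<close>. At
  times where \<open>\<zeta>\<close> is small one of them is negligible. A first time at which the superlevel set takes
  over would be preceded, within \<open>\<tau>\<close>, by a time at which it is negligible, as the exceptional
  times have measure less than \<open>\<tau>/2\<close>.\<close>

lemma time_dichotomy:
  fixes f g \<zeta> :: "real \<Rightarrow> real"
  assumes [measurable]: "\<zeta> \<in> borel_measurable borel" and \<zeta>0: "\<And>t. 0 \<le> \<zeta> t"
    and f: "\<And>t. 0 \<le> f t" "\<And>t. f t \<le> \<omega>" and g: "\<And>t. 0 \<le> g t" "\<And>t. g t \<le> \<omega>"
    and J: "(\<integral>\<^sup>+t\<in>{-2<..<0}. ennreal (\<zeta> t) \<partial>lborel) \<le> ennreal J" "0 \<le> J"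
    and \<delta>: "0 < \<delta>" "\<delta> \<le> \<omega> / 2" "J < \<delta> * (\<tau> / 2)"
    and P: "AE t in lborel. t \<in> {-2<..<0} \<longrightarrow> P t"
    and prod: "\<And>t. P t \<Longrightarrow> f t * g t \<le> \<zeta> t" and sum: "\<And>t. P t \<Longrightarrow> \<omega> - \<zeta> t \<le> f t + g t"
    and jump: "\<And>s t. P s \<Longrightarrow> P t \<Longrightarrow> -2 < s \<Longrightarrow> s < t \<Longrightarrow> t < 0 \<Longrightarrow> t < s + \<tau> \<Longrightarrow> \<zeta> s \<le> \<delta> \<Longrightarrow> \<zeta> t \<le> \<delta> \<Longrightarrow>
      g s \<le> 4 / \<omega> * \<zeta> s \<Longrightarrow> f t \<le> 4 / \<omega> * \<zeta> t \<Longrightarrow> False"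
  shows "(\<integral>\<^sup>+t\<in>{-2<..<-1}. ennreal (f t) \<partial>lborel) \<le> ennreal ((4 / \<omega> + \<omega> / \<delta>) * J)
    \<or> (\<integral>\<^sup>+t\<in>{-1<..<0}. ennreal (g t) \<partial>lborel) \<le> ennreal ((4 / \<omega> + \<omega> / \<delta>) * J)"
proof -
  have \<omega>: "\<omega> > 0" using \<delta> by simp
  have \<tau>: "\<tau> > 0" using \<delta> J(2) by (smt (verit) mult_le_0_iff divide_nonpos_pos)
  define good where "good t \<longleftrightarrow> P t \<and> -2 < t \<and> t < 0 \<and> \<zeta> t \<le> \<delta>" for t
  define A where "A t \<longleftrightarrow> good t \<and> g t \<le> 4 / \<omega> * \<zeta> t" for t
  define B where "B t \<longleftrightarrow> good t \<and> f t \<le> 4 / \<omega> * \<zeta> t" for t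
  have small: "y \<le> 4 / \<omega> * z" if "x * y \<le> z" "x \<ge> \<omega> / 4" "y \<ge> 0" for x y z
  proof -
    have "\<omega> / 4 * y \<le> z" using mult_right_mono[OF that(2,3)] that(1) by simp
    then show ?thesis using \<omega> by (simp add: field_simps)
  qed
  have AB: "A t \<or> B t" if "good t" for t
  proof -
    have "f t + g t \<ge> \<omega> / 2" using that sum[of t] \<delta> by (auto simp: good_def)
    then have "f t \<ge> \<omega> / 4 \<or> g t \<ge> \<omega> / 4" by linarith
    then show ?thesis
      using small[of "f t" "g t" "\<zeta> t"] small[of "g t" "f t" "\<zeta> t"] prod[of t] f(1)[of t] g(1)[of t] that
      by (auto simp: A_def B_def good_def mult.commute)
  qed
  have noAB: False if "A s" "B t" "s < t" "t < s + \<tau>" for s t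
    using jump[of s t] that by (auto simp: A_def B_def good_def)
  \<comment> \<open>Chebyshev: an interval of length \<tau>/2 consisting of bad times would already
    contribute \<delta> \<tau>/2 to the integral of \<zeta>, more than \<open>J\<close>.\<close>
  have hit: "\<exists>t. a < t \<and> t < b \<and> good t" if ab: "-2 \<le> a" "b \<le> 0" "\<tau> / 2 \<le> b - a" for a b
  proof (rule ccontr)
    assume no: "\<not> (\<exists>t. a < t \<and> t < b \<and> good t)"
    have "AE t in lborel. ennreal \<delta> * indicator {a<..<b} t \<le> ennreal (\<zeta> t) * indicator {-2<..<0} t"
      using P
    proof eventually_elim
      case (elim t)
      show ?case
      proof (cases "t \<in> {a<..<b}")
        case True
        then have "\<not> good t" "-2 < t" "t < 0" using no ab by auto
        then have "\<zeta> t > \<delta>" using elim by (auto simp: good_def)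
        then show ?thesis using True ab by (auto intro!: ennreal_leI)
      qed simp
    qed
    then have "(\<integral>\<^sup>+t. ennreal \<delta> * indicator {a<..<b} t \<partial>lborel) \<le> ennreal J"
      by (rule order_trans[OF nn_integral_mono_AE J(1)])
    moreover have "(\<integral>\<^sup>+t. ennreal \<delta> * indicator {a<..<b} t \<partial>lborel) = ennreal (\<delta> * (b - a))"
      using \<delta> ab \<tau> by (subst nn_integral_cmult) (auto simp: ennreal_mult)
    ultimately have "\<delta> * (b - a) \<le> J" using J(2) by (simp add: ennreal_le_iff)
    moreover have "\<delta> * (\<tau> / 2) \<le> \<delta> * (b - a)" using ab \<delta> by (intro mult_left_mono) auto
    ultimately show False using \<delta> by simp
  qed
  \<comment> \<open>The constant has one summand for each kind of time. At good times
    \<open>h\<close> is at most 4/\<omega> times \<zeta>; at bad times \<zeta> exceeds \<delta>, so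
    the trivial bound \<omega> is at most \<omega>/\<delta> times \<zeta>.\<close>
  have bound: "(\<integral>\<^sup>+t\<in>S. ennreal (h t) \<partial>lborel) \<le> ennreal ((4 / \<omega> + \<omega> / \<delta>) * J)"
    if S: "S \<subseteq> {-2<..<0}" and h: "\<And>t. h t \<le> \<omega>" "\<And>t. t \<in> S \<Longrightarrow> good t \<Longrightarrow> h t \<le> 4 / \<omega> * \<zeta> t" for S h
  proof -
    have "AE t in lborel. ennreal (h t) * indicator S t \<le> ennreal (4 / \<omega> + \<omega> / \<delta>) * (ennreal (\<zeta> t) * indicator {-2<..<0} t)"
      using P
    proof eventually_elim
      case (elim t)
      show ?case
      proof (cases "t \<in> S")
        case True
        then have t: "t \<in> {-2<..<0}" using S by auto
        have "h t \<le> (4 / \<omega> + \<omega> / \<delta>) * \<zeta> t"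
        proof (cases "\<zeta> t \<le> \<delta>")
          case le: True
          then have "h t \<le> 4 / \<omega> * \<zeta> t" using h(2)[OF True] elim t by (auto simp: good_def)
          also have "\<dots> \<le> (4 / \<omega> + \<omega> / \<delta>) * \<zeta> t" using \<zeta>0[of t] \<omega> \<delta> by (intro mult_right_mono) auto
          finally show ?thesis .
        next
          case False
          have "\<omega> / \<delta> * \<delta> \<le> \<omega> / \<delta> * \<zeta> t" using False \<omega> \<delta> by (intro mult_left_mono) auto
          then have "h t \<le> \<omega> / \<delta> * \<zeta> t" using h(1)[of t] \<delta> by simp
          also have "\<dots> \<le> (4 / \<omega> + \<omega> / \<delta>) * \<zeta> t" using \<zeta>0[of t] \<omega> \<delta> by (intro mult_right_mono) auto
          finally show ?thesis .
        qed
        then have "ennreal (h t) \<le> ennreal (4 / \<omega> + \<omega> / \<delta>) * ennreal (\<zeta> t)"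
          using \<omega> \<delta> \<zeta>0 by (subst ennreal_mult[symmetric]) (auto intro!: ennreal_leI)
        then show ?thesis using True t by simp
      qed simp
    qed
    then have "(\<integral>\<^sup>+t\<in>S. ennreal (h t) \<partial>lborel) \<le> (\<integral>\<^sup>+t. ennreal (4 / \<omega> + \<omega> / \<delta>) * (ennreal (\<zeta> t) * indicator {-2<..<0} t) \<partial>lborel)"
      by (rule nn_integral_mono_AE)
    also have "\<dots> = ennreal (4 / \<omega> + \<omega> / \<delta>) * (\<integral>\<^sup>+t\<in>{-2<..<0}. ennreal (\<zeta> t) \<partial>lborel)"
      by (rule nn_integral_cmult) measurable
    also have "\<dots> \<le> ennreal (4 / \<omega> + \<omega> / \<delta>) * ennreal J" by (intro mult_left_mono J) auto
    also have "\<dots> = ennreal ((4 / \<omega> + \<omega> / \<delta>) * J)" using \<omega> \<delta> J by (intro ennreal_mult[symmetric]) auto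
    finally show ?thesis .
  qed
  show ?thesis
  proof (cases "\<exists>t. A t \<and> t < -1")
    case False
    have "(\<integral>\<^sup>+t\<in>{-2<..<-1}. ennreal (f t) \<partial>lborel) \<le> ennreal ((4 / \<omega> + \<omega> / \<delta>) * J)"
      by (rule bound) (use f False AB in \<open>auto simp: B_def\<close>)
    then show ?thesis ..
  next
    case True
    then obtain s0 where s0: "A s0" "s0 < -1" by blast
    have "\<not> B t" if t: "t > -1" for t
    proof
      assume Bt: "B t"
      define X where "X = {t. B t \<and> s0 < t}"
      have X: "t \<in> X" "bdd_below X" using Bt t s0 by (auto simp: X_def intro!: bdd_belowI[of _ s0])
      define t' where "t' = Inf X"
      have "s0 \<le> t'" unfolding t'_def using X by (intro cInf_greatest) (auto simp: X_def)
      have "t' \<le> t" unfolding t'_def using X by (intro cInf_lower)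
      have lower: "\<not> B s" if "s0 < s" "s < t'" for s
        using cInf_lower[of s X] X(2) that by (auto simp: X_def t'_def)
      \<comment> \<open>The infimum \<open>t'\<close> need not belong to \<open>X\<close>, so a
        nearby element replaces it. This costs less than \<tau>/2. Another \<tau>/2 is allowed for
        the distance from \<open>t'\<close> back to a time of type \<open>A\<close>, and the two
        together stay below \<tau>.\<close>
      obtain t'' where t'': "t'' \<in> X" "t'' < t' + \<tau> / 2"
        using cInf_lessD[of X "t' + \<tau> / 2"] X \<tau> by (auto simp: t'_def)
      have "t' \<le> t''" unfolding t'_def using t'' X by (intro cInf_lower)
      show False
      proof (cases "t' - s0 < \<tau> / 2")
        case True
        then show False using noAB[of s0 t''] s0 t'' by (auto simp: X_def)
      next
        case False
        have "t < 0" "-2 < s0" using Bt s0 by (auto simp: A_def B_def good_def)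
        then obtain s where s: "t' - \<tau> / 2 < s" "s < t'" "good s"
          using hit[of "t' - \<tau> / 2" t'] \<open>t' \<le> t\<close> False by auto
        then have "A s" using AB[of s] lower[of s] False by auto
        then show False using noAB[of s t''] t'' s \<open>t' \<le> t''\<close> by (auto simp: X_def)
      qed
    qed
    then have "(\<integral>\<^sup>+t\<in>{-1<..<0}. ennreal (g t) \<partial>lborel) \<le> ennreal ((4 / \<omega> + \<omega> / \<delta>) * J)"
      by (intro bound) (use g AB in \<open>auto simp: A_def\<close>)
    then show ?thesis ..
  qed
qed

section \<open>Consequences of the De Giorgi inequality\<close>

lemma emeasure_ball_eq_measure:
  "emeasure lborel (ball (a::'a::euclidean_space) r) = ennreal (measure lborel (ball a r))"
  using emeasure_lborel_ball_finite[of a r] by (intro emeasure_eq_ennreal_measure) auto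

lemma ennreal_powr_le:
  assumes "a \<le> ennreal b" "q \<ge> 0" "b \<ge> 0"
  shows "ennreal_powr a q \<le> ennreal (b powr q)"
proof -
  have "a \<noteq> \<infinity>" using assms(1) by (auto simp: top_unique)
  moreover have "enn2real a \<le> b" using assms by (metis enn2real_leI)
  ultimately show ?thesis unfolding ennreal_powr_def using assms(2)
    by (auto intro!: ennreal_leI powr_mono2)
qed

text \<open>The factor \<open>16\<close> bounds \<open>1 / (R - r)\<^sup>2\<close> for \<open>R - r \<ge> 1/4\<close>.\<close>

definition energy_growth :: "real \<Rightarrow> real \<Rightarrow> real \<Rightarrow> real \<Rightarrow> real \<Rightarrow> real" where
  "energy_growth \<gamma>2 \<gamma>3 p \<omega> \<tau> = 16 * \<gamma>2 * (\<tau> * \<omega>) + \<gamma>3 * (\<tau> * \<omega>) powr (1 / p)"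

text \<open>With k = 0 and u \<le> 1 the truncation takes values in [0,1], so the two error terms
  are controlled by the volume (t - s) \<omega> of the cylinder alone. They become small with the
  length of the time interval, which is what prevents a fast passage.\<close>

lemma DG_energy_estimate:
  fixes u :: "real \<times> 'a::euclidean_space \<Rightarrow> real"
  assumes u: "u \<in> DG_plus (-4) 0 (ball 0 2) \<gamma>1 \<gamma>2 \<gamma>3 p"
    and pos: "\<gamma>1 > 0" "\<gamma>2 > 0" "\<gamma>3 > 0" "p > 0"
    and le1: "AE t in lborel. t \<in> {-9/4<..<0} \<longrightarrow> (AE x in lborel. x \<in> ball 0 (3/2) \<longrightarrow> u (t, x) \<le> 1)"
    and st: "-9/4 < s" "s < t" "t \<le> 0" and r: "0 < r" "r < R" "R \<le> 3/2" "1/4 \<le> R - r"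
  defines "\<omega> \<equiv> measure lborel (ball (0::'a) (3/2))"
  shows "(\<integral>\<^sup>+x\<in>ball 0 r. ennreal ((trunc u 0 t x)\<^sup>2) \<partial>lebesgue)
    + ennreal \<gamma>1 * (\<integral>\<^sup>+\<tau>\<in>{s..t}. (\<integral>\<^sup>+x\<in>ball 0 r. ennreal ((norm (weak_grad (ball 0 2) (trunc u 0 \<tau>) x))\<^sup>2) \<partial>lebesgue) \<partial>lebesgue)
    \<le> (\<integral>\<^sup>+x\<in>ball 0 R. ennreal ((trunc u 0 s x)\<^sup>2) \<partial>lebesgue) + ennreal (energy_growth \<gamma>2 \<gamma>3 p \<omega> (t - s))"
proof -
  have \<omega>: "emeasure lborel (ball (0::'a) (3/2)) = ennreal \<omega>" "\<omega> \<ge> 0"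
    unfolding \<omega>_def by (simp_all add: emeasure_ball_eq_measure)
  \<comment> \<open>The function \<psi> stands for the square and for the p-th power, the two powers
    in the error terms.\<close>
  have inner: "(\<integral>\<^sup>+x\<in>ball 0 R. ennreal (\<psi> (trunc u 0 \<tau> x)) \<partial>lebesgue) \<le> ennreal \<omega>"
    if \<psi>: "\<And>y. 0 \<le> y \<Longrightarrow> y \<le> 1 \<Longrightarrow> \<psi> y \<le> 1" and ae: "AE x in lborel. x \<in> ball 0 (3/2) \<longrightarrow> u (\<tau>, x) \<le> 1" for \<psi> \<tau>
  proof -
    have "(\<integral>\<^sup>+x\<in>ball 0 R. ennreal (\<psi> (trunc u 0 \<tau> x)) \<partial>lebesgue) \<le> (\<integral>\<^sup>+x. indicator (ball 0 (3/2)) x \<partial>(lebesgue :: 'a measure))"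
    proof (rule nn_integral_mono_AE)
      show "AE x in lebesgue. ennreal (\<psi> (trunc u 0 \<tau> x)) * indicator (ball 0 R) x \<le> indicator (ball 0 (3/2)) x"
        using AE_completion[OF ae]
      proof eventually_elim
        case (elim x)
        show ?case
        proof (cases "x \<in> ball 0 R")
          case True
          then have "x \<in> ball 0 (3/2)" using r by auto
          then have "\<psi> (trunc u 0 \<tau> x) \<le> 1" using elim by (intro \<psi>) (auto simp: trunc_def)
          then show ?thesis using True \<open>x \<in> ball 0 (3/2)\<close> by (simp add: ennreal_le_1)
        qed simp
      qed
    qed
    also have "\<dots> = ennreal \<omega>" using \<omega>(1) by simp
    finally show ?thesis .
  qed
  have outer: "(\<integral>\<^sup>+\<tau>\<in>{s..t}. (\<integral>\<^sup>+x\<in>ball 0 R. ennreal (\<psi> (trunc u 0 \<tau> x)) \<partial>lebesgue) \<partial>lebesgue) \<le> ennreal ((t - s) * \<omega>)"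
    if \<psi>: "\<And>y. 0 \<le> y \<Longrightarrow> y \<le> 1 \<Longrightarrow> \<psi> y \<le> 1" for \<psi>
  proof -
    \<comment> \<open>The bound u \<le> 1 is available on the open time interval only, while
      \<open>t\<close> may be the final time 0.\<close>
    have "AE \<tau> in lebesgue. \<tau> \<noteq> (0::real)"
      by (rule AE_completion) (rule AE_lborel_singleton)
    then have "(\<integral>\<^sup>+\<tau>\<in>{s..t}. (\<integral>\<^sup>+x\<in>ball 0 R. ennreal (\<psi> (trunc u 0 \<tau> x)) \<partial>lebesgue) \<partial>lebesgue)
      \<le> (\<integral>\<^sup>+\<tau>. ennreal \<omega> * indicator {s..t} \<tau> \<partial>lebesgue)"
      using AE_completion[OF le1]
      by (intro nn_integral_mono_AE, elim AE_mp, intro AE_I2 impI)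
        (use inner[OF \<psi>] st in \<open>auto simp: indicator_def\<close>)
    also have "\<dots> = ennreal ((t - s) * \<omega>)"
      using st \<omega>(2) by (subst nn_integral_cmult) (auto simp: ennreal_mult mult.commute intro!: borel_measurable_indicator)
    finally show ?thesis .
  qed
  have DG: "(\<integral>\<^sup>+x\<in>ball 0 r. ennreal ((trunc u 0 t x)\<^sup>2) \<partial>lebesgue)
    + ennreal \<gamma>1 * (\<integral>\<^sup>+\<tau>\<in>{s..t}. (\<integral>\<^sup>+x\<in>ball 0 r. ennreal ((norm (weak_grad (ball 0 2) (trunc u 0 \<tau>) x))\<^sup>2) \<partial>lebesgue) \<partial>lebesgue)
    \<le> (\<integral>\<^sup>+x\<in>ball 0 R. ennreal ((trunc u 0 s x)\<^sup>2) \<partial>lebesgue)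
      + ennreal (\<gamma>2 / (R - r)\<^sup>2) * (\<integral>\<^sup>+\<tau>\<in>{s..t}. (\<integral>\<^sup>+x\<in>ball 0 R. ennreal ((trunc u 0 \<tau> x)\<^sup>2) \<partial>lebesgue) \<partial>lebesgue)
      + ennreal \<gamma>3 * ennreal_powr (\<integral>\<^sup>+\<tau>\<in>{s..t}. (\<integral>\<^sup>+x\<in>ball 0 R. ennreal (trunc u 0 \<tau> x powr p) \<partial>lebesgue) \<partial>lebesgue) (1 / p)"
  proof -
    have "-4 \<le> s \<and> s < t \<and> t \<le> 0 \<and> 0 < r \<and> r < R \<and> (0::'a) \<in> ball 0 2 \<and> ball (0::'a) R \<subseteq> ball 0 2"
      using st r by auto
    then show ?thesis using u unfolding DG_plus_def mem_Collect_eq by blast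
  qed
  have "\<gamma>2 / (R - r)\<^sup>2 \<le> 16 * \<gamma>2"
  proof -
    have "(1/4)\<^sup>2 \<le> (R - r)\<^sup>2" using r by (intro power_mono) auto
    then have "\<gamma>2 / (R - r)\<^sup>2 \<le> \<gamma>2 / (1/4)\<^sup>2" using pos r by (intro divide_left_mono) auto
    then show ?thesis by (simp add: power2_eq_square)
  qed
  then have t2: "ennreal (\<gamma>2 / (R - r)\<^sup>2) * (\<integral>\<^sup>+\<tau>\<in>{s..t}. (\<integral>\<^sup>+x\<in>ball 0 R. ennreal ((trunc u 0 \<tau> x)\<^sup>2) \<partial>lebesgue) \<partial>lebesgue)
    \<le> ennreal (16 * \<gamma>2) * ennreal ((t - s) * \<omega>)"
    by (intro mult_mono ennreal_leI outer) (auto simp: power_le_one)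
  have t3: "ennreal \<gamma>3 * ennreal_powr (\<integral>\<^sup>+\<tau>\<in>{s..t}. (\<integral>\<^sup>+x\<in>ball 0 R. ennreal (trunc u 0 \<tau> x powr p) \<partial>lebesgue) \<partial>lebesgue) (1 / p)
    \<le> ennreal \<gamma>3 * ennreal (((t - s) * \<omega>) powr (1 / p))"
    by (intro mult_left_mono ennreal_powr_le outer) (use pos st \<omega>(2) in \<open>auto intro: powr_le1\<close>)
  have "ennreal (16 * \<gamma>2) * ennreal ((t - s) * \<omega>) + ennreal \<gamma>3 * ennreal (((t - s) * \<omega>) powr (1 / p)) = ennreal (energy_growth \<gamma>2 \<gamma>3 p \<omega> (t - s))"
    unfolding energy_growth_def using pos st \<omega>(2) by (simp add: ennreal_mult ennreal_plus)
  then show ?thesis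
    using order_trans[OF DG add_mono[OF add_mono[OF order_refl t2] t3]] by (simp add: add.assoc)
qed

lemma AE_lborel_pair:
  fixes P :: "real \<times> 'a::euclidean_space \<Rightarrow> bool"
  assumes "AE z in lborel. P z" shows "AE t in lborel. AE x in lborel. P (t, x)"
  by (rule lborel_pair.AE_pair) (use assms in \<open>simp only: lborel_prod\<close>)

lemma AE_lborel_ex_in_interval:
  fixes a b :: real
  assumes "AE t in lborel. P t" "a < b" shows "\<exists>t. a < t \<and> t < b \<and> P t"
proof (rule ccontr)
  assume "\<not> ?thesis"
  with assms(1) have "AE t in lborel. t \<notin> {a<..<b}" by (auto elim!: eventually_mono)
  then have "emeasure lborel {a<..<b} = 0" by (subst (asm) AE_iff_null_sets[symmetric]) auto
  then show False using assms(2) by simp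
qed

lemma emeasure_lborel_slices:
  fixes S :: "(real \<times> 'a::euclidean_space) set"
  assumes "S \<in> sets borel"
  shows "emeasure lborel S = (\<integral>\<^sup>+t. emeasure lborel (Pair t -` S) \<partial>lborel)"
    and "(\<lambda>t. emeasure lborel (Pair t -` S)) \<in> borel_measurable borel"
proof -
  have S: "S \<in> sets (lborel \<Otimes>\<^sub>M lborel)" using assms by (simp only: lborel_prod sets_lborel)
  from lborel.emeasure_pair_measure_alt[OF S]
  show "emeasure lborel S = (\<integral>\<^sup>+t. emeasure lborel (Pair t -` S) \<partial>lborel)" by (simp add: lborel_prod)
  show "(\<lambda>t. emeasure lborel (Pair t -` S)) \<in> borel_measurable borel"
    using lborel.measurable_emeasure_Pair[OF S] by simp
qed

text \<open>The constant 16 (2 R) \<bar>B\<bar> of the isoperimetric inequality for R = 5/4, where B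
  is the ball of radius 2 R.\<close>

definition iso_const :: "'a::euclidean_space itself \<Rightarrow> real" where
  "iso_const _ = 16 * (5/2 * measure lborel (ball (0::'a) (5/2)))"

definition slice_isoperimetric :: "(real \<times> 'a::euclidean_space \<Rightarrow> real) \<Rightarrow> (real \<times> 'a \<Rightarrow> 'a) \<Rightarrow> real \<Rightarrow> bool" where
  "slice_isoperimetric w H t \<longleftrightarrow>
    (emeasure lborel ({x. w (t, x) \<le> 0} \<inter> ball 0 (5/4)) * emeasure lborel ({x. w (t, x) \<ge> 1/2} \<inter> ball 0 (5/4)))\<^sup>2
    \<le> (ennreal (iso_const TYPE('a)))\<^sup>2 * (emeasure lborel ({x. 0 < w (t, x) \<and> w (t, x) < 1/2} \<inter> ball 0 (5/4))
    * (\<integral>\<^sup>+x\<in>ball 0 (5/4). ennreal ((norm (H (t, x)))\<^sup>2) \<partial>lborel))"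

text \<open>\<open>H\<close> is a jointly Borel function that agrees with \<open>weak_grad\<close>
  of the positive part on almost every slice, so the slice energy becomes measurable in time. The
  time interval is open because nothing is known about a representative at the end times.\<close>

definition DG_representative ::
  "(real \<times> 'a::euclidean_space \<Rightarrow> real) \<Rightarrow> (real \<times> 'a \<Rightarrow> real) \<Rightarrow> (real \<times> 'a \<Rightarrow> 'a) \<Rightarrow> bool" where
  "DG_representative u w H \<longleftrightarrow> w \<in> borel_measurable borel \<and> H \<in> borel_measurable borel \<and>
    (AE z in lborel. z \<in> {-4<..<0} \<times> ball 0 2 \<longrightarrow> u z = w z) \<and>
    (AE t in lborel. t \<in> {-4<..<0} \<longrightarrow> slice_isoperimetric w H t \<and>
      (AE x in lborel. x \<in> ball 0 2 \<longrightarrow> weak_grad (ball 0 2) (trunc u 0 t) x = H (t, x)))"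

text \<open>Null sets in space-time have null slices at almost every time. There \<open>w\<close>
  and \<open>G'\<close> inherit the weak gradient relation from \<open>u\<close> and
  \<open>G\<close>, and the slice results on positive parts and on the isoperimetric inequality
  apply.\<close>

lemma DG_representative_exists:
  fixes u :: "real \<times> 'a::euclidean_space \<Rightarrow> real"
  assumes "u \<in> DG_plus (-4) 0 (ball 0 2) \<gamma>1 \<gamma>2 \<gamma>3 p"
  obtains w H where "DG_representative u w H"
proof -
  let ?\<Omega> = "ball (0::'a) 2" and ?S = "{-4<..<0::real} \<times> ball (0::'a) 2"
  have "?S \<in> sets borel" by (intro borel_Times) auto
  then have S: "?S \<in> sets lebesgue" by auto
  from assms have "L2_H1 (-4) 0 ?\<Omega> u" unfolding DG_plus_def by blast
  then obtain G where G: "u \<in> borel_measurable (lebesgue_on ?S)" "G \<in> borel_measurable (lebesgue_on ?S)"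
    "AE t in lebesgue_on {-4<..<0}. is_weak_grad ?\<Omega> (\<lambda>x. u (t, x)) (\<lambda>x. G (t, x))"
    unfolding L2_H1_def by blast
  obtain w where w: "w \<in> borel_measurable borel" "AE z in lborel. z \<in> ?S \<longrightarrow> u z = w z"
    by (rule lebesgue_on_ex_borel_measurable[OF G(1) S])
  obtain G' where G': "G' \<in> borel_measurable borel" "AE z in lborel. z \<in> ?S \<longrightarrow> G z = G' z"
    by (rule lebesgue_on_ex_borel_measurable[OF G(2) S])
  note [measurable] = w(1) G'(1)
  define H where "H z = ((1 + sgn (w z)) / 2) *\<^sub>R G' z" for z
  have H: "H \<in> borel_measurable borel" unfolding H_def[abs_def] by measurable
  have "AE t in lebesgue. t \<in> {-4<..<0} \<longrightarrow> is_weak_grad ?\<Omega> (\<lambda>x. u (t, x)) (\<lambda>x. G (t, x))"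
    using G(3) by (subst (asm) AE_restrict_space_iff) auto
  then have wg: "AE t in lborel. t \<in> {-4<..<0} \<longrightarrow> is_weak_grad ?\<Omega> (\<lambda>x. u (t, x)) (\<lambda>x. G (t, x))"
    unfolding AE_completion_iff .
  have bwg: "AE t in lborel. t \<in> {-4<..<0} \<longrightarrow> borel_weak_grad ?\<Omega> (\<lambda>x. w (t, x)) (\<lambda>x. G' (t, x)) \<and>
      (AE x in lborel. x \<in> ?\<Omega> \<longrightarrow> trunc u 0 t x = max (w (t, x)) 0)"
    using wg AE_lborel_pair[OF w(2)] AE_lborel_pair[OF G'(2)]
  proof eventually_elim
    case (elim t)
    show ?case
    proof
      assume t: "t \<in> {-4<..<0}"
      have a: "AE x in lborel. x \<in> ?\<Omega> \<longrightarrow> u (t, x) = w (t, x)" "AE x in lborel. x \<in> ?\<Omega> \<longrightarrow> G (t, x) = G' (t, x)"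
        using elim t by auto
      have "is_weak_grad ?\<Omega> (\<lambda>x. w (t, x)) (\<lambda>x. G' (t, x))"
        by (rule is_weak_grad_cong_AE[OF AE_completion[OF a(1)] AE_completion[OF a(2)]]) (use elim t in auto)
      then have "borel_weak_grad ?\<Omega> (\<lambda>x. w (t, x)) (\<lambda>x. G' (t, x))"
        by (subst (asm) is_weak_grad_iff_borel) measurable
      moreover have "AE x in lborel. x \<in> ?\<Omega> \<longrightarrow> trunc u 0 t x = max (w (t, x)) 0"
        using a(1) by eventually_elim (simp add: trunc_def)
      ultimately show "borel_weak_grad ?\<Omega> (\<lambda>x. w (t, x)) (\<lambda>x. G' (t, x)) \<and>
        (AE x in lborel. x \<in> ?\<Omega> \<longrightarrow> trunc u 0 t x = max (w (t, x)) 0)" ..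
    qed
  qed
  have c: "16 * (ennreal (2 * (5/4)) * emeasure lborel (ball (0::'a) (2 * (5/4)))) = ennreal (iso_const TYPE('a))"
  proof -
    have "ennreal (a * (b * c)) = ennreal a * (ennreal b * ennreal c)" if "a \<ge> 0" "b \<ge> 0" "c \<ge> 0" for a b c
      using that by (simp add: ennreal_mult)
    from this[of 16 "5/2" "measure lborel (ball (0::'a) (5/2))"]
    have "ennreal (iso_const TYPE('a)) = 16 * (ennreal (5/2) * ennreal (measure lborel (ball (0::'a) (5/2))))"
      unfolding iso_const_def by simp
    then show ?thesis by (simp add: emeasure_ball_eq_measure)
  qed
  have "AE t in lborel. t \<in> {-4<..<0} \<longrightarrow> slice_isoperimetric w H t \<and>
      (AE x in lborel. x \<in> ?\<Omega> \<longrightarrow> weak_grad ?\<Omega> (trunc u 0 t) x = H (t, x))"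
    using bwg
  proof eventually_elim
    case (elim t)
    show ?case
    proof (intro impI conjI)
      assume t: "t \<in> {-4<..<0}"
      then have b: "borel_weak_grad ?\<Omega> (\<lambda>x. w (t, x)) (\<lambda>x. G' (t, x))" using elim by blast
      show "AE x in lborel. x \<in> ?\<Omega> \<longrightarrow> weak_grad ?\<Omega> (trunc u 0 t) x = H (t, x)"
        using weak_grad_pos_part_AE[OF b] elim t by (auto simp: H_def)
      have "ball (0::'a) (5/4) \<subseteq> ?\<Omega>" by auto
      from isoperimetric_inequality_L2[OF b open_ball convex_ball this]
      show "slice_isoperimetric w H t" unfolding slice_isoperimetric_def c H_def by simp
    qed
  qed
  then show thesis using w H by (intro that[of w H]) (simp add: DG_representative_def)
qed

lemma ennreal_mult_le_imp_le_divide: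
  assumes "ennreal c * X \<le> ennreal b" "c > 0" "b \<ge> 0" shows "X \<le> ennreal (b / c)"
proof -
  have "X = ennreal (1 / c) * (ennreal c * X)"
    using assms(2) by (simp add: mult.assoc[symmetric] ennreal_mult[symmetric])
  also have "\<dots> \<le> ennreal (1 / c) * ennreal b" using assms(1) by (rule mult_left_mono) simp
  also have "\<dots> = ennreal (b / c)" using assms by (simp add: ennreal_mult[symmetric])
  finally show ?thesis .
qed

lemma energy_growth_mono:
  assumes "\<gamma>2 > 0" "\<gamma>3 > 0" "p > 0" "\<omega> \<ge> 0" "0 \<le> s" "s \<le> t"
  shows "energy_growth \<gamma>2 \<gamma>3 p \<omega> s \<le> energy_growth \<gamma>2 \<gamma>3 p \<omega> t"
  unfolding energy_growth_def using assms
  by (intro add_mono mult_left_mono powr_mono2 mult_right_mono) auto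

lemma energy_growth_nonneg:
  assumes "\<gamma>2 > 0" "\<gamma>3 > 0" "\<omega> \<ge> 0" "0 \<le> t"
  shows "0 \<le> energy_growth \<gamma>2 \<gamma>3 p \<omega> t"
  unfolding energy_growth_def using assms by simp

text \<open>The energy inequality is started at a time between -9/4 and -2 whose slice satisfies u
  \<le> 1 almost everywhere; such a time exists because almost all are of this kind. The initial
  energy is then at most \<omega>, and the elapsed time is below 9/4.\<close>

lemma DG_gradient_bound:
  fixes u :: "real \<times> 'a::euclidean_space \<Rightarrow> real"
  assumes u: "u \<in> DG_plus (-4) 0 (ball 0 2) \<gamma>1 \<gamma>2 \<gamma>3 p"
    and pos: "\<gamma>1 > 0" "\<gamma>2 > 0" "\<gamma>3 > 0" "p > 0"
    and le1: "AE t in lborel. t \<in> {-9/4<..<0} \<longrightarrow> (AE x in lborel. x \<in> ball 0 (3/2) \<longrightarrow> u (t, x) \<le> 1)"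
    and H: "AE t in lborel. t \<in> {-4<..<0} \<longrightarrow> (AE x in lborel. x \<in> ball 0 2 \<longrightarrow> weak_grad (ball 0 2) (trunc u 0 t) x = H (t, x))"
  defines "\<omega> \<equiv> measure lborel (ball (0::'a) (3/2))"
  shows "(\<integral>\<^sup>+t\<in>{-2<..<0}. (\<integral>\<^sup>+x\<in>ball 0 (5/4). ennreal ((norm (H (t, x)))\<^sup>2) \<partial>lborel) \<partial>lborel)
    \<le> ennreal ((\<omega> + energy_growth \<gamma>2 \<gamma>3 p \<omega> (9/4)) / \<gamma>1)"
proof -
  obtain s where s: "-9/4 < s" "s < -2" "AE x in lborel. x \<in> ball 0 (3/2) \<longrightarrow> u (s, x) \<le> 1"
    using AE_lborel_ex_in_interval[OF le1, of "-9/4" "-2"] by auto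
  have \<omega>: "emeasure lborel (ball (0::'a) (3/2)) = ennreal \<omega>" "\<omega> \<ge> 0"
    unfolding \<omega>_def by (simp_all add: emeasure_ball_eq_measure)
  let ?W = "\<lambda>\<tau>. \<integral>\<^sup>+x\<in>ball 0 (5/4). ennreal ((norm (weak_grad (ball 0 2) (trunc u 0 \<tau>) x))\<^sup>2) \<partial>lebesgue"
  let ?e = "\<lambda>t. \<integral>\<^sup>+x\<in>ball 0 (5/4). ennreal ((norm (H (t, x)))\<^sup>2) \<partial>lborel"
  have "(\<integral>\<^sup>+x\<in>ball 0 (3/2). ennreal ((trunc u 0 s x)\<^sup>2) \<partial>lebesgue) \<le> (\<integral>\<^sup>+x. indicator (ball 0 (3/2)) x \<partial>(lebesgue :: 'a measure))"
  proof (rule nn_integral_mono_AE)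
    show "AE x in lebesgue. ennreal ((trunc u 0 s x)\<^sup>2) * indicator (ball 0 (3/2)) x \<le> indicator (ball 0 (3/2)) x"
      using AE_completion[OF s(3)]
      by eventually_elim (auto simp: indicator_def trunc_def ennreal_le_1 power_le_one)
  qed
  also have "\<dots> = ennreal \<omega>" using \<omega>(1) by simp
  finally have i: "(\<integral>\<^sup>+x\<in>ball 0 (3/2). ennreal ((trunc u 0 s x)\<^sup>2) \<partial>lebesgue) \<le> ennreal \<omega>" .
  have "(\<integral>\<^sup>+t\<in>{-2<..<0}. ?e t \<partial>lborel) = (\<integral>\<^sup>+t\<in>{-2<..<0}. ?e t \<partial>lebesgue)"
    by (simp add: nn_integral_completion)
  also have "\<dots> \<le> (\<integral>\<^sup>+\<tau>\<in>{s..0}. ?W \<tau> \<partial>lebesgue)"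
  proof (rule nn_integral_mono_AE)
    show "AE t in lebesgue. ?e t * indicator {-2<..<0} t \<le> ?W t * indicator {s..0} t"
      using AE_completion[OF H]
    proof eventually_elim
      case (elim t)
      show ?case
      proof (cases "t \<in> {-2<..<0}")
        case True
        then have ae: "AE x in lborel. x \<in> ball 0 2 \<longrightarrow> weak_grad (ball 0 2) (trunc u 0 t) x = H (t, x)" using elim by auto
        have "?e t = (\<integral>\<^sup>+x\<in>ball 0 (5/4). ennreal ((norm (H (t, x)))\<^sup>2) \<partial>lebesgue)"
          by (simp add: nn_integral_completion)
        also have "\<dots> = ?W t"
        proof (rule nn_integral_cong_AE)
          show "AE x in lebesgue. ennreal ((norm (H (t, x)))\<^sup>2) * indicator (ball 0 (5/4)) x
            = ennreal ((norm (weak_grad (ball 0 2) (trunc u 0 t) x))\<^sup>2) * indicator (ball 0 (5/4)) x"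
            using AE_completion[OF ae] by eventually_elim (auto simp: indicator_def)
        qed
        finally show ?thesis using True s by simp
      qed simp
    qed
  qed
  finally have le: "(\<integral>\<^sup>+t\<in>{-2<..<0}. ?e t \<partial>lborel) \<le> (\<integral>\<^sup>+\<tau>\<in>{s..0}. ?W \<tau> \<partial>lebesgue)" .
  have "ennreal \<gamma>1 * (\<integral>\<^sup>+\<tau>\<in>{s..0}. ?W \<tau> \<partial>lebesgue)
    \<le> (\<integral>\<^sup>+x\<in>ball 0 (5/4). ennreal ((trunc u 0 0 x)\<^sup>2) \<partial>lebesgue) + ennreal \<gamma>1 * (\<integral>\<^sup>+\<tau>\<in>{s..0}. ?W \<tau> \<partial>lebesgue)"
    by simp
  also have "\<dots> \<le> (\<integral>\<^sup>+x\<in>ball 0 (3/2). ennreal ((trunc u 0 s x)\<^sup>2) \<partial>lebesgue) + ennreal (energy_growth \<gamma>2 \<gamma>3 p \<omega> (0 - s))"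
    unfolding \<omega>_def by (rule DG_energy_estimate[OF u pos le1]) (use s in auto)
  also have "\<dots> \<le> ennreal \<omega> + ennreal (energy_growth \<gamma>2 \<gamma>3 p \<omega> (9/4))"
    using s pos \<omega> by (intro add_mono i ennreal_leI energy_growth_mono) auto
  also have "\<dots> = ennreal (\<omega> + energy_growth \<gamma>2 \<gamma>3 p \<omega> (9/4))"
    using energy_growth_nonneg[of \<gamma>2 \<gamma>3 \<omega> "9/4" p] pos \<omega> by (simp add: ennreal_plus)
  finally have "(\<integral>\<^sup>+\<tau>\<in>{s..0}. ?W \<tau> \<partial>lebesgue) \<le> ennreal ((\<omega> + energy_growth \<gamma>2 \<gamma>3 p \<omega> (9/4)) / \<gamma>1)"
    using pos \<omega> energy_growth_nonneg[of \<gamma>2 \<gamma>3 \<omega> "9/4" p] by (intro ennreal_mult_le_imp_le_divide) auto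
  with le show ?thesis by (rule order_trans)
qed

text \<open>The energy inequality goes from radius 5/4 at time \<open>s\<close> to radius 1 at time
  \<open>t\<close>. At the earlier time the square of the positive part is at most 1 and lives where
  w > 0. At the later time it is at least 1/4 on the superlevel set, which gives the factor 4. The
  rest of the unit ball is covered by the other two level sets.\<close>

lemma DG_propagation:
  fixes u w :: "real \<times> 'a::euclidean_space \<Rightarrow> real"
  assumes u: "u \<in> DG_plus (-4) 0 (ball 0 2) \<gamma>1 \<gamma>2 \<gamma>3 p"
    and pos: "\<gamma>1 > 0" "\<gamma>2 > 0" "\<gamma>3 > 0" "p > 0"
    and le1: "AE t in lborel. t \<in> {-9/4<..<0} \<longrightarrow> (AE x in lborel. x \<in> ball 0 (3/2) \<longrightarrow> u (t, x) \<le> 1)"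
    and st: "-2 < s" "s < t" "t < 0"
    and s1: "AE x in lborel. x \<in> ball 0 (3/2) \<longrightarrow> u (s, x) \<le> 1"
    and w[measurable]: "w \<in> borel_measurable borel"
    and uw: "AE x in lborel. x \<in> ball 0 2 \<longrightarrow> u (s, x) = w (s, x)" "AE x in lborel. x \<in> ball 0 2 \<longrightarrow> u (t, x) = w (t, x)"
  defines "\<omega> \<equiv> measure lborel (ball (0::'a) (3/2))"
  shows "measure lborel (ball (0::'a) 1) \<le> measure lborel ({x. w (t, x) \<le> 0} \<inter> ball 0 (5/4))
    + measure lborel ({x. 0 < w (t, x) \<and> w (t, x) < 1/2} \<inter> ball 0 (5/4))
    + 4 * (measure lborel ({x. w (s, x) \<ge> 1/2} \<inter> ball 0 (5/4))
      + measure lborel ({x. 0 < w (s, x) \<and> w (s, x) < 1/2} \<inter> ball 0 (5/4)) + energy_growth \<gamma>2 \<gamma>3 p \<omega> (t - s))"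
proof -
  define F where "F = {x. w (t, x) \<le> 0} \<inter> ball 0 (5/4)"
  define M where "M \<tau> = {x. 0 < w (\<tau>, x) \<and> w (\<tau>, x) < 1/2} \<inter> ball 0 (5/4)" for \<tau>
  define D where "D = {x. w (s, x) \<ge> 1/2} \<inter> ball 0 (5/4)"
  define D1 where "D1 = {x. w (t, x) \<ge> 1/2} \<inter> ball 0 1"
  have [measurable]: "ball (0::'a) (5/4) \<in> sets borel" "ball (0::'a) 1 \<in> sets borel" by simp_all
  have [measurable]: "F \<in> sets borel" "M \<tau> \<in> sets borel" "D \<in> sets borel" "D1 \<in> sets borel" for \<tau>
    unfolding F_def M_def D_def D1_def by measurable
  have bfin: "emeasure lborel S < \<infinity>" if "S \<subseteq> ball (0::'a) (5/4)" for S
    using emeasure_bounded_finite bounded_subset[OF bounded_ball that] by blast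
  have sub: "F \<subseteq> ball 0 (5/4)" "M \<tau> \<subseteq> ball 0 (5/4)" "D \<subseteq> ball 0 (5/4)" "D1 \<subseteq> ball 0 (5/4)" for \<tau>
    unfolding F_def M_def D_def D1_def by auto
  have em: "emeasure lborel S = ennreal (measure lborel S)" if "S \<subseteq> ball (0::'a) (5/4)" for S
    using bfin[OF that] by (intro emeasure_eq_ennreal_measure) auto
  have \<omega>: "\<omega> \<ge> 0" by (simp add: \<omega>_def)
  have eg: "energy_growth \<gamma>2 \<gamma>3 p \<omega> (t - s) \<ge> 0" using energy_growth_nonneg[of \<gamma>2 \<gamma>3 \<omega> "t - s" p] pos st \<omega> by simp
  have "ennreal (1/4) * emeasure lborel D1 = (\<integral>\<^sup>+x. ennreal (1/4) * indicator D1 x \<partial>lebesgue)"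
    by (simp add: nn_integral_completion nn_integral_cmult)
  also have "\<dots> \<le> (\<integral>\<^sup>+x\<in>ball 0 1. ennreal ((trunc u 0 t x)\<^sup>2) \<partial>lebesgue)"
  proof (rule nn_integral_mono_AE)
    show "AE x in lebesgue. ennreal (1/4) * indicator D1 x \<le> ennreal ((trunc u 0 t x)\<^sup>2) * indicator (ball 0 1) x"
      using AE_completion[OF uw(2)]
    proof eventually_elim
      case (elim x)
      show ?case
      proof (cases "x \<in> D1")
        case True
        then have "trunc u 0 t x \<ge> 1/2" using elim by (auto simp: D1_def trunc_def)
        from power_mono[OF this, of 2] have "1/4 \<le> (trunc u 0 t x)\<^sup>2" by (simp add: power2_eq_square)
        then show ?thesis using True by (auto simp: D1_def intro!: ennreal_leI)
      qed simp
    qed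
  qed
  also have "\<dots> \<le> (\<integral>\<^sup>+x\<in>ball 0 1. ennreal ((trunc u 0 t x)\<^sup>2) \<partial>lebesgue) + ennreal \<gamma>1 * (\<integral>\<^sup>+\<tau>\<in>{s..t}. (\<integral>\<^sup>+x\<in>ball 0 1. ennreal ((norm (weak_grad (ball 0 2) (trunc u 0 \<tau>) x))\<^sup>2) \<partial>lebesgue) \<partial>lebesgue)"
    by simp
  also have "\<dots> \<le> (\<integral>\<^sup>+x\<in>ball 0 (5/4). ennreal ((trunc u 0 s x)\<^sup>2) \<partial>lebesgue) + ennreal (energy_growth \<gamma>2 \<gamma>3 p \<omega> (t - s))"
    unfolding \<omega>_def by (rule DG_energy_estimate[OF u pos le1]) (use st in auto)
  also have "(\<integral>\<^sup>+x\<in>ball 0 (5/4). ennreal ((trunc u 0 s x)\<^sup>2) \<partial>lebesgue) \<le> (\<integral>\<^sup>+x. indicator D x + indicator (M s) x \<partial>lebesgue)"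
  proof (rule nn_integral_mono_AE)
    show "AE x in lebesgue. ennreal ((trunc u 0 s x)\<^sup>2) * indicator (ball 0 (5/4)) x \<le> indicator D x + indicator (M s) x"
      using AE_completion[OF uw(1)] AE_completion[OF s1]
    proof eventually_elim
      case (elim x)
      show ?case
      proof (cases "x \<in> ball 0 (5/4)")
        case True
        then have w: "u (s, x) = w (s, x)" "w (s, x) \<le> 1" using elim by auto
        show ?thesis
        proof (cases "w (s, x) \<le> 0")
          case True then show ?thesis using w by (simp add: trunc_def)
        next
          case False
          then have "(x \<in> D \<and> x \<notin> M s) \<or> (x \<in> M s \<and> x \<notin> D)" using True by (auto simp: D_def M_def)
          moreover have "(trunc u 0 s x)\<^sup>2 \<le> 1" using w by (auto simp: trunc_def intro!: power_le_one)
          ultimately show ?thesis using True by (auto simp: ennreal_le_1 indicator_def intro: order_trans)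
        qed
      qed simp
    qed
  qed
  also have "(\<integral>\<^sup>+x. indicator D x + indicator (M s) x \<partial>lebesgue) = emeasure lborel D + emeasure lborel (M s)"
    by (simp add: nn_integral_completion nn_integral_add)
  finally have "ennreal (1/4) * emeasure lborel D1 \<le> emeasure lborel D + emeasure lborel (M s) + ennreal (energy_growth \<gamma>2 \<gamma>3 p \<omega> (t - s))"
    by (simp add: add_mono)
  moreover have "ennreal (1/4 * measure lborel D1) = ennreal (1/4) * ennreal (measure lborel D1)"
    by (rule ennreal_mult) auto
  ultimately have "ennreal (1/4 * measure lborel D1) \<le> ennreal (measure lborel D + measure lborel (M s) + energy_growth \<gamma>2 \<gamma>3 p \<omega> (t - s))"
    using eg by (simp only: em[OF sub(1)] em[OF sub(2)] em[OF sub(3)] em[OF sub(4)] ennreal_plus measure_nonneg add_nonneg_nonneg)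
  then have 1: "measure lborel D1 \<le> 4 * (measure lborel D + measure lborel (M s) + energy_growth \<gamma>2 \<gamma>3 p \<omega> (t - s))"
    using eg by (subst (asm) ennreal_le_iff) auto
  have "measure lborel (ball (0::'a) 1) \<le> measure lborel ((F \<union> M t) \<union> D1)"
    by (rule measure_mono_fmeasurable) (use sub bfin[of "(F \<union> M t) \<union> D1"] in \<open>auto simp: F_def M_def D1_def fmeasurable_def\<close>)
  also have "\<dots> \<le> measure lborel F + measure lborel (M t) + measure lborel D1"
    using measure_Un_le[of "F \<union> M t" lborel D1] measure_Un_le[of F lborel "M t"] by simp
  finally show ?thesis using 1 unfolding F_def M_def D_def by simp
qed

lemma slice_integral_le:
  fixes S S' :: "(real \<times> 'a::euclidean_space) set"
  assumes S: "S \<in> sets borel" and S': "S' \<in> sets borel" and sub: "S \<inter> (T \<times> UNIV) \<subseteq> S'"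
  shows "(\<integral>\<^sup>+t\<in>T. emeasure lborel (Pair t -` S) \<partial>lborel) \<le> emeasure lborel S'"
proof -
  have "Pair t -` S' \<in> sets lborel" for t
    using sets_Pair1[of S' lborel "lborel :: 'a measure" t] S' by (simp only: lborel_prod sets_lborel)
  then have "(\<integral>\<^sup>+t\<in>T. emeasure lborel (Pair t -` S) \<partial>lborel) \<le> (\<integral>\<^sup>+t. emeasure lborel (Pair t -` S') \<partial>lborel)"
    using sub by (intro nn_integral_mono) (auto simp: indicator_def intro!: emeasure_mono)
  then show ?thesis using emeasure_lborel_slices(1)[OF S'] by simp
qed

lemma ennreal_power2_le_imp_le_sqrt:
  assumes "X\<^sup>2 \<le> ennreal y" "y \<ge> 0" shows "X \<le> ennreal (sqrt y)"
proof (cases X)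
  case (real r)
  then have "r\<^sup>2 \<le> y" using assms by (simp add: ennreal_power)
  then show ?thesis using real by (auto intro!: ennreal_leI real_le_rsqrt)
next
  case top
  then show ?thesis using assms by (simp add: power2_eq_square top_unique)
qed

text \<open>A passage would give \<beta> \<le> f t + m t + 4 (g s + m s + growth). With d =
  4/\<omega> times \<delta>, the measures total at most 5 (d + \<delta>) \<le> 5 \<beta>/32, and the
  growth term contributes at most \<beta>/2. The sum is below \<beta>, a contradiction; this fixes
  the constants 1/32 and 1/8.\<close>

lemma DG_dichotomy:
  fixes u w :: "real \<times> 'a::euclidean_space \<Rightarrow> real" and H :: "real \<times> 'a \<Rightarrow> 'a"
  assumes u: "u \<in> DG_plus (-4) 0 (ball 0 2) \<gamma>1 \<gamma>2 \<gamma>3 p"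
    and pos: "\<gamma>1 > 0" "\<gamma>2 > 0" "\<gamma>3 > 0" "p > 0"
    and le1: "AE t in lborel. t \<in> {-9/4<..<0} \<longrightarrow> (AE x in lborel. x \<in> ball 0 (3/2) \<longrightarrow> u (t, x) \<le> 1)"
    and rep: "DG_representative u w H"
  defines "\<omega>3 \<equiv> measure lborel (ball (0::'a) (3/2))" and "\<omega> \<equiv> measure lborel (ball (0::'a) (5/4))"
    and "\<beta> \<equiv> measure lborel (ball (0::'a) 1)"
  defines "E \<equiv> (\<omega>3 + energy_growth \<gamma>2 \<gamma>3 p \<omega>3 (9/4)) / \<gamma>1"
    and "\<epsilon> \<equiv> measure lborel ({z. 0 < w z \<and> w z < 1/2} \<inter> ({-4<..<0} \<times> ball 0 2))"
  assumes \<delta>: "0 < \<delta>" "\<delta> \<le> \<omega> / 2" "(4 / \<omega> + 1) * \<delta> \<le> \<beta> / 32"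
    and \<tau>: "energy_growth \<gamma>2 \<gamma>3 p \<omega>3 \<tau> \<le> \<beta> / 8"
    and J: "\<epsilon> + iso_const TYPE('a) * sqrt (\<epsilon> * E) \<le> J" "J < \<delta> * (\<tau> / 2)"
  shows "emeasure lborel ({z. w z \<le> 0} \<inter> ({-2<..<-1} \<times> ball 0 1)) \<le> ennreal ((4 / \<omega> + \<omega> / \<delta>) * J)
    \<or> emeasure lborel ({z. w z \<ge> 1/2} \<inter> ({-1<..<0} \<times> ball 0 1)) \<le> ennreal ((4 / \<omega> + \<omega> / \<delta>) * J)"
proof -
  have w[measurable]: "w \<in> borel_measurable borel" and [measurable]: "H \<in> borel_measurable borel"
    and uw: "AE z in lborel. z \<in> {-4<..<0} \<times> ball 0 2 \<longrightarrow> u z = w z"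
    and iso: "AE t in lborel. t \<in> {-4<..<0} \<longrightarrow> slice_isoperimetric w H t"
    and wH: "AE t in lborel. t \<in> {-4<..<0} \<longrightarrow>
      (AE x in lborel. x \<in> ball 0 2 \<longrightarrow> weak_grad (ball 0 2) (trunc u 0 t) x = H (t, x))"
    using rep by (auto simp: DG_representative_def elim: eventually_mono)
  let ?B = "ball (0::'a) (5/4)" and ?c = "iso_const TYPE('a)"
  have [measurable]: "?B \<in> sets borel" "ball (0::'a) 1 \<in> sets borel" "ball (0::'a) 2 \<in> sets borel" by simp_all
  have \<omega>0: "\<omega> > 0" using \<delta> by simp
  have c0: "?c \<ge> 0" unfolding iso_const_def by simp
  have \<omega>3: "\<omega>3 \<ge> 0" by (simp add: \<omega>3_def)
  have E0: "E \<ge> 0" unfolding E_def using \<omega>3 pos energy_growth_nonneg[of \<gamma>2 \<gamma>3 \<omega>3 "9/4" p] by simp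
  have \<epsilon>0: "\<epsilon> \<ge> 0" by (simp add: \<epsilon>_def)
  have J0: "J \<ge> 0" using J(1) \<epsilon>0 c0 E0 by (meson add_nonneg_nonneg mult_nonneg_nonneg order_trans real_sqrt_ge_zero)
  define SF where "SF = {z. w z \<le> 0} \<inter> (UNIV \<times> ?B)"
  define SG where "SG = {z. w z \<ge> 1/2} \<inter> (UNIV \<times> ?B)"
  define SM where "SM = {z. 0 < w z \<and> w z < 1/2} \<inter> (UNIV \<times> ?B)"
  have UB[measurable]: "(UNIV :: real set) \<times> ?B \<in> sets borel" by (intro borel_Times) auto
  have S[measurable]: "SF \<in> sets borel" "SG \<in> sets borel" "SM \<in> sets borel"
    unfolding SF_def SG_def SM_def by measurable
  have sl: "Pair t -` SF = {x. w (t, x) \<le> 0} \<inter> ?B" "Pair t -` SG = {x. w (t, x) \<ge> 1/2} \<inter> ?B"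
    "Pair t -` SM = {x. 0 < w (t, x) \<and> w (t, x) < 1/2} \<inter> ?B" for t
    by (auto simp: SF_def SG_def SM_def)
  define f where "f t = measure lborel (Pair t -` SF)" for t
  define g where "g t = measure lborel (Pair t -` SG)" for t
  define m where "m t = measure lborel (Pair t -` SM)" for t
  define e where "e t = (\<integral>\<^sup>+x\<in>?B. ennreal ((norm (H (t, x)))\<^sup>2) \<partial>lborel)" for t
  define e' where "e' t = enn2real (e t)" for t
  \<comment> \<open>The first summand is the deficit of f + g from \<omega>, the second the
    isoperimetric bound for f g. Cauchy-Schwarz in time bounds the integral of the square root by
    \<open>sqrt (\<epsilon> * E)\<close>.\<close>
  define \<zeta> where "\<zeta> t = m t + ?c * sqrt (m t * e' t)" for t
  have bfin: "emeasure lborel X < \<infinity>" if "X \<subseteq> ?B" for X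
    using emeasure_bounded_finite bounded_subset[OF bounded_ball that] by blast
  have em: "emeasure lborel X = ennreal (measure lborel X)" if "X \<subseteq> ?B" for X
    using bfin[OF that] by (intro emeasure_eq_ennreal_measure) auto
  have slB: "Pair t -` SF \<subseteq> ?B" "Pair t -` SG \<subseteq> ?B" "Pair t -` SM \<subseteq> ?B" for t
    unfolding sl by auto
  have slm: "Pair t -` X \<in> sets borel" if "X \<in> sets borel" for X :: "(real \<times> 'a) set" and t
    using sets_Pair1[of X lborel "lborel :: 'a measure" t] that by (simp only: lborel_prod sets_lborel)
  have emf: "emeasure lborel (Pair t -` SF) = ennreal (f t)" "emeasure lborel (Pair t -` SG) = ennreal (g t)"
    "emeasure lborel (Pair t -` SM) = ennreal (m t)" for t
    unfolding f_def g_def m_def by (intro em slB)+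
  have le\<omega>: "measure lborel X \<le> \<omega>" if "X \<subseteq> ?B" "X \<in> sets borel" for X
    unfolding \<omega>_def using bfin[of ?B] by (intro measure_mono_fmeasurable that) (use that in \<open>auto simp: fmeasurable_def\<close>)
  have [measurable]: "m \<in> borel_measurable borel"
    unfolding m_def[abs_def] measure_def using emeasure_lborel_slices(2)[OF S(3)] by measurable
  have [measurable]: "e \<in> borel_measurable borel"
  proof -
    have "(\<lambda>t. \<integral>\<^sup>+x\<in>?B. ennreal ((norm (H (t, x)))\<^sup>2) \<partial>lborel) \<in> borel_measurable lborel" by measurable
    then show ?thesis by (simp add: e_def[abs_def])
  qed
  have [measurable]: "e' \<in> borel_measurable borel" unfolding e'_def[abs_def] by measurable
  have [measurable]: "\<zeta> \<in> borel_measurable borel" unfolding \<zeta>_def[abs_def] by measurable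
  have nn: "0 \<le> f t" "0 \<le> g t" "0 \<le> m t" "0 \<le> e' t" "0 \<le> \<zeta> t" "m t \<le> \<zeta> t" for t
    using c0 by (auto simp: f_def g_def m_def e'_def \<zeta>_def)

  have Ie: "(\<integral>\<^sup>+t\<in>{-2<..<0}. e t \<partial>lborel) \<le> ennreal E"
    unfolding e_def E_def \<omega>3_def by (rule DG_gradient_bound[OF u pos le1 wH])
  have Im: "(\<integral>\<^sup>+t\<in>{-2<..<0}. ennreal (m t) \<partial>lborel) \<le> ennreal \<epsilon>"
  proof -
    let ?S = "{z. 0 < w z \<and> w z < 1/2} \<inter> ({-4<..<0} \<times> ball 0 2)"
    have "{-4<..<0::real} \<times> ball (0::'a) 2 \<in> sets borel" by (intro borel_Times) auto
    then have S': "?S \<in> sets borel" by measurable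
    have "(\<integral>\<^sup>+t\<in>{-2<..<0}. ennreal (m t) \<partial>lborel) \<le> emeasure lborel ?S"
      unfolding emf[symmetric] by (rule slice_integral_le[OF S(3) S']) (auto simp: SM_def)
    moreover have "bounded ?S"
      by (rule bounded_subset[of "{-4<..<0} \<times> ball 0 2"]) (auto intro!: bounded_Times)
    then have "emeasure lborel ?S = ennreal \<epsilon>"
      unfolding \<epsilon>_def using emeasure_bounded_finite[of ?S] by (intro emeasure_eq_ennreal_measure) auto
    ultimately show ?thesis by simp
  qed
  have I\<zeta>: "(\<integral>\<^sup>+t\<in>{-2<..<0}. ennreal (\<zeta> t) \<partial>lborel) \<le> ennreal J"
  proof -
    define X where "X = (\<integral>\<^sup>+t. (ennreal (sqrt (m t)) * indicator {-2<..<0} t) * (ennreal (sqrt (e' t)) * indicator {-2<..<0} t) \<partial>lborel)"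
    have "X\<^sup>2 \<le> (\<integral>\<^sup>+t. (ennreal (sqrt (m t)) * indicator {-2<..<0} t)\<^sup>2 \<partial>lborel) * (\<integral>\<^sup>+t. (ennreal (sqrt (e' t)) * indicator {-2<..<0} t)\<^sup>2 \<partial>lborel)"
      unfolding X_def by (rule Cauchy_Schwarz_nn_integral) measurable
    also have "(\<integral>\<^sup>+t. (ennreal (sqrt (m t)) * indicator {-2<..<0} t)\<^sup>2 \<partial>lborel) = (\<integral>\<^sup>+t\<in>{-2<..<0}. ennreal (m t) \<partial>lborel)"
      using nn by (intro nn_integral_cong) (auto simp: indicator_def ennreal_power)
    also have "(\<integral>\<^sup>+t. (ennreal (sqrt (e' t)) * indicator {-2<..<0} t)\<^sup>2 \<partial>lborel) \<le> (\<integral>\<^sup>+t\<in>{-2<..<0}. e t \<partial>lborel)"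
    proof (rule nn_integral_mono)
      fix t
      have "ennreal (e' t) \<le> e t" unfolding e'_def by (cases "e t") auto
      then show "(ennreal (sqrt (e' t)) * indicator {-2<..<0} t)\<^sup>2 \<le> e t * indicator {-2<..<0} t"
        using nn(4)[of t] by (auto simp: indicator_def ennreal_power)
    qed
    finally have "X\<^sup>2 \<le> (\<integral>\<^sup>+t\<in>{-2<..<0}. ennreal (m t) \<partial>lborel) * (\<integral>\<^sup>+t\<in>{-2<..<0}. e t \<partial>lborel)"
      by (simp add: mult_left_mono)
    also have "\<dots> \<le> ennreal \<epsilon> * ennreal E" by (intro mult_mono Im Ie) auto
    finally have "X\<^sup>2 \<le> ennreal \<epsilon> * ennreal E" .
    then have X: "X \<le> ennreal (sqrt (\<epsilon> * E))"
      using \<epsilon>0 E0 by (intro ennreal_power2_le_imp_le_sqrt) (auto simp: ennreal_mult)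
    have "(\<integral>\<^sup>+t\<in>{-2<..<0}. ennreal (\<zeta> t) \<partial>lborel) = (\<integral>\<^sup>+t. ennreal (m t) * indicator {-2<..<0} t
      + ennreal ?c * ((ennreal (sqrt (m t)) * indicator {-2<..<0} t) * (ennreal (sqrt (e' t)) * indicator {-2<..<0} t)) \<partial>lborel)"
    proof (rule nn_integral_cong)
      fix t
      have "ennreal (\<zeta> t) = ennreal (m t) + ennreal ?c * (ennreal (sqrt (m t)) * ennreal (sqrt (e' t)))"
        unfolding \<zeta>_def using nn c0 by (simp add: ennreal_plus ennreal_mult real_sqrt_mult)
      then show "ennreal (\<zeta> t) * indicator {-2<..<0} t = ennreal (m t) * indicator {-2<..<0} t
        + ennreal ?c * ((ennreal (sqrt (m t)) * indicator {-2<..<0} t) * (ennreal (sqrt (e' t)) * indicator {-2<..<0} t))"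
        by (auto simp: indicator_def)
    qed
    also have "\<dots> = (\<integral>\<^sup>+t\<in>{-2<..<0}. ennreal (m t) \<partial>lborel) + ennreal ?c * X"
      unfolding X_def by (subst nn_integral_add) (auto simp: nn_integral_cmult)
    also have "\<dots> \<le> ennreal \<epsilon> + ennreal ?c * ennreal (sqrt (\<epsilon> * E))"
      by (intro add_mono Im mult_left_mono X) auto
    also have "\<dots> = ennreal (\<epsilon> + ?c * sqrt (\<epsilon> * E))"
      using \<epsilon>0 c0 E0 by (simp add: ennreal_plus ennreal_mult)
    also have "\<dots> \<le> ennreal J" using J by (intro ennreal_leI)
    finally show ?thesis .
  qed
  define P where "P t \<longleftrightarrow> (f t * g t)\<^sup>2 \<le> ?c\<^sup>2 * (m t * e' t) \<and> (AE x in lborel. x \<in> ball 0 2 \<longrightarrow> u (t, x) = w (t, x))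
    \<and> (AE x in lborel. x \<in> ball 0 (3/2) \<longrightarrow> u (t, x) \<le> 1)" for t
  \<comment> \<open>Where the slice energy is infinite, \<open>e'\<close> takes the default value 0
    and the isoperimetric bound would be lost. The energy has finite integral, so this happens on a
    null set of times.\<close>
  have fin: "AE t in lborel. e t * indicator {-2<..<0} t \<noteq> \<infinity>"
    by (rule nn_integral_PInf_AE) (use Ie in \<open>auto simp: top_unique\<close>)
  have P: "AE t in lborel. t \<in> {-2<..<0} \<longrightarrow> P t"
    using fin iso AE_lborel_pair[OF uw] le1
  proof eventually_elim
    case (elim t)
    show ?case
    proof
      assume t: "t \<in> {-2<..<0}"
      then have et: "e t = ennreal (e' t)" unfolding e'_def using elim by (cases "e t") auto
      have "(emeasure lborel (Pair t -` SF) * emeasure lborel (Pair t -` SG))\<^sup>2 \<le> (ennreal ?c)\<^sup>2 * (emeasure lborel (Pair t -` SM) * e t)"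
        using elim t unfolding sl e_def slice_isoperimetric_def by auto
      then have "ennreal ((f t * g t)\<^sup>2) \<le> ennreal (?c\<^sup>2 * (m t * e' t))"
        unfolding emf et using nn c0 by (simp add: ennreal_mult[symmetric] ennreal_power)
      then have "(f t * g t)\<^sup>2 \<le> ?c\<^sup>2 * (m t * e' t)" using nn c0 by (subst (asm) ennreal_le_iff) auto
      then show "P t" unfolding P_def using elim t by auto
    qed
  qed
  have "(\<integral>\<^sup>+t\<in>{-2<..<-1}. ennreal (f t) \<partial>lborel) \<le> ennreal ((4 / \<omega> + \<omega> / \<delta>) * J)
    \<or> (\<integral>\<^sup>+t\<in>{-1<..<0}. ennreal (g t) \<partial>lborel) \<le> ennreal ((4 / \<omega> + \<omega> / \<delta>) * J)"
  proof (rule time_dichotomy[where \<zeta>=\<zeta> and \<tau>=\<tau> and P=P])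
    show "f t \<le> \<omega>" "g t \<le> \<omega>" for t unfolding f_def g_def by (intro le\<omega> slB slm S)+
    show "f t * g t \<le> \<zeta> t" if "P t" for t
    proof -
      have "f t * g t \<le> sqrt (?c\<^sup>2 * (m t * e' t))" using that by (intro real_le_rsqrt) (auto simp: P_def)
      also have "\<dots> = ?c * sqrt (m t * e' t)" using c0 by (simp add: real_sqrt_mult)
      finally show ?thesis using nn(3)[of t] by (simp add: \<zeta>_def)
    qed
    show "\<omega> - \<zeta> t \<le> f t + g t" for t
    proof -
      have "?B = (Pair t -` SF \<union> Pair t -` SG) \<union> Pair t -` SM" unfolding sl by auto
      then have "\<omega> \<le> measure lborel (Pair t -` SF \<union> Pair t -` SG) + m t"
        unfolding \<omega>_def m_def using measure_Un_le[of "Pair t -` SF \<union> Pair t -` SG" lborel "Pair t -` SM"] slm S by simp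
      also have "measure lborel (Pair t -` SF \<union> Pair t -` SG) \<le> f t + g t"
        unfolding f_def g_def by (intro measure_Un_le) (use slm S in auto)
      finally show ?thesis using nn(6)[of t] by simp
    qed
    show False if st: "P s" "P t" "-2 < s" "s < t" "t < 0" "t < s + \<tau>" "\<zeta> s \<le> \<delta>" "\<zeta> t \<le> \<delta>"
      "g s \<le> 4 / \<omega> * \<zeta> s" "f t \<le> 4 / \<omega> * \<zeta> t" for s t
    proof -
      have "\<beta> \<le> f t + m t + 4 * (g s + m s + energy_growth \<gamma>2 \<gamma>3 p \<omega>3 (t - s))"
        unfolding \<beta>_def f_def g_def m_def sl \<omega>3_def
        by (rule DG_propagation[OF u pos le1 st(3,4,5) _ w]) (use st(1,2) in \<open>auto simp: P_def\<close>)
      moreover have "energy_growth \<gamma>2 \<gamma>3 p \<omega>3 (t - s) \<le> \<beta> / 8"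
        using st pos \<omega>3 by (intro order_trans[OF energy_growth_mono \<tau>]) auto
      moreover define d where "d = 4 / \<omega> * \<delta>"
      have "4 / \<omega> * \<zeta> s \<le> d" "4 / \<omega> * \<zeta> t \<le> d"
        unfolding d_def using st \<omega>0 by (auto intro!: divide_right_mono)
      then have "g s \<le> d" "f t \<le> d" using st(9,10) by linarith+
      moreover have "d + \<delta> \<le> \<beta> / 32" unfolding d_def using \<delta>(3) by (simp add: algebra_simps)
      moreover have "d > 0" unfolding d_def using \<omega>0 \<delta>(1) by simp
      moreover have "m s \<le> \<delta>" "m t \<le> \<delta>" using st(7,8) nn(6)[of s] nn(6)[of t] by linarith+
      ultimately show False using \<delta>(1) by simp
    qed
  qed (use nn \<delta> J J0 I\<zeta> P in auto)
  moreover have "emeasure lborel ({z. w z \<le> 0} \<inter> ({-2<..<-1} \<times> ball 0 1)) \<le> (\<integral>\<^sup>+t\<in>{-2<..<-1}. ennreal (f t) \<partial>lborel)"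
  proof -
    let ?S = "{z. w z \<le> 0} \<inter> ({-2<..<-1} \<times> ball 0 1)"
    have "{-2<..<-1::real} \<times> ball (0::'a) 1 \<in> sets borel" by (intro borel_Times) auto
    then have S': "?S \<in> sets borel" by measurable
    show ?thesis unfolding emeasure_lborel_slices(1)[OF S'] emf[symmetric]
      by (intro nn_integral_mono) (auto simp: SF_def indicator_def slm S intro!: emeasure_mono)
  qed
  moreover have "emeasure lborel ({z. w z \<ge> 1/2} \<inter> ({-1<..<0} \<times> ball 0 1)) \<le> (\<integral>\<^sup>+t\<in>{-1<..<0}. ennreal (g t) \<partial>lborel)"
  proof -
    let ?S = "{z. w z \<ge> 1/2} \<inter> ({-1<..<0} \<times> ball 0 1)"
    have "{-1<..<0::real} \<times> ball (0::'a) 1 \<in> sets borel" by (intro borel_Times) auto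
    then have S': "?S \<in> sets borel" by measurable
    show ?thesis unfolding emeasure_lborel_slices(1)[OF S'] emf[symmetric]
      by (intro nn_integral_mono) (auto simp: SG_def indicator_def slm S intro!: emeasure_mono)
  qed
  ultimately show ?thesis by (meson order_trans)
qed

section \<open>The intermediate value inequality\<close>

lemma ex_small_energy_growth:
  assumes "\<gamma>2 > 0" "\<gamma>3 > 0" "p > 0" "\<omega> > 0" "b > 0"
  shows "\<exists>\<tau>>0. energy_growth \<gamma>2 \<gamma>3 p \<omega> \<tau> \<le> b"
proof -
  \<comment> \<open>Each entry of the minimum bounds one summand of the growth term by b/2.\<close>
  define \<tau> where "\<tau> = min (b / (32 * \<gamma>2 * \<omega>)) ((b / (2 * \<gamma>3)) powr p / \<omega>)"
  have "\<tau> > 0" unfolding \<tau>_def using assms by simp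
  moreover have "16 * \<gamma>2 * (\<tau> * \<omega>) \<le> b / 2"
  proof -
    have "\<tau> \<le> b / (32 * \<gamma>2 * \<omega>)" unfolding \<tau>_def by simp
    then show ?thesis using assms by (simp add: field_simps)
  qed
  moreover have "\<gamma>3 * (\<tau> * \<omega>) powr (1 / p) \<le> b / 2"
  proof -
    have "\<tau> \<le> (b / (2 * \<gamma>3)) powr p / \<omega>" unfolding \<tau>_def by simp
    then have "\<tau> * \<omega> \<le> (b / (2 * \<gamma>3)) powr p" using assms by (simp add: field_simps)
    then have "(\<tau> * \<omega>) powr (1 / p) \<le> ((b / (2 * \<gamma>3)) powr p) powr (1 / p)"
      using assms \<open>\<tau> > 0\<close> by (intro powr_mono2) auto
    also have "\<dots> = b / (2 * \<gamma>3)" using assms by (simp add: powr_powr)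
    finally show ?thesis using assms by (simp add: field_simps)
  qed
  ultimately show ?thesis unfolding energy_growth_def by (intro exI[of _ \<tau>]) auto
qed

text \<open>\<open>measure\<close> is 0 on non-measurable sets, so upper bounds on \<open>S\<close>
  follow without showing that it is measurable.\<close>

lemma measure_lebesgue_le_lborel_AE:
  fixes S T :: "'a::euclidean_space set"
  assumes "AE z in lborel. z \<in> S \<longrightarrow> z \<in> T" "T \<in> sets borel" "emeasure lborel T \<le> ennreal b" "b \<ge> 0"
  shows "measure lebesgue S \<le> b"
proof (cases "S \<in> sets lebesgue")
  case True
  have "emeasure lebesgue S \<le> emeasure lebesgue T"
    by (rule emeasure_mono_AE) (use assms(1,2) in \<open>auto intro: AE_completion\<close>)
  also have "\<dots> \<le> ennreal b" using assms(2,3) by simp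
  finally show ?thesis unfolding measure_def by (intro enn2real_leI assms)
next
  case False
  then show ?thesis using assms(4) by (simp add: measure_notin_sets)
qed

text \<open>The cylinders contain their final time, while representatives are controlled on open
  time intervals. Time slices are null, so the difference is harmless.\<close>

lemma AE_time_ne:
  "AE z in (lborel :: (real \<times> 'a::euclidean_space) measure). fst z \<noteq> t"
proof -
  have "{t} \<times> (UNIV :: 'a set) \<in> null_sets (lborel \<Otimes>\<^sub>M lborel)"
    by (subst null_sets_def) (auto simp: lborel.emeasure_pair_measure_Times)
  then have "AE z in lborel. z \<notin> {t} \<times> (UNIV :: 'a set)" unfolding lborel_prod by (rule AE_not_in)
  then show ?thesis by eventually_elim (metis SigmaI UNIV_I prod.collapse singletonI)
qed

lemma DG_intermediate_value:
  fixes \<gamma>1 \<gamma>2 \<gamma>3 p \<theta> :: real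
  assumes pos: "\<gamma>1 > 0" "\<gamma>2 > 0" "\<gamma>3 > 0" "p > 0" and \<theta>: "0 < \<theta>" "\<theta> \<le> 1/2"
  shows "\<exists>C>0. \<forall>u :: real \<times> 'a::euclidean_space \<Rightarrow> real.
     u \<in> DG_plus (-4) 0 (ball 0 2) \<gamma>1 \<gamma>2 \<gamma>3 p \<longrightarrow>
     (AE z in lebesgue_on (Q (3/2)). u z \<le> 1) \<longrightarrow>
     measure lebesgue ({z. u z \<le> 0} \<inter> Q1_minus) * measure lebesgue ({z. u z \<ge> 1/2} \<inter> Q 1)
       \<le> C * measure lebesgue ({z. 0 < u z \<and> u z < 1/2} \<inter> Q 2) powr \<theta>"
proof -
  define \<omega>3 where "\<omega>3 = measure lborel (ball (0::'a) (3/2))"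
  define \<omega> where "\<omega> = measure lborel (ball (0::'a) (5/4))"
  define \<beta> where "\<beta> = measure lborel (ball (0::'a) 1)"
  have \<omega>0: "\<omega>3 > 0" "\<omega> > 0" "\<beta> > 0"
    unfolding \<omega>3_def \<omega>_def \<beta>_def by (simp_all add: content_ball_pos)
  let ?S = "{-4<..<0::real} \<times> ball (0::'a) 2"
  have SB[measurable]: "?S \<in> sets borel" by (intro borel_Times) auto
  have "bounded ?S" by (intro bounded_Times) auto
  then have Sfin: "emeasure lborel ?S < \<infinity>" by (rule emeasure_bounded_finite)
  define q where "q = measure lborel ?S"
  have q0: "q \<ge> 0" by (simp add: q_def)
  have qe: "emeasure lborel ?S = ennreal q" unfolding q_def using Sfin by (intro emeasure_eq_ennreal_measure) auto
  define E where "E = (\<omega>3 + energy_growth \<gamma>2 \<gamma>3 p \<omega>3 (9/4)) / \<gamma>1"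
  have E0: "E \<ge> 0" unfolding E_def using \<omega>0 pos energy_growth_nonneg[of \<gamma>2 \<gamma>3 \<omega>3 "9/4" p] by simp
  define c where "c = iso_const TYPE('a)"
  have c0: "c \<ge> 0" unfolding c_def iso_const_def by simp
  \<comment> \<open>The first entry makes the sublevel and superlevel sets fill at least half of the
    ball at good times, so one of them has measure at least \<omega>/4. The second is the slack that
    rules out a passage.\<close>
  define \<delta> where "\<delta> = min (\<omega> / 2) (\<beta> / 32 / (4 / \<omega> + 1))"
  have \<delta>: "\<delta> > 0" "\<delta> \<le> \<omega> / 2" "(4 / \<omega> + 1) * \<delta> \<le> \<beta> / 32"
  proof -
    have k: "4 / \<omega> + 1 > 0" using \<omega>0 by (simp add: add_pos_pos)
    show "\<delta> > 0" unfolding \<delta>_def using \<omega>0 k by auto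
    show "\<delta> \<le> \<omega> / 2" unfolding \<delta>_def by (rule min.cobounded1)
    have "\<delta> \<le> \<beta> / 32 / (4 / \<omega> + 1)" unfolding \<delta>_def by simp
    then show "(4 / \<omega> + 1) * \<delta> \<le> \<beta> / 32" using k by (simp only: pos_le_divide_eq mult.commute[of \<delta>])
  qed
  obtain \<tau> where \<tau>: "\<tau> > 0" "energy_growth \<gamma>2 \<gamma>3 p \<omega>3 \<tau> \<le> \<beta> / 8"
    using ex_small_energy_growth[OF pos(2-4) \<omega>0(1), of "\<beta> / 8"] \<omega>0(3) by auto
  \<comment> \<open>As \<epsilon> \<le> q, one has \<epsilon> \<le> sqrt q sqrt \<epsilon>, so k
    sqrt \<epsilon> can serve as the bound \<open>J\<close>. The added 1 makes \<open>k\<close>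
    positive.\<close>
  define k where "k = sqrt q + c * sqrt E + 1"
  have k0: "k > 0" unfolding k_def using q0 c0 E0 by (simp add: add_nonneg_pos)
  define D where "D = 4 / \<omega> + \<omega> / \<delta>"
  have D0: "D > 0" unfolding D_def using \<omega>0 \<delta> by (simp add: add_pos_pos)
  \<comment> \<open>The value of \<epsilon> at which k sqrt \<epsilon> reaches \<delta> \<tau>/2,
    the limit of the dichotomy.\<close>
  define \<epsilon>0 where "\<epsilon>0 = (\<delta> * (\<tau> / 2) / k)\<^sup>2"
  have \<epsilon>00: "\<epsilon>0 > 0" unfolding \<epsilon>0_def using \<delta> \<tau> k0 by simp
  \<comment> \<open>One summand for each case. Below \<epsilon>0, one factor is at most D k sqrt
    \<epsilon> and the other at most \<open>q\<close>, and sqrt \<epsilon> is \<epsilon> powr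
    \<theta> times a power of exponent 1/2 - \<theta> \<ge> 0, bounded by that of \<open>q\<close>.
    From \<epsilon>0 on, both factors are at most \<open>q\<close>. The 1 makes \<open>C\<close>
    positive.\<close>
  define C where "C = q * D * k * q powr (1/2 - \<theta>) + q * q / \<epsilon>0 powr \<theta> + 1"
  have C0: "C > 0" unfolding C_def using q0 D0 k0 \<epsilon>00 by (intro add_nonneg_pos add_nonneg_nonneg) auto
  have "measure lebesgue ({z. u z \<le> 0} \<inter> Q1_minus) * measure lebesgue ({z. u z \<ge> 1/2} \<inter> Q 1)
       \<le> C * measure lebesgue ({z. 0 < u z \<and> u z < 1/2} \<inter> Q 2) powr \<theta>"
    if u: "u \<in> DG_plus (-4) 0 (ball 0 2) \<gamma>1 \<gamma>2 \<gamma>3 p" and le: "AE z in lebesgue_on (Q (3/2)). u z \<le> 1"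
    for u :: "real \<times> 'a \<Rightarrow> real"
  proof -
    obtain w H where rep: "DG_representative u w H" by (rule DG_representative_exists[OF u])
    then have w[measurable]: "w \<in> borel_measurable borel" and uw: "AE z in lborel. z \<in> ?S \<longrightarrow> u z = w z"
      by (simp_all add: DG_representative_def)
    have "(Q (3/2) :: (real \<times> 'a) set) \<in> sets borel" unfolding Q_def by (intro borel_Times) auto
    then have "AE z in lebesgue. z \<in> Q (3/2) \<longrightarrow> u z \<le> 1"
      using le by (subst (asm) AE_restrict_space_iff) auto
    then have "AE z in lborel. z \<in> Q (3/2) \<longrightarrow> u z \<le> 1" unfolding AE_completion_iff .
    from AE_lborel_pair[OF this]
    have le1: "AE t in lborel. t \<in> {-9/4<..<0} \<longrightarrow> (AE x in lborel. x \<in> ball 0 (3/2) \<longrightarrow> u (t, x) \<le> 1)"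
      by eventually_elim (auto simp: Q_def power2_eq_square)
    let ?M = "{z. 0 < w z \<and> w z < 1/2} \<inter> ?S"
    define \<epsilon> where "\<epsilon> = measure lborel ?M"
    have MB: "?M \<in> sets borel" by measurable
    have "\<epsilon> \<ge> 0" by (simp add: \<epsilon>_def)
    have "\<epsilon> \<le> q" unfolding \<epsilon>_def q_def using Sfin
      by (intro measure_mono_fmeasurable) (use MB in \<open>auto simp: fmeasurable_def\<close>)
    \<comment> \<open>An equality is needed here, since this measure stands on the right of the
      inequality and a default value 0 would be fatal. Hence measurability of the set is derived
      from that of \<open>?M\<close>.\<close>
    have \<epsilon>_eq: "measure lebesgue ({z. 0 < u z \<and> u z < 1/2} \<inter> Q 2) = \<epsilon>"
    proof -
      have "AE z in lborel. z \<in> ?M \<longleftrightarrow> z \<in> {z. 0 < u z \<and> u z < 1/2} \<inter> Q 2"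
        using uw AE_time_ne[of 0]
      proof eventually_elim
        case (elim z)
        then show ?case by (cases z) (auto simp: Q_def)
      qed
      then have ae: "AE z in lebesgue. z \<in> ?M \<longleftrightarrow> z \<in> {z. 0 < u z \<and> u z < 1/2} \<inter> Q 2"
        by (rule AE_completion)
      have "{z. 0 < u z \<and> u z < 1/2} \<inter> Q 2 \<in> sets lebesgue"
        by (rule completion.in_sets_AE[OF ae]) (use MB in auto)
      then have "emeasure lebesgue ?M = emeasure lebesgue ({z. 0 < u z \<and> u z < 1/2} \<inter> Q 2)"
        using MB by (intro emeasure_eq_AE[OF ae]) auto
      then show ?thesis unfolding \<epsilon>_def measure_def using MB by simp
    qed
    let ?F = "{z. w z \<le> 0} \<inter> ({-2<..<-1} \<times> ball 0 1)" and ?G = "{z. w z \<ge> 1/2} \<inter> ({-1<..<0} \<times> ball 0 1)"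
    have t1[measurable]: "{-2<..<-1::real} \<times> ball (0::'a) 1 \<in> sets borel" "{-1<..<0::real} \<times> ball (0::'a) 1 \<in> sets borel"
      by (intro borel_Times; simp)+
    have FG: "?F \<in> sets borel" "?G \<in> sets borel" by measurable
    have aeF: "AE z in lborel. z \<in> {z. u z \<le> 0} \<inter> Q1_minus \<longrightarrow> z \<in> ?F"
      using uw AE_time_ne[of "-1"]
    proof eventually_elim
      case (elim z)
      then show ?case by (cases z) (auto simp: Q1_minus_def)
    qed
    have aeG: "AE z in lborel. z \<in> {z. u z \<ge> 1/2} \<inter> Q 1 \<longrightarrow> z \<in> ?G"
      using uw AE_time_ne[of 0]
    proof eventually_elim
      case (elim z)
      then show ?case by (cases z) (auto simp: Q_def)
    qed
    define a where "a = measure lebesgue ({z. u z \<le> 0} \<inter> Q1_minus)"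
    define b where "b = measure lebesgue ({z. u z \<ge> 1/2} \<inter> Q 1)"
    have ab0: "a \<ge> 0" "b \<ge> 0" by (simp_all add: a_def b_def)
    have "emeasure lborel ?F \<le> ennreal q" "emeasure lborel ?G \<le> ennreal q"
      unfolding qe[symmetric] by (intro emeasure_mono; auto)+
    then have abq: "a \<le> q" "b \<le> q"
      unfolding a_def b_def using measure_lebesgue_le_lborel_AE[OF aeF FG(1) _ q0] measure_lebesgue_le_lborel_AE[OF aeG FG(2) _ q0] by auto
    have "a * b \<le> C * \<epsilon> powr \<theta>"
    proof (cases "k * sqrt \<epsilon> < \<delta> * (\<tau> / 2)")
      case True
      have J: "\<epsilon> + c * sqrt (\<epsilon> * E) \<le> k * sqrt \<epsilon>"
      proof -
        have "\<epsilon> = sqrt \<epsilon> * sqrt \<epsilon>" using \<open>\<epsilon> \<ge> 0\<close> by simp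
        also have "\<dots> \<le> sqrt q * sqrt \<epsilon>" using \<open>\<epsilon> \<ge> 0\<close> \<open>\<epsilon> \<le> q\<close> by (intro mult_right_mono) auto
        also have "\<dots> \<le> sqrt q * sqrt \<epsilon> + sqrt \<epsilon>" using \<open>\<epsilon> \<ge> 0\<close> by simp
        finally show ?thesis unfolding k_def by (simp add: real_sqrt_mult algebra_simps)
      qed
      have "emeasure lborel ?F \<le> ennreal (D * (k * sqrt \<epsilon>)) \<or> emeasure lborel ?G \<le> ennreal (D * (k * sqrt \<epsilon>))"
        unfolding D_def \<omega>_def
        by (rule DG_dichotomy[OF u pos le1 rep])
          (use \<delta> \<tau> J True in \<open>simp_all only: \<omega>3_def \<omega>_def \<beta>_def \<epsilon>_def E_def c_def\<close>)
      then have "a \<le> D * (k * sqrt \<epsilon>) \<or> b \<le> D * (k * sqrt \<epsilon>)"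
        unfolding a_def b_def using measure_lebesgue_le_lborel_AE[OF aeF FG(1)] measure_lebesgue_le_lborel_AE[OF aeG FG(2)] D0 k0 \<open>\<epsilon> \<ge> 0\<close>
        by auto
      then have "a * b \<le> q * (D * (k * sqrt \<epsilon>))"
      proof
        assume "a \<le> D * (k * sqrt \<epsilon>)"
        then have "b * a \<le> q * (D * (k * sqrt \<epsilon>))" using abq ab0 q0 by (intro mult_mono) auto
        then show ?thesis by (simp add: mult.commute)
      next
        assume "b \<le> D * (k * sqrt \<epsilon>)"
        then show ?thesis using abq ab0 q0 by (intro mult_mono) auto
      qed
      also have "sqrt \<epsilon> = \<epsilon> powr (1/2 - \<theta>) * \<epsilon> powr \<theta>"
        using \<open>\<epsilon> \<ge> 0\<close> \<theta> by (cases "\<epsilon> = 0") (auto simp: powr_half_sqrt[symmetric] powr_add[symmetric])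
      also have "q * (D * (k * (\<epsilon> powr (1/2 - \<theta>) * \<epsilon> powr \<theta>))) \<le> q * (D * (k * (q powr (1/2 - \<theta>) * \<epsilon> powr \<theta>)))"
        using q0 D0 k0 \<open>\<epsilon> \<ge> 0\<close> \<open>\<epsilon> \<le> q\<close> \<theta> by (intro mult_left_mono mult_right_mono powr_mono2) auto
      also have "\<dots> = q * D * k * q powr (1/2 - \<theta>) * \<epsilon> powr \<theta>" by (simp add: mult_ac)
      also have "\<dots> \<le> C * \<epsilon> powr \<theta>"
        unfolding C_def using q0 by (intro mult_right_mono) auto
      finally show ?thesis .
    next
      case False
      then have "\<delta> * (\<tau> / 2) / k \<le> sqrt \<epsilon>" using k0 by (simp add: field_simps)
      then have "\<epsilon>0 \<le> (sqrt \<epsilon>)\<^sup>2" unfolding \<epsilon>0_def using \<delta> \<tau> k0 by (intro power_mono) auto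
      then have "\<epsilon>0 powr \<theta> \<le> \<epsilon> powr \<theta>" using \<epsilon>00 \<open>\<epsilon> \<ge> 0\<close> \<theta> by (intro powr_mono2) auto
      then have "q * q / \<epsilon>0 powr \<theta> * \<epsilon>0 powr \<theta> \<le> q * q / \<epsilon>0 powr \<theta> * \<epsilon> powr \<theta>"
        using q0 by (intro mult_left_mono) auto
      moreover have "a * b \<le> q * q" using abq ab0 q0 by (intro mult_mono) auto
      ultimately have "a * b \<le> q * q / \<epsilon>0 powr \<theta> * \<epsilon> powr \<theta>" using \<epsilon>00 by simp
      also have "\<dots> \<le> C * \<epsilon> powr \<theta>"
        unfolding C_def using q0 D0 k0 by (intro mult_right_mono) auto
      finally show ?thesis .
    qed
    then show ?thesis unfolding a_def b_def \<epsilon>_eq .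
  qed
  then show ?thesis using C0 by (intro exI[of _ C]) blast
qed

text \<open>Since p > 0, the exponent lies strictly between 0 and 1/2. The index type of the space
  is finite and nonempty, so its dimension is an arbitrary d \<ge> 1.\<close>

theorem theorem1p3:
  fixes \<gamma>1 \<gamma>2 \<gamma>3 p :: real
  assumes "\<gamma>1 > 0" and "\<gamma>2 > 0" and "\<gamma>3 > 0" and "p > 0"
  shows "\<exists>C>0. \<forall>u :: real \<times> (real ^ 'd) \<Rightarrow> real.
     u \<in> DG_plus (-4) 0 (ball 0 2) \<gamma>1 \<gamma>2 \<gamma>3 p \<longrightarrow>
     (AE z in lebesgue_on (Q (3/2)). u z \<le> 1) \<longrightarrow>
     measure lebesgue ({z. u z \<le> 0} \<inter> Q1_minus) * measure lebesgue ({z. u z \<ge> 1/2} \<inter> Q 1)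
       \<le> C * measure lebesgue ({z. 0 < u z \<and> u z < 1/2} \<inter> Q 2) powr (1 / (4 * p + 2))"
  using assms by (intro DG_intermediate_value) (auto simp: field_simps)

end
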